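(* Let $(\Sigma,I)$ be a fixed independence alphabet. The word problem of the free partially commutative inverse monoid $\mathrm{FIM}(\Sigma,I)$ can be solved in deterministic logspace; that is, given two words $u,v\in(\Sigma\cup\overline{\Sigma})^*$, it can be decided in deterministic logarithmic space whether $u=v$ in $\mathrm{FIM}(\Sigma,I)$.
   Context: An independence alphabet is a pair $(\Sigma,I)$ with $\Sigma$ a finite set and $I\subseteq\Sigma\times\Sigma$ an irreflexive and symmetric relation. Let $\overline{\Sigma}$ be a disjoint copy of $\Sigma$ and $\Gamma=\Sigma\cup\overline{\Sigma}$. The free monoid $\Gamma^*$ is equipped with the involution given by $\overline{\overline{a}}=a$ and $\overline{a_1\cdots a_n}=\overline{a_n}\cdots\overline{a_1}$. The free inverse monoid $\mathrm{FIM}(\Sigma)$ is the quotient of $\Gamma^*$ by the defining relations $x\overline{x}x=x$, $\overline{x}x\overline{x}=\overline{x}$ and $x\overline{x}\,y\overline{y}=y\overline{y}\,x\overline{x}$ for all $x,y\in\Gamma^*$. The free partially commutative inverse monoid over $(\Sigma,I)$ is the quotient monoid $\mathrm{FIM}(\Sigma,I)=\mathrm{FIM}(\Sigma)/\{ab=ba,\ \overline{a}b=b\overline{a}\mid (a,b)\in I\}$. The independence alphabet is fixed and is not part of the input. *)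

theory Defs
  imports "HOL-Algebra.Coset" "HOL-Library.Landau_Symbols"
begin

section \<open>Quotients of monoids\<close>

inductive_set cong_gen :: "('m, 'x) monoid_scheme \<Rightarrow> ('m \<times> 'm) set \<Rightarrow> ('m \<times> 'm) set"
  for M (structure) and R where
  gen: "(x, y) \<in> R \<Longrightarrow> x \<in> carrier M \<Longrightarrow> y \<in> carrier M \<Longrightarrow> (x, y) \<in> cong_gen M R"
| refl: "x \<in> carrier M \<Longrightarrow> (x, x) \<in> cong_gen M R"
| sym: "(x, y) \<in> cong_gen M R \<Longrightarrow> (y, x) \<in> cong_gen M R"
| trans: "(x, y) \<in> cong_gen M R \<Longrightarrow> (y, z) \<in> cong_gen M R \<Longrightarrow> (x, z) \<in> cong_gen M R"
| mult: "(x, y) \<in> cong_gen M R \<Longrightarrow> (x', y') \<in> cong_gen M R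
    \<Longrightarrow> (x \<otimes> x', y \<otimes> y') \<in> cong_gen M R"

definition quot_class :: "('m, 'x) monoid_scheme \<Rightarrow> ('m \<times> 'm) set \<Rightarrow> 'm \<Rightarrow> 'm set" where
  "quot_class M R x = cong_gen M R `` {x}"

text \<open>The product of two classes is the class containing their elementwise product,
  see \<open>quot_class_mult\<close> below.\<close>

definition quot_monoid ::
    "('m, 'x) monoid_scheme \<Rightarrow> ('m \<times> 'm) set \<Rightarrow> 'm set monoid" where
  "quot_monoid M R =
    \<lparr>carrier = carrier M // cong_gen M R,
     monoid.mult = (\<lambda>X Y. cong_gen M R `` (X <#>\<^bsub>M\<^esub> Y)),
     one = quot_class M R \<one>\<^bsub>M\<^esub>\<rparr>"

lemma cong_gen_closed:
  assumes "Group.monoid M" "(x, y) \<in> cong_gen M R"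
  shows "x \<in> carrier M \<and> y \<in> carrier M"
  using assms(2) by induction (auto intro: monoid.m_closed[OF assms(1)])

lemma equiv_cong_gen:
  assumes "Group.monoid M"
  shows "equiv (carrier M) (cong_gen M R)"
proof (rule equivI)
  show "cong_gen M R \<subseteq> carrier M \<times> carrier M"
    by (auto dest: cong_gen_closed[OF assms])
  show "refl_on (carrier M) (cong_gen M R)"
    by (auto simp: refl_on_def intro: cong_gen.refl)
  show "Relation.sym (cong_gen M R)"
    by (auto intro: symI cong_gen.sym)
  show "Relation.trans (cong_gen M R)"
    by (auto intro: transI cong_gen.trans)
qed

lemma quot_class_eq_iff:
  assumes "Group.monoid M" "x \<in> carrier M" "y \<in> carrier M"
  shows "quot_class M R x = quot_class M R y \<longleftrightarrow> (x, y) \<in> cong_gen M R"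
  unfolding quot_class_def
  using eq_equiv_class_iff[OF equiv_cong_gen[OF assms(1)] assms(2,3)] .

lemma quot_class_mult:
  assumes "Group.monoid M" "x \<in> carrier M" "y \<in> carrier M"
  shows "quot_class M R x \<otimes>\<^bsub>quot_monoid M R\<^esub> quot_class M R y =
    quot_class M R (x \<otimes>\<^bsub>M\<^esub> y)"
proof -
  have "(x \<otimes>\<^bsub>M\<^esub> y, z) \<in> cong_gen M R"
    if "(x, a) \<in> cong_gen M R" "(y, b) \<in> cong_gen M R" "(a \<otimes>\<^bsub>M\<^esub> b, z) \<in> cong_gen M R" for a b z
    using that by (blast intro: cong_gen.trans cong_gen.mult)
  then show ?thesis
    using assms
    by (auto simp: quot_monoid_def quot_class_def set_mult_def intro: cong_gen.refl)
qed

lemma monoid_quot_monoid: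
  assumes "Group.monoid M"
  shows "Group.monoid (quot_monoid M R)"
proof -
  interpret Group.monoid M by fact
  have carrier: "carrier (quot_monoid M R) = quot_class M R ` carrier M"
    by (auto simp: quot_monoid_def quot_class_def quotient_def)
  have one: "\<one>\<^bsub>quot_monoid M R\<^esub> = quot_class M R \<one>\<^bsub>M\<^esub>"
    by (simp add: quot_monoid_def)
  show ?thesis
    by (rule Group.monoid.intro)
      (auto simp: carrier one quot_class_mult[OF assms] m_assoc)
qed


section \<open>Free partially commutative inverse monoids\<close>

definition independence_alphabet :: "'a set \<Rightarrow> ('a \<times> 'a) set \<Rightarrow> bool" where
  "independence_alphabet \<Sigma> I \<longleftrightarrow> finite \<Sigma> \<and> I \<subseteq> \<Sigma> \<times> \<Sigma> \<and> irrefl I \<and> Relation.sym I"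

text \<open>\<open>Inl a\<close> is the letter \<open>a\<close>, and \<open>Inr a\<close> is its formal inverse.\<close>

definition Gam :: "'a set \<Rightarrow> ('a + 'a) set" where
  "Gam \<Sigma> = \<Sigma> <+> \<Sigma>"

fun bar_letter :: "'a + 'a \<Rightarrow> 'a + 'a" where
  "bar_letter (Inl a) = Inr a"
| "bar_letter (Inr a) = Inl a"

definition bar :: "('a + 'a) list \<Rightarrow> ('a + 'a) list" where
  "bar w = rev (map bar_letter w)"

definition free_monoid :: "'b set \<Rightarrow> 'b list monoid" where
  "free_monoid A = \<lparr>carrier = lists A, monoid.mult = (@), one = []\<rparr>"

definition fim_rels :: "'a set \<Rightarrow> (('a + 'a) list \<times> ('a + 'a) list) set" where
  "fim_rels \<Sigma> =
    {(x @ bar x @ x, x) | x. x \<in> lists (Gam \<Sigma>)} \<union>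
    {(bar x @ x @ bar x, bar x) | x. x \<in> lists (Gam \<Sigma>)} \<union>
    {(x @ bar x @ y @ bar y, y @ bar y @ x @ bar x) | x y.
      x \<in> lists (Gam \<Sigma>) \<and> y \<in> lists (Gam \<Sigma>)}"

definition FIM :: "'a set \<Rightarrow> ('a + 'a) list set monoid" where
  "FIM \<Sigma> = quot_monoid (free_monoid (Gam \<Sigma>)) (fim_rels \<Sigma>)"

definition fim_val :: "'a set \<Rightarrow> ('a + 'a) list \<Rightarrow> ('a + 'a) list set" where
  "fim_val \<Sigma> w = quot_class (free_monoid (Gam \<Sigma>)) (fim_rels \<Sigma>) w"

definition comm_rels ::
    "'a set \<Rightarrow> ('a \<times> 'a) set \<Rightarrow> (('a + 'a) list set \<times> ('a + 'a) list set) set" where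
  "comm_rels \<Sigma> I =
    {(fim_val \<Sigma> [Inl a, Inl b], fim_val \<Sigma> [Inl b, Inl a]) | a b. (a, b) \<in> I} \<union>
    {(fim_val \<Sigma> [Inr a, Inl b], fim_val \<Sigma> [Inl b, Inr a]) | a b. (a, b) \<in> I}"

definition FPCIM :: "'a set \<Rightarrow> ('a \<times> 'a) set \<Rightarrow> ('a + 'a) list set set monoid" where
  "FPCIM \<Sigma> I = quot_monoid (FIM \<Sigma>) (comm_rels \<Sigma> I)"

definition fpcim_val ::
    "'a set \<Rightarrow> ('a \<times> 'a) set \<Rightarrow> ('a + 'a) list \<Rightarrow> ('a + 'a) list set set" where
  "fpcim_val \<Sigma> I w = quot_class (FIM \<Sigma>) (comm_rels \<Sigma> I) (fim_val \<Sigma> w)"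

lemma monoid_free_monoid: "Group.monoid (free_monoid A)"
  by (rule Group.monoid.intro) (auto simp: free_monoid_def)

lemma monoid_FIM: "Group.monoid (FIM \<Sigma>)"
  unfolding FIM_def by (intro monoid_quot_monoid monoid_free_monoid)

lemma monoid_FPCIM: "Group.monoid (FPCIM \<Sigma> I)"
  unfolding FPCIM_def by (intro monoid_quot_monoid monoid_FIM)

lemma fim_val_hom: "fim_val \<Sigma> \<in> hom (free_monoid (Gam \<Sigma>)) (FIM \<Sigma>)"
  unfolding FIM_def
  by (auto simp: hom_def fim_val_def quot_class_mult[OF monoid_free_monoid])
    (auto simp: quot_monoid_def quot_class_def intro: quotientI)

lemma fpcim_val_hom: "fpcim_val \<Sigma> I \<in> hom (free_monoid (Gam \<Sigma>)) (FPCIM \<Sigma> I)"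
proof -
  have "quot_class (FIM \<Sigma>) (comm_rels \<Sigma> I) \<in> hom (FIM \<Sigma>) (FPCIM \<Sigma> I)"
    unfolding FPCIM_def
    by (auto simp: hom_def quot_class_mult[OF monoid_FIM])
      (auto simp: quot_monoid_def quot_class_def intro: quotientI)
  then show ?thesis
    using fim_val_hom[of \<Sigma>] by (auto simp: hom_def fpcim_val_def)
qed

text \<open>An instance \<open>(u, v)\<close> of the word problem is encoded as \<open>u # v\<close>, where the separator
  \<open>#\<close> is the letter \<^term>\<open>None\<close>.\<close>

definition pair_word :: "'b list \<Rightarrow> 'b list \<Rightarrow> 'b option list" where
  "pair_word u v = map Some u @ [None] @ map Some v"

definition pair_alphabet :: "'b set \<Rightarrow> 'b option set" where
  "pair_alphabet A = insert None (Some ` A)"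

definition FPCIM_word_problem :: "'a set \<Rightarrow> ('a \<times> 'a) set \<Rightarrow> ('a + 'a) option list set" where
  "FPCIM_word_problem \<Sigma> I =
    {pair_word u v | u v. u \<in> lists (Gam \<Sigma>) \<and> v \<in> lists (Gam \<Sigma>) \<and>
      fpcim_val \<Sigma> I u = fpcim_val \<Sigma> I v}"


section \<open>Deterministic logarithmic space\<close>

text \<open>Deterministic Turing machines with a read-only input tape, delimited by end markers, and
  a fixed number of two-way infinite work tapes. States and work symbols are initial segments
  of the natural numbers; the work symbol \<open>0\<close> is the blank. The transition function maps a
  state, the scanned input symbol and the scanned work symbols to a new state, a move of the
  input head and, for each work tape, a symbol to write and a head move.\<close>

datatype 'c input_symbol = Left_End | Input 'c | Right_End

datatype head_move = Go_Left | Stay | Go_Right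

record 'c tm =
  num_states :: nat
  num_symbols :: nat
  num_tapes :: nat
  start_state :: nat
  accept_state :: nat
  reject_state :: nat
  trans_fun :: "nat \<Rightarrow> 'c input_symbol \<Rightarrow> nat list \<Rightarrow> nat \<times> head_move \<times> (nat \<times> head_move) list"

definition wf_tm :: "'c set \<Rightarrow> 'c tm \<Rightarrow> bool" where
  "wf_tm A M \<longleftrightarrow>
    start_state M < num_states M \<and> accept_state M < num_states M \<and>
    reject_state M < num_states M \<and> accept_state M \<noteq> reject_state M \<and>
    0 < num_symbols M \<and>
    (\<forall>q < num_states M. \<forall>c \<in> {Left_End, Right_End} \<union> Input ` A. \<forall>ss.
      length ss = num_tapes M \<and> set ss \<subseteq> {..<num_symbols M} \<longrightarrow>
      (case trans_fun M q c ss of (q', d, acts) \<Rightarrow>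
        q' < num_states M \<and> length acts = num_tapes M \<and>
        fst ` set acts \<subseteq> {..<num_symbols M}))"

text \<open>A configuration consists of the state, the position of the input head (position \<open>0\<close> is the
  left end marker, position \<open>length w + 1\<close> the right one) and, for each work tape, the
  head position and the tape contents.\<close>

type_synonym tm_config = "nat \<times> nat \<times> (int \<times> (int \<Rightarrow> nat)) list"

definition input_at :: "'c list \<Rightarrow> nat \<Rightarrow> 'c input_symbol" where
  "input_at w p =
    (if p = 0 then Left_End else if p \<le> length w then Input (w ! (p - 1)) else Right_End)"

text \<open>The input head does not leave the region delimited by the end markers.\<close>

fun move_input :: "nat \<Rightarrow> head_move \<Rightarrow> nat \<Rightarrow> nat" where
  "move_input n Go_Left p = p - 1"
| "move_input n Stay p = p"
| "move_input n Go_Right p = min (n + 1) (p + 1)"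

fun move_work :: "head_move \<Rightarrow> int \<Rightarrow> int" where
  "move_work Go_Left h = h - 1"
| "move_work Stay h = h"
| "move_work Go_Right h = h + 1"

definition tm_init :: "'c tm \<Rightarrow> tm_config" where
  "tm_init M = (start_state M, 0, replicate (num_tapes M) (0, \<lambda>_. 0))"

fun tm_step :: "'c tm \<Rightarrow> 'c list \<Rightarrow> tm_config \<Rightarrow> tm_config" where
  "tm_step M w (q, p, ts) =
    (if q = accept_state M \<or> q = reject_state M then (q, p, ts)
     else case trans_fun M q (input_at w p) (map (\<lambda>(h, T). T h) ts) of (q', d, acts) \<Rightarrow>
       (q', move_input (length w) d p,
        map2 (\<lambda>(h, T) (s, e). (move_work e h, T(h := s))) ts acts))"

definition tm_run :: "'c tm \<Rightarrow> 'c list \<Rightarrow> nat \<Rightarrow> tm_config" where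
  "tm_run M w t = (tm_step M w ^^ t) (tm_init M)"

definition tm_decides :: "'c set \<Rightarrow> 'c tm \<Rightarrow> 'c list set \<Rightarrow> bool" where
  "tm_decides A M L \<longleftrightarrow>
    (\<forall>w \<in> lists A. \<exists>t.
      fst (tm_run M w t) = (if w \<in> L then accept_state M else reject_state M))"

text \<open>The work cells, as pairs of a tape index and a position, that are scanned during the
  computation; the input tape does not count.\<close>

definition work_cells :: "'c tm \<Rightarrow> 'c list \<Rightarrow> (nat \<times> int) set" where
  "work_cells M w = {(i, fst (snd (snd (tm_run M w t)) ! i)) | i t. i < num_tapes M}"

definition tm_space :: "'c set \<Rightarrow> 'c tm \<Rightarrow> (nat \<Rightarrow> nat) \<Rightarrow> bool" where
  "tm_space A M s \<longleftrightarrow>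
    (\<forall>w \<in> lists A. finite (work_cells M w) \<and> card (work_cells M w) \<le> s (length w))"

definition in_DSPACE :: "(nat \<Rightarrow> nat) \<Rightarrow> 'c set \<Rightarrow> 'c list set \<Rightarrow> bool" where
  "in_DSPACE s A L \<longleftrightarrow>
    finite A \<and> L \<subseteq> lists A \<and> (\<exists>M. wf_tm A M \<and> tm_decides A M L \<and> tm_space A M s)"

definition in_DLOGSPACE :: "'c set \<Rightarrow> 'c list set \<Rightarrow> bool" where
  "in_DLOGSPACE A L \<longleftrightarrow>
    (\<exists>s. (\<lambda>n. real (s n)) \<in> O(\<lambda>n. log 2 (real n)) \<and> in_DSPACE s A L)"

end

theory Submission
  imports Defs "HOL-Number_Theory.Cong"
begin

text \<open>Let a word over the generators act on integer vectors by the numbers game of the right-angled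
  Coxeter group with two reflections \<open>(a, False)\<close>, \<open>(a, True)\<close> for each \<open>a \<in> \<Sigma>\<close>, the generator \<open>a\<close>
  being their product. This represents the graph group \<open>G(\<Sigma>, I)\<close> faithfully, and suitable start
  vectors have the subgroups generated by links as stabilizers. Hence the image of such a vector
  names a hyperplane of the Cayley graph of \<open>G(\<Sigma>, I)\<close>, seen as a median graph. Two words are equal
  in the free partially commutative inverse monoid iff their paths have the same endpoint and the
  same convex hull, and the hull is determined by the hyperplanes that the path crosses. So each
  word has a finite set of labels, and equality of words is equality of label sets.

  A label is computed by one scan of the input, and its entries are bounded by \<open>2 \<cdot> 9\<^sup>n\<close>. Since
  \<open>k \<cdot> (2k choose k) \<ge> 2\<^sup>k\<close> divides every common multiple of \<open>1, \<dots>, 2k\<close>, two labels are equal iff they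
  are congruent modulo all \<open>m \<le> 8n + 6\<close>. A program whose counters are bounded by a linear function of
  \<open>n\<close> checks this, and such a program runs on a Turing machine with one binary counter on each tape.\<close>


section \<open>The numbers game\<close>

text \<open>An exact label does not fit into logarithmic space, since its entries can have linearly
  many bits. Residues modulo a small number do fit, but not for all moduli at once, so each pair of
  positions is scanned afresh for every modulus. Hyperplanes are used instead of the vertices of the
  hull because the hull can have many vertices off the path, while every hyperplane that cuts the
  hull is crossed by the path itself and can be found by stopping at each letter. The detour through
  a Coxeter group pays off in normal forms: the sign of a vector at a site tells which letter can be
  moved to the end of a word and cancelled, so orbits and stabilizers are computed without geometry.
  Two reflections for each generator are needed because a single one has order two. The hull enters
  only algebraically: a word \<open>p\<close> stays inside the hull of \<open>u\<close> iff the
  idempotent \<open>p @ bar p\<close> fixes \<open>u\<close> from the left.\<close>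

fun gen :: "'a + 'a \<Rightarrow> 'a" where
  "gen (Inl a) = a"
| "gen (Inr a) = a"

fun site :: "'a + 'a \<Rightarrow> 'a \<times> bool" where
  "site (Inl a) = (a, False)"
| "site (Inr a) = (a, True)"

lemma bar_letter_bar_letter [simp]: "bar_letter (bar_letter c) = c"
  by (cases c) auto

lemma gen_bar_letter [simp]: "gen (bar_letter c) = gen c"
  by (cases c) auto

lemma fst_site [simp]: "fst (site c) = gen c"
  by (cases c) auto

lemma site_bar_neq [simp]: "site (bar_letter c) \<noteq> site c" "site c \<noteq> site (bar_letter c)"
  by (cases c; simp)+

lemma mem_Gam_iff: "c \<in> Gam \<Sigma> \<longleftrightarrow> gen c \<in> \<Sigma>"
  by (cases c) (auto simp: Gam_def)

lemma bar_Nil [simp]: "bar [] = []"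
  and bar_Cons [simp]: "bar (c # w) = bar w @ [bar_letter c]"
  and bar_append [simp]: "bar (u @ v) = bar v @ bar u"
  by (auto simp: bar_def)

lemma bar_bar [simp]: "bar (bar w) = w"
  by (induction w) auto

lemma bar_in_lists [simp]: "bar w \<in> lists (Gam \<Sigma>) \<longleftrightarrow> w \<in> lists (Gam \<Sigma>)"
  by (auto simp: bar_def mem_Gam_iff)

section \<open>Commutation and cancellation of letters\<close>

context
  fixes I :: "('a \<times> 'a) set"
begin

inductive swaps :: "('a + 'a) list \<Rightarrow> ('a + 'a) list \<Rightarrow> bool" where
  swaps_refl: "swaps w w"
| swaps_trans: "swaps u v \<Longrightarrow> swaps v w \<Longrightarrow> swaps u w"
| swaps_step: "(gen c, gen d) \<in> I \<Longrightarrow> swaps (p @ c # d # q) (p @ d # c # q)"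

text \<open>Cancellation goes in one direction only. In the inverse monoid a word lies below each of
  its reducts in the natural partial order (\<open>reduces_below\<close>); insertions of
  \<open>c\<close> and its inverse would destroy this.\<close>

inductive reduces :: "('a + 'a) list \<Rightarrow> ('a + 'a) list \<Rightarrow> bool" where
  reduces_refl: "reduces w w"
| reduces_trans: "reduces u v \<Longrightarrow> reduces v w \<Longrightarrow> reduces u w"
| reduces_swap: "(gen c, gen d) \<in> I \<Longrightarrow> reduces (p @ c # d # q) (p @ d # c # q)"
| reduces_cancel: "reduces (p @ c # bar_letter c # q) (p @ q)"

lemma swaps_context: "swaps u v \<Longrightarrow> swaps (p @ u @ q) (p @ v @ q)"
proof (induction rule: swaps.induct)
  case (swaps_step c d p' q')
  show ?case
    using swaps.swaps_step[OF swaps_step, of "p @ p'" "q' @ q"] by simp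
qed (auto intro: swaps.intros)

lemma reduces_context: "reduces u v \<Longrightarrow> reduces (p @ u @ q) (p @ v @ q)"
proof (induction rule: reduces.induct)
  case (reduces_swap c d p' q')
  show ?case
    using reduces.reduces_swap[OF reduces_swap, of "p @ p'" "q' @ q"] by simp
next
  case (reduces_cancel p' c q')
  show ?case
    using reduces.reduces_cancel[of "p @ p'" c "q' @ q"] by simp
qed (auto intro: reduces.intros)

lemma swaps_imp_reduces: "swaps u v \<Longrightarrow> reduces u v"
  by (induction rule: swaps.induct) (auto intro: reduces.intros)

lemma swaps_commute:
  assumes "\<And>d. d \<in> set w \<Longrightarrow> (gen d, gen c) \<in> I"
  shows "swaps (w @ [c]) (c # w)"
  using assms
proof (induction w)
  case (Cons d w)
  have "swaps (d # w @ [c]) (d # c # w)"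
    using swaps_context[of "w @ [c]" "c # w" "[d]" "[]"] Cons by simp
  moreover have "swaps (d # c # w) (c # d # w)"
    using swaps_step[of d c "[]" w] Cons.prems by simp
  ultimately show ?case
    by (auto intro: swaps_trans)
qed (auto intro: swaps_refl)

end

section \<open>The action of words on integer vectors\<close>

locale numbers_game =
  fixes \<Sigma> :: "'a set" and I :: "('a \<times> 'a) set"
  assumes sym_I: "Relation.sym I" and irrefl_I: "irrefl I"
begin

lemma I_sym: "(a, b) \<in> I \<Longrightarrow> (b, a) \<in> I"
  using sym_I by (auto dest: symD)

lemma I_irrefl [simp]: "(a, a) \<notin> I"
  using irrefl_I by (auto simp: irrefl_def)

lemma reduces_bar: "reduces I u v \<Longrightarrow> reduces I (bar u) (bar v)"
proof (induction rule: reduces.induct)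
  case (reduces_swap c d p q)
  then show ?case
    using reduces.reduces_swap[of "bar_letter d" "bar_letter c" I "bar q" "bar p"]
    by (simp add: I_sym)
next
  case (reduces_cancel p c q)
  show ?case
    using reduces.reduces_cancel[of I "bar q" c "bar p"] by simp
qed (auto intro: reduces.intros)

text \<open>The edges of the Coxeter diagram, all with label infinity. As \<open>I\<close> is
  irreflexive, the two sites of a generator are joined, so the product of their reflections has
  infinite order.\<close>

definition nbr :: "'a \<times> bool \<Rightarrow> 'a \<times> bool \<Rightarrow> bool" where
  "nbr s t \<longleftrightarrow> s \<noteq> t \<and> fst s \<in> \<Sigma> \<and> fst t \<in> \<Sigma> \<and> (fst s, fst t) \<notin> I"

text \<open>The contragredient of a reflection of the geometric representation. The weight 2 is
  \<open>- 2 * B(s, t)\<close>, where \<open>B(s, t) = - 1\<close> is the value of the form for a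
  product of infinite order.\<close>

definition fire :: "'a \<times> bool \<Rightarrow> ('a \<times> bool \<Rightarrow> int) \<Rightarrow> 'a \<times> bool \<Rightarrow> int" where
  "fire s f = (\<lambda>t. if t = s then - f s else if nbr s t then f t + 2 * f s else f t)"

definition act :: "'a + 'a \<Rightarrow> ('a \<times> bool \<Rightarrow> int) \<Rightarrow> 'a \<times> bool \<Rightarrow> int" where
  "act c f = fire (site (bar_letter c)) (fire (site c) f)"

definition acts :: "('a + 'a) list \<Rightarrow> ('a \<times> bool \<Rightarrow> int) \<Rightarrow> 'a \<times> bool \<Rightarrow> int" where
  "acts = fold act"

lemma acts_simps [simp]:
  "acts [] f = f" "acts (c # w) f = acts w (act c f)" "acts (u @ v) f = acts v (acts u f)"
  by (auto simp: acts_def)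

lemma nbr_sym: "nbr s t \<Longrightarrow> nbr t s"
  by (auto simp: nbr_def I_sym)

lemma nbr_irrefl [simp]: "\<not> nbr s s"
  by (simp add: nbr_def)

lemma nbr_site_bar: "gen c \<in> \<Sigma> \<Longrightarrow> nbr (site c) (site (bar_letter c))"
  by (cases c) (auto simp: nbr_def)

lemma fire_fire [simp]: "fire s (fire s f) = f"
  by (auto simp: fire_def fun_eq_iff)

lemma fire_commute:
  assumes "\<not> nbr s t" "s \<noteq> t"
  shows "fire s (fire t f) = fire t (fire s f)"
  using assms nbr_sym[of t s] by (auto simp: fire_def fun_eq_iff)

lemma act_bar_act [simp]: "act (bar_letter c) (act c f) = f" "act c (act (bar_letter c) f) = f"
  by (simp_all add: act_def)

lemma acts_bar_acts [simp]: "acts (bar w) (acts w f) = f" "acts w (acts (bar w) f) = f"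
  by (induction w arbitrary: f) auto

lemma act_commute:
  assumes "(gen c, gen d) \<in> I"
  shows "act c (act d f) = act d (act c f)"
proof -
  have "\<not> nbr s t" "s \<noteq> t" if "fst s = gen c" "fst t = gen d" for s t
    using that assms by (auto simp: nbr_def)
  then have comm: "fire s (fire t g) = fire t (fire s g)"
    if "fst s = gen c" "fst t = gen d" for s t g
    using that fire_commute by blast
  let ?s = "site c" and ?s' = "site (bar_letter c)" and ?t = "site d" and ?t' = "site (bar_letter d)"
  have "fire ?s' (fire ?s (fire ?t' (fire ?t f))) = fire ?s' (fire ?t' (fire ?t (fire ?s f)))"
    using comm[of ?s ?t' "fire ?t f"] comm[of ?s ?t f] by simp
  also have "\<dots> = fire ?t' (fire ?t (fire ?s' (fire ?s f)))"
    using comm[of ?s' ?t' "fire ?t (fire ?s f)"] comm[of ?s' ?t "fire ?s f"] by simp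
  finally show ?thesis
    by (simp add: act_def)
qed

lemma acts_reduces: "reduces I u v \<Longrightarrow> acts u f = acts v f"
proof (induction rule: reduces.induct)
  case (reduces_swap c d p q)
  then show ?case
    using act_commute[of c d "acts p f"] by simp
qed auto

lemma act_zero: "f (site c) = 0 \<Longrightarrow> f (site (bar_letter c)) = 0 \<Longrightarrow> act c f = f"
  by (auto simp: act_def fire_def fun_eq_iff)

lemma act_other:
  assumes "(gen c, fst t) \<in> I"
  shows "act c f t = f t"
  using assms by (auto simp: act_def fire_def nbr_def)

text \<open>A negative value is dominated by all its neighbours. Firing a positive site preserves this,
  so that the sites that were fired last are exactly the negative ones.\<close>

definition dominated :: "('a \<times> bool \<Rightarrow> int) \<Rightarrow> bool" where
  "dominated f \<longleftrightarrow> (\<forall>s t. nbr s t \<longrightarrow> f t < 0 \<longrightarrow> - f t < f s)"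

lemma dominatedD: "dominated f \<Longrightarrow> nbr s t \<Longrightarrow> f t < 0 \<Longrightarrow> - f t < f s"
  unfolding dominated_def by blast

text \<open>After the move each neighbour of \<open>s\<close> exceeds the old value of
  \<open>s\<close>, because before it was more than minus that value. So no neighbour of
  \<open>s\<close> is negative, any other negative site keeps its value, and the values around it
  can only grow.\<close>

lemma dominated_fire:
  assumes "dominated f" "0 < f s"
  shows "dominated (fire s f)"
  unfolding dominated_def
proof (intro allI impI)
  fix x t assume xt: "nbr x t" and neg: "fire s f t < 0"
  have nbr_pos: "f s < fire s f y" if "nbr s y" for y
  proof -
    have "- f y < f s" if "f y < 0"
      using dominatedD[OF assms(1) \<open>nbr s y\<close>] that by simp
    then show ?thesis
      using that assms(2) by (auto simp: fire_def) linarith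
  qed
  show "- fire s f t < fire s f x"
  proof (cases "t = s")
    case True
    then show ?thesis
      using nbr_pos[of x] xt nbr_sym by (auto simp: fire_def)
  next
    case False
    then have "\<not> nbr s t"
      using nbr_pos[of t] neg assms(2) by auto
    then have ft: "fire s f t = f t" and "x \<noteq> s"
      using False xt by (auto simp: fire_def)
    then have "f x \<le> fire s f x"
      using assms(2) by (auto simp: fire_def)
    then show ?thesis
      using dominatedD[OF assms(1) xt] neg ft by simp
  qed
qed

text \<open>Firing \<open>site c\<close> makes it negative, so domination makes its partner positive
  and the second firing is legal too; this is why \<open>goods\<close> asks for positivity at
  \<open>site c\<close> only. Afterwards the partner is negative, and every other site that does not
  commute with \<open>c\<close> is a neighbour of it, hence positive. The negative site thus
  remembers the last letter.\<close>

lemma act_good: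
  assumes "dominated f" "0 < f (site c)" "gen c \<in> \<Sigma>"
  shows "dominated (act c f)"
    and "act c f (site (bar_letter c)) < 0"
    and "\<And>t. fst t \<in> \<Sigma> \<Longrightarrow> (gen c, fst t) \<notin> I \<Longrightarrow> t \<noteq> site (bar_letter c) \<Longrightarrow> 0 < act c f t"
proof -
  let ?s = "site c" and ?t = "site (bar_letter c)" and ?g = "fire (site c) f"
  have st: "nbr ?s ?t"
    by (rule nbr_site_bar[OF assms(3)])
  have g: "dominated ?g"
    by (rule dominated_fire[OF assms(1,2)])
  have "?g ?s < 0"
    using assms(2) by (simp add: fire_def)
  then have pos: "0 < ?g ?t"
    using dominatedD[OF g nbr_sym[OF st]] by simp
  show dom: "dominated (act c f)"
    unfolding act_def by (rule dominated_fire[OF g pos])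
  show neg: "act c f ?t < 0"
    using pos by (simp add: act_def fire_def)
  fix t assume "fst t \<in> \<Sigma>" "(gen c, fst t) \<notin> I" "t \<noteq> ?t"
  then have "nbr t ?t"
    using assms(3) I_sym by (auto simp: nbr_def)
  then show "0 < act c f t"
    using dominatedD[OF dom _ neg] neg by fastforce
qed

section \<open>Positive firing sequences and normal forms\<close>

fun goods :: "('a \<times> bool \<Rightarrow> int) \<Rightarrow> ('a + 'a) list \<Rightarrow> bool" where
  "goods f [] = True"
| "goods f (c # w) \<longleftrightarrow> gen c \<in> \<Sigma> \<and> 0 < f (site c) \<and> goods (act c f) w"

lemma goods_append [simp]: "goods f (u @ v) \<longleftrightarrow> goods f u \<and> goods (acts u f) v"
  by (induction u arbitrary: f) auto

text \<open>Vectors of the closed fundamental chamber. The two sites of a generator vanish together,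
  so that at a start vector each letter either is legal or acts trivially.\<close>

definition start :: "('a \<times> bool \<Rightarrow> int) \<Rightarrow> bool" where
  "start f \<longleftrightarrow> (\<forall>s. 0 \<le> f s) \<and> (\<forall>a. f (a, False) = 0 \<longleftrightarrow> f (a, True) = 0)"

lemma start_nonneg: "start f \<Longrightarrow> 0 \<le> f s"
  unfolding start_def by blast

lemma start_zero: "start f \<Longrightarrow> f (site c) = 0 \<Longrightarrow> f (site (bar_letter c)) = 0"
  by (cases c) (auto simp: start_def)

lemma dominated_start: "start f \<Longrightarrow> dominated f"
  unfolding dominated_def using start_nonneg not_less by blast

lemma dominated_acts: "dominated f \<Longrightarrow> goods f w \<Longrightarrow> dominated (acts w f)"
  by (induction w arbitrary: f) (auto simp: act_good)

lemma goods_negative: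
  assumes "dominated f" "goods f (w @ [c])"
  shows "acts (w @ [c]) f (site (bar_letter c)) < 0"
  using act_good(2)[OF dominated_acts[OF assms(1)]] assms(2) by simp

text \<open>The descent property. If the last letter commutes with \<open>c\<close>, it does not
  change the value at \<open>site c\<close> and can be moved out of the way. Otherwise
  \<open>act_good\<close> leaves only one negative candidate, so the last letter is already the
  inverse of \<open>c\<close>.\<close>

lemma goods_descent:
  assumes "start f" "goods f w" "acts w f (site c) < 0" "gen c \<in> \<Sigma>"
  shows "\<exists>w'. swaps I w (w' @ [bar_letter c]) \<and> goods f w' \<and> length w' < length w"
  using assms(2-)
proof (induction w rule: rev_induct)
  case Nil
  then show ?case
    using start_nonneg[OF assms(1), of "site c"] by simp
next
  case (snoc d w)
  have dom: "dominated (acts w f)"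
    using dominated_acts[OF dominated_start[OF assms(1)]] snoc.prems by simp
  show ?case
  proof (cases "(gen d, gen c) \<in> I")
    case True
    then have "acts w f (site c) < 0"
      using snoc.prems act_other[of d "site c"] by simp
    then obtain w' where w': "swaps I w (w' @ [bar_letter c])" "goods f w'" "length w' < length w"
      using snoc by auto
    have "acts w f = act (bar_letter c) (acts w' f)"
      using acts_reduces[OF swaps_imp_reduces[OF w'(1)], of f] by simp
    then have "acts w f (site d) = acts w' f (site d)"
      using act_other[of "bar_letter c" "site d"] I_sym[OF True] by simp
    then have "goods f (w' @ [d])"
      using w' snoc.prems by simp
    moreover have "swaps I (w @ [d]) (w' @ [bar_letter c] @ [d])"
      using swaps_context[OF w'(1), of "[]" "[d]"] by simp
    moreover have "swaps I (w' @ [bar_letter c] @ [d]) ((w' @ [d]) @ [bar_letter c])"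
      using swaps_step[of "bar_letter c" d I w' "[]"] I_sym[OF True] by simp
    ultimately show ?thesis
      using w'(3) by (intro exI[of _ "w' @ [d]"]) (auto intro: swaps_trans)
  next
    case False
    then have "site c = site (bar_letter d)"
      using act_good(3)[OF dom, of d "site c"] snoc.prems by force
    then have "bar_letter c = d"
      by (cases c; cases d) auto
    then show ?thesis
      using snoc.prems by (intro exI[of _ w]) (auto intro: swaps_refl)
  qed
qed

text \<open>A last letter that does not commute with \<open>c\<close> leaves a strictly positive or
  negative value at \<open>site c\<close>, never zero. So zeros can only survive from
  \<open>f\<close>.\<close>

lemma goods_zero:
  assumes "start f" "goods f w" "acts w f (site c) = 0" "gen c \<in> \<Sigma>"
  shows "f (site c) = 0 \<and> (\<forall>d \<in> set w. (gen d, gen c) \<in> I)"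
  using assms(2-)
proof (induction w rule: rev_induct)
  case (snoc d w)
  have dom: "dominated (acts w f)"
    using dominated_acts[OF dominated_start[OF assms(1)]] snoc.prems by simp
  have "(gen d, gen c) \<in> I"
  proof (rule ccontr)
    assume "(gen d, gen c) \<notin> I"
    then show False
      using act_good(2)[OF dom, of d] act_good(3)[OF dom, of d "site c"] snoc.prems
      by (cases "site c = site (bar_letter d)") auto
  qed
  moreover from this have "acts w f (site c) = 0"
    using snoc.prems act_other[of d "site c"] by simp
  ultimately show ?case
    using snoc by auto
qed simp

lemma acts_zero:
  assumes "start f" "\<And>c. c \<in> set k \<Longrightarrow> f (site c) = 0"
  shows "acts k f = f"
  using assms(2) by (induction k) (auto simp: act_zero start_zero[OF assms(1)])

text \<open>A factorization along the stabilizer: \<open>k\<close> acts first and fixes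
  \<open>f\<close>. A new letter extends \<open>n\<close> if its site is positive, commutes past
  \<open>n\<close> into \<open>k\<close> if the value is zero, and cancels against the end of
  \<open>n\<close> by \<open>goods_descent\<close> if it is negative.\<close>

lemma normal_form:
  assumes "start f" "w \<in> lists (Gam \<Sigma>)"
  shows "\<exists>k n. reduces I w (k @ n) \<and> goods f n \<and> (\<forall>c \<in> set k. f (site c) = 0)"
  using assms(2)
proof (induction w rule: rev_induct)
  case Nil
  have "reduces I [] ([] @ [])"
    by (simp add: reduces_refl)
  then show ?case
    by fastforce
next
  case (snoc c w)
  then obtain k n where kn: "reduces I w (k @ n)" "goods f n" "\<forall>c \<in> set k. f (site c) = 0"
    by auto
  have c: "gen c \<in> \<Sigma>"
    using snoc.prems by (simp add: mem_Gam_iff)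
  have red: "reduces I (w @ [c]) (k @ n @ [c])"
    using reduces_context[OF kn(1), of "[]" "[c]"] by simp
  consider "0 < acts n f (site c)" | "acts n f (site c) = 0" | "acts n f (site c) < 0"
    by linarith
  then show ?case
  proof cases
    case 1
    then show ?thesis
      using kn red c by (intro exI[of _ k] exI[of _ "n @ [c]"]) auto
  next
    case 2
    then have z: "f (site c) = 0" "\<forall>d \<in> set n. (gen d, gen c) \<in> I"
      using goods_zero[OF assms(1) kn(2) _ c] by auto
    then have "reduces I (k @ n @ [c]) (k @ [c] @ n)"
      using swaps_imp_reduces[OF swaps_commute[of n c I]]
        reduces_context[of I "n @ [c]" "c # n" k "[]"] by simp
    then have "reduces I (w @ [c]) ((k @ [c]) @ n)"
      using red by (auto intro: reduces_trans)
    then show ?thesis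
      using kn z by (intro exI[of _ "k @ [c]"] exI[of _ n]) auto
  next
    case 3
    then obtain n' where n': "swaps I n (n' @ [bar_letter c])" "goods f n'"
      using goods_descent[OF assms(1) kn(2) _ c] by blast
    have "reduces I (k @ n @ [c]) (k @ (n' @ [bar_letter c]) @ [c])"
      using reduces_context[OF swaps_imp_reduces[OF n'(1)]] by blast
    moreover have "reduces I (k @ (n' @ [bar_letter c]) @ [c]) (k @ n')"
      using reduces_cancel[of I "k @ n'" "bar_letter c" "[]"] by simp
    ultimately have "reduces I (w @ [c]) (k @ n')"
      using red by (blast intro: reduces_trans)
    then show ?thesis
      using kn n' by blast
  qed
qed

text \<open>The last letter of \<open>m\<close> is visible as a negative value of the common result,
  so \<open>goods_descent\<close> moves the same letter to the end of \<open>n\<close>, and both can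
  be stripped. A result without negative values comes from the empty word only.\<close>

lemma goods_unique:
  assumes "start f" "start g" "goods f m" "goods g n" "acts m f = acts n g"
  shows "f = g \<and> swaps I n m"
  using assms(3-)
proof (induction m arbitrary: n rule: rev_induct)
  case Nil
  then have "n = []"
  proof (cases n rule: rev_cases)
    case (snoc n' c)
    then have "acts n g (site (bar_letter c)) < 0"
      using goods_negative[OF dominated_start[OF assms(2)], of n' c] Nil.prems by simp
    then show ?thesis
      using start_nonneg[OF assms(1), of "site (bar_letter c)"] Nil.prems by simp
  qed auto
  then show ?case
    using Nil.prems by (auto intro: swaps_refl)
next
  case (snoc c m)
  have "acts n g (site (bar_letter c)) < 0"
    using goods_negative[OF dominated_start[OF assms(1)], of m c] snoc.prems by simp
  then obtain n' where n': "swaps I n (n' @ [c])" "goods g n'"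
    using goods_descent[OF assms(2) snoc.prems(2), of "bar_letter c"] snoc.prems(1) by auto
  have "act c (acts m f) = act c (acts n' g)"
    using acts_reduces[OF swaps_imp_reduces[OF n'(1)], of g] snoc.prems by simp
  then have "acts m f = acts n' g"
    by (metis act_bar_act(1))
  then have "f = g \<and> swaps I n' m"
    using snoc n' by simp
  then show ?case
    using n'(1) swaps_context[of I n' m "[]" "[c]"] by (auto intro: swaps_trans)
qed

text \<open>Start vectors form a fundamental domain, so equal images force equal start vectors. The
  words then differ only by factors from the stabilizer in front, that is, they represent the same
  coset.\<close>

lemma common_normal_form:
  assumes "start f" "start g" "u \<in> lists (Gam \<Sigma>)" "v \<in> lists (Gam \<Sigma>)" "acts u f = acts v g"
  shows "f = g \<and> (\<exists>k l n. reduces I u (k @ n) \<and> reduces I v (l @ n) \<and>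
    (\<forall>c \<in> set k. f (site c) = 0) \<and> (\<forall>c \<in> set l. f (site c) = 0))"
proof -
  obtain k m where km: "reduces I u (k @ m)" "goods f m" "\<forall>c \<in> set k. f (site c) = 0"
    using normal_form[OF assms(1,3)] by auto
  obtain l n where ln: "reduces I v (l @ n)" "goods g n" "\<forall>c \<in> set l. g (site c) = 0"
    using normal_form[OF assms(2,4)] by auto
  have "acts m f = acts n g"
    using acts_reduces[OF km(1), of f] acts_reduces[OF ln(1), of g] assms
      acts_zero[of f k] acts_zero[of g l] km ln by simp
  then have eq: "f = g" "swaps I n m"
    using goods_unique[OF assms(1,2) km(2) ln(2)] by auto
  have "reduces I (l @ n) (l @ m)"
    using reduces_context[OF swaps_imp_reduces[OF eq(2)], of l "[]"] by simp
  then have "reduces I v (l @ m)"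
    using ln(1) by (auto intro: reduces_trans)
  then show ?thesis
    using eq km ln by blast
qed

end


section \<open>Munn sets and labels\<close>

text \<open>The congruence that defines the free partially commutative inverse monoid, as a relation on
  words over all letters at once.\<close>

inductive inv_eq :: "('a \<times> 'a) set \<Rightarrow> ('a + 'a) list \<Rightarrow> ('a + 'a) list \<Rightarrow> bool"
  for I where
  inv_eq_refl: "inv_eq I w w"
| inv_eq_sym: "inv_eq I u v \<Longrightarrow> inv_eq I v u"
| inv_eq_trans: "inv_eq I u v \<Longrightarrow> inv_eq I v w \<Longrightarrow> inv_eq I u w"
| inv_eq_append: "inv_eq I u v \<Longrightarrow> inv_eq I u' v' \<Longrightarrow> inv_eq I (u @ u') (v @ v')"
| inv_eq_inverse: "inv_eq I (x @ bar x @ x) x"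
| inv_eq_idem: "inv_eq I (x @ bar x @ y @ bar y) (y @ bar y @ x @ bar x)"
| inv_eq_pos: "(a, b) \<in> I \<Longrightarrow> inv_eq I [Inl a, Inl b] [Inl b, Inl a]"
| inv_eq_neg: "(a, b) \<in> I \<Longrightarrow> inv_eq I [Inr a, Inl b] [Inl b, Inr a]"

text \<open>The left regular action on sets of words turns the congruence into an equality of
  functions.\<close>

definition lact :: "('a \<times> 'a) set \<Rightarrow> ('a + 'a) list \<Rightarrow> ('a + 'a) list set \<Rightarrow> ('a + 'a) list set" where
  "lact I u X = {w. \<exists>x \<in> X. inv_eq I w (u @ x)}"

lemma lact_append [simp]: "lact I (u @ v) X = lact I u (lact I v X)"
proof -
  have "\<exists>y \<in> lact I v X. inv_eq I w (u @ y)" if "x \<in> X" "inv_eq I w ((u @ v) @ x)" for w x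
    using that inv_eq_refl[of I "v @ x"] by (intro bexI[of _ "v @ x"]) (auto simp: lact_def)
  moreover have "\<exists>x \<in> X. inv_eq I w ((u @ v) @ x)"
    if "x \<in> X" "inv_eq I w (u @ y)" "inv_eq I y (v @ x)" for w x y
    using that(1) inv_eq_trans[OF that(2) inv_eq_append[OF inv_eq_refl that(3)]]
    by (intro bexI[of _ x]) auto
  ultimately show ?thesis
    unfolding lact_def[of I "u @ v"] lact_def[of I u] by (auto simp: lact_def[of I v])
qed

lemma lact_eq_iff: "lact I u = lact I v \<longleftrightarrow> inv_eq I u v"
proof
  assume "lact I u = lact I v"
  then have "lact I u {[]} = lact I v {[]}"
    by simp
  then show "inv_eq I u v"
    by (auto simp: lact_def intro: inv_eq_refl)
next
  assume uv: "inv_eq I u v"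
  have "inv_eq I w (u @ x) \<longleftrightarrow> inv_eq I w (v @ x)" for w x
    using inv_eq_append[OF uv inv_eq_refl, of x] inv_eq_trans inv_eq_sym by metis
  then show "lact I u = lact I v"
    by (auto simp: lact_def fun_eq_iff)
qed

lemma lact_cong: "inv_eq I u v \<Longrightarrow> lact I u X = lact I v X"
  by (simp flip: lact_eq_iff)

lemma inv_eqI: "(\<And>X. lact I u X = lact I v X) \<Longrightarrow> inv_eq I u v"
  by (simp flip: lact_eq_iff add: fun_eq_iff)

lemma lact_below:
  assumes "inv_eq I u (u @ v @ w)"
  shows "lact I u X = lact I u (lact I v (lact I w X))"
  using lact_cong[OF assms] unfolding lact_append .

lemma lact_inverse:
  "lact I x (lact I (bar x) (lact I x X)) = lact I x X"
  "lact I (bar x) (lact I x (lact I (bar x) X)) = lact I (bar x) X"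
  using lact_cong[OF inv_eq_inverse[of I x], of X] lact_cong[OF inv_eq_inverse[of I "bar x"], of X]
  by simp_all

lemma lact_idem:
  "lact I x (lact I (bar x) (lact I y (lact I (bar y) X))) =
    lact I y (lact I (bar y) (lact I x (lact I (bar x) X)))"
  using lact_cong[OF inv_eq_idem[of I x y], of X] by simp

text \<open>The congruence has no rule for \<open>bar\<close>. The reason is uniqueness of inverses:
  \<open>bar u\<close> and \<open>bar v\<close> are inverses of the same element, and idempotents
  commute.\<close>

lemma inv_eq_bar:
  assumes "inv_eq I u v"
  shows "inv_eq I (bar u) (bar v)"
proof (rule inv_eqI)
  fix X
  let ?u = "lact I u" and ?v = "lact I v" and ?u' = "lact I (bar u)" and ?v' = "lact I (bar v)"
  have uv: "?u = ?v"
    using assms by (simp add: lact_eq_iff)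
  have "?u' X = ?u' (?v (?u' X))"
    by (simp add: uv[symmetric] lact_inverse)
  also have "\<dots> = ?u' (?v (?v' (?v (?u' X))))"
    by (simp only: lact_inverse)
  also have "\<dots> = ?u' (?u (?v' (?v (?u' X))))"
    by (simp only: uv)
  also have "\<dots> = ?v' (?v (?u' (?u (?u' X))))"
    using lact_idem[of I "bar u" "bar v"] by simp
  also have "\<dots> = ?v' (?u (?u' X))"
    by (simp only: lact_inverse) (simp only: uv)
  also have "\<dots> = ?v' (?v (?v' (?u (?u' X))))"
    by (simp only: lact_inverse)
  also have "\<dots> = ?v' (?u (?u' (?v (?v' X))))"
    by (simp only: lact_idem[of I v u])
  also have "\<dots> = ?v' (?u (?u' (?u (?v' X))))"
    by (simp only: uv)
  also have "\<dots> = ?v' (?v (?v' X))"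
    by (simp only: lact_inverse(1) uv[symmetric])
  also have "\<dots> = ?v' X"
    by (simp only: lact_inverse)
  finally show "?u' X = ?v' X" .
qed

context numbers_game
begin

text \<open>The relations cover two of the four sign patterns. Two negative letters are obtained
  from two positive ones by \<open>inv_eq_bar\<close>, and the remaining mixed pattern by symmetry
  of \<open>I\<close>.\<close>

lemma inv_eq_letters:
  assumes "(gen c, gen d) \<in> I"
  shows "inv_eq I [c, d] [d, c]"
proof -
  have neg_neg: "inv_eq I [Inr a, Inr b] [Inr b, Inr a]" if "(a, b) \<in> I" for a b
    using inv_eq_bar[OF inv_eq_pos[OF I_sym[OF that]]] by simp
  show ?thesis
    using assms inv_eq_pos[of "gen c" "gen d" I] inv_eq_neg[of "gen c" "gen d" I]
      inv_eq_neg[of "gen d" "gen c" I] neg_neg[of "gen c" "gen d"] I_sym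
    by (cases c; cases d) (auto intro: inv_eq_sym)
qed

lemma lact_letters:
  assumes "(gen c, gen d) \<in> I"
  shows "lact I [c] (lact I [d] X) = lact I [d] (lact I [c] X)"
  using lact_cong[OF inv_eq_letters[OF assms], of X] lact_append[of I "[c]" "[d]" X]
    lact_append[of I "[d]" "[c]" X] by simp

lemma lact_Cons: "lact I (c # w) X = lact I [c] (lact I w X)"
  using lact_append[of I "[c]" w X] by simp

lemma lact_commute:
  assumes "\<And>d. d \<in> set k \<Longrightarrow> (gen c, gen d) \<in> I"
  shows "lact I [c] (lact I k X) = lact I k (lact I [c] X)"
  using assms
proof (induction k arbitrary: X)
  case Nil
  then show ?case
    using lact_append[of I "[c]" "[]" X] lact_append[of I "[]" "[c]" X] by simp
next
  case (Cons d k)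
  then show ?case
    using lact_letters[of c d] by (simp add: lact_Cons[of d k])
qed

lemma lact_swap_letters:
  assumes "(gen c, gen d) \<in> I"
  shows "lact I (p @ c # d # q) X = lact I (p @ d # c # q) X"
proof -
  have "lact I (p @ c # d # q) X = lact I p (lact I [c] (lact I [d] (lact I q X)))"
    by (metis lact_append lact_Cons)
  also have "\<dots> = lact I p (lact I [d] (lact I [c] (lact I q X)))"
    using lact_letters[OF assms] by simp
  also have "\<dots> = lact I (p @ d # c # q) X"
    by (metis lact_append lact_Cons)
  finally show ?thesis .
qed

lemma inv_eq_swap_letters:
  "(gen c, gen d) \<in> I \<Longrightarrow> inv_eq I (p @ c # d # q) (p @ d # c # q)"
  by (rule inv_eqI) (rule lact_swap_letters)

text \<open>This says \<open>u \<le> v\<close> in the natural partial order. For a cancellation the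
  middle factor is an idempotent, and deleting an idempotent moves upwards; a commutation changes
  nothing.\<close>

lemma reduces_below:
  assumes "reduces I u v"
  shows "inv_eq I u (u @ bar u @ v)"
  using assms
proof (induction rule: reduces.induct)
  case (reduces_refl w)
  then show ?case
    by (rule inv_eq_sym[OF inv_eq_inverse])
next
  case (reduces_trans u v w)
  show ?case
  proof (rule inv_eqI)
    fix X
    note u = lact_below[OF reduces_trans.IH(1)] and v = lact_below[OF reduces_trans.IH(2)]
    let ?u = "lact I u" and ?v = "lact I v" and ?u' = "lact I (bar u)" and ?v' = "lact I (bar v)"
    \<comment> \<open>From \<open>u \<le> v\<close> the idempotent of \<open>u\<close> lies below
      that of \<open>v\<close>, so the latter fixes \<open>u\<close>.\<close>
    have vu: "?v (?v' (?u Y)) = ?u Y" for Y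
    proof -
      have "?v (?v' (?u Y)) = ?v (?v' (?u (?u' (?v Y))))"
        by (rule arg_cong[where f = "\<lambda>Z. ?v (?v' Z)", OF u])
      also have "\<dots> = ?u (?u' (?v (?v' (?v Y))))"
        by (rule lact_idem)
      also have "\<dots> = ?u Y"
        by (simp only: lact_inverse u[symmetric])
      finally show ?thesis .
    qed
    have "?u X = ?u (?u' (?v X))"
      by (rule u)
    also have "\<dots> = ?u (?u' (?v (?v' (lact I w X))))"
      by (rule arg_cong[where f = "\<lambda>Z. ?u (?u' Z)", OF v])
    also have "\<dots> = ?v (?v' (?u (?u' (lact I w X))))"
      by (rule lact_idem)
    also have "\<dots> = lact I (u @ bar u @ w) X"
      by (simp only: vu lact_append)
    finally show "?u X = lact I (u @ bar u @ w) X" .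
  qed
next
  case (reduces_swap c d p q)
  let ?u = "p @ c # d # q" and ?v = "p @ d # c # q"
  show ?case
  proof (rule inv_eqI)
    fix X
    show "lact I ?u X = lact I (?u @ bar ?u @ ?v) X"
      by (simp only: lact_append[of I ?u] lact_append[of I "bar ?u"] lact_swap_letters[OF reduces_swap, symmetric]
          lact_inverse)
  qed
next
  case (reduces_cancel p c q)
  let ?p = "lact I p" and ?p' = "lact I (bar p)" and ?q = "lact I q" and ?q' = "lact I (bar q)"
    and ?c = "lact I [c]" and ?c' = "lact I [bar_letter c]"
  have e: "?c (?c' (?c (?c' X))) = ?c (?c' X)" for X
    using lact_inverse[of I "[c]"] by simp
  have eq: "?c (?c' (?q (?q' X))) = ?q (?q' (?c (?c' X)))" for X
    using lact_idem[of I "[c]" q] by simp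
  have ep: "?c (?c' (?p' (?p X))) = ?p' (?p (?c (?c' X)))" for X
    using lact_idem[of I "[c]" "bar p"] by simp
  have pq: "?p' (?p (?q (?q' X))) = ?q (?q' (?p' (?p X)))" for X
    using lact_idem[of I "bar p" q] by simp
  show ?case
  proof (rule inv_eqI)
    fix X
    have L: "lact I (c # bar_letter c # q) Y = ?c (?c' (?q Y))" for Y
      by (metis lact_Cons)
    have B: "lact I (bar (p @ c # bar_letter c # q)) Y = ?q' (?c (?c' (?p' Y)))" for Y
      by simp (metis lact_Cons)
    have "lact I ((p @ c # bar_letter c # q) @ bar (p @ c # bar_letter c # q) @ p @ q) X
        = ?p (?c (?c' (?q (?q' (?c (?c' (?p' (?p (?q X)))))))))"
      by (simp only: lact_append L B)
    also have "\<dots> = ?p (?q (?q' (?c (?c' (?p' (?p (?q X)))))))"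
      using eq e by metis
    also have "\<dots> = ?p (?q (?q' (?p' (?p (?c (?c' (?q X)))))))"
      by (simp only: ep)
    also have "\<dots> = ?p (?p' (?p (?q (?q' (?c (?c' (?q X)))))))"
      by (simp only: pq)
    also have "\<dots> = ?p (?c (?c' (?q (?q' (?q X)))))"
      by (simp only: eq[symmetric] lact_inverse)
    also have "\<dots> = lact I (p @ c # bar_letter c # q) X"
      by (simp only: lact_inverse L lact_append)
    finally show "lact I (p @ c # bar_letter c # q) X =
      lact I ((p @ c # bar_letter c # q) @ bar (p @ c # bar_letter c # q) @ p @ q) X" by simp
  qed
qed

text \<open>The vertex set of the convex hull of the path with label \<open>u\<close>; a vertex is represented by
  all words \<open>p\<close> that lead to it inside the hull.\<close>

definition munn :: "('a + 'a) list \<Rightarrow> ('a + 'a) list set" where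
  "munn u = {p. inv_eq I (p @ bar p @ u) u}"

lemma mem_munn_iff: "p \<in> munn u \<longleftrightarrow> (\<forall>X. lact I p (lact I (bar p) (lact I u X)) = lact I u X)"
  by (simp add: munn_def fun_eq_iff flip: lact_eq_iff)

text \<open>The idempotent of \<open>p @ q\<close> lies below that of \<open>p\<close>, and
  everything fixed by the smaller one is fixed by the larger one.\<close>

lemma munn_prefix: "p @ q \<in> munn u \<Longrightarrow> p \<in> munn u"
proof -
  assume "p @ q \<in> munn u"
  then have eq: "lact I p (lact I q (lact I (bar q) (lact I (bar p) (lact I u X)))) = lact I u X" for X
    by (simp add: mem_munn_iff)
  have "lact I p (lact I (bar p) (lact I u X)) = lact I u X" for X
  proof -
    have "lact I p (lact I (bar p) (lact I u X)) =
        lact I p (lact I (bar p) (lact I p (lact I q (lact I (bar q) (lact I (bar p) (lact I u X))))))"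
      by (rule arg_cong[where f = "\<lambda>Z. lact I p (lact I (bar p) Z)", OF eq[symmetric]])
    also have "\<dots> = lact I u X"
      by (simp only: lact_inverse(1)) (rule eq)
    finally show ?thesis .
  qed
  then show ?thesis
    by (simp add: mem_munn_iff)
qed

lemma munn_self: "u \<in> munn u"
  by (auto simp: mem_munn_iff lact_inverse)

lemma munn_cong: "inv_eq I p q \<Longrightarrow> p \<in> munn u \<longleftrightarrow> q \<in> munn u"
  unfolding mem_munn_iff by (simp only: lact_cong[of I p q] lact_cong[OF inv_eq_bar, of I p q])

text \<open>Cutting out a detour enlarges the idempotent of the word, so the result still fixes
  \<open>u\<close>. The tail \<open>z\<close> allows the reduction of a prefix only.\<close>

lemma munn_reduces:
  assumes "reduces I p q" "p @ z \<in> munn u"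
  shows "q @ z \<in> munn u"
  using assms
proof (induction arbitrary: z rule: reduces.induct)
  case (reduces_swap c d p q)
  then show ?case
    using munn_cong[OF inv_eq_swap_letters[of c d p "q @ z"]] by simp
next
  case (reduces_cancel p c q)
  let ?p = "lact I p" and ?p' = "lact I (bar p)" and ?c = "lact I [c]" and ?c' = "lact I [bar_letter c]"
    and ?q = "lact I (q @ z)" and ?q' = "lact I (bar (q @ z))"
  have L: "lact I (p @ c # bar_letter c # q @ z) Y = ?p (?c (?c' (?q Y)))" for Y
    by (metis lact_append lact_Cons)
  have B: "lact I (bar (p @ c # bar_letter c # q @ z)) Y = ?q' (?c (?c' (?p' Y)))" for Y
    by simp (metis lact_Cons)
  have e: "?c (?c' (?c (?c' X))) = ?c (?c' X)" for X
    using lact_inverse[of I "[c]"] by simp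
  have eq: "?c (?c' (?q (?q' X))) = ?q (?q' (?c (?c' X)))" for X
    using lact_idem[of I "[c]" "q @ z"] by simp
  have pq: "?p' (?p (?q (?q' X))) = ?q (?q' (?p' (?p X)))" for X
    using lact_idem[of I "bar p" "q @ z"] by simp
  have qq: "?q (?q' (?q (?q' X))) = ?q (?q' X)" for X
    by (simp only: lact_inverse)
  have mem: "p @ c # bar_letter c # q @ z \<in> munn u"
    using reduces_cancel by simp
  have u: "lact I u X = ?p (?q (?q' (?c (?c' (?p' (lact I u X))))))" for X
  proof -
    have "lact I u X = ?p (?c (?c' (?q (?q' (?c (?c' (?p' (lact I u X))))))))"
      by (rule mem[unfolded mem_munn_iff L B, rule_format, symmetric])
    then show ?thesis
      by (simp only: eq e)
  qed
  have "?p (?q (?q' (?p' (lact I u X)))) = lact I u X" for X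
  proof -
    let ?Y = "?c (?c' (?p' (lact I u X)))"
    have "?p (?q (?q' (?p' (lact I u X)))) = ?p (?q (?q' (?p' (?p (?q (?q' ?Y))))))"
      by (rule arg_cong[where f = "\<lambda>Z. ?p (?q (?q' (?p' Z)))", OF u])
    also have "\<dots> = ?p (?p' (?p (?q (?q' (?q (?q' ?Y))))))"
      by (simp only: pq)
    also have "\<dots> = ?p (?q (?q' ?Y))"
      by (simp only: qq lact_inverse)
    also have "\<dots> = lact I u X"
      by (rule u[symmetric])
    finally show ?thesis .
  qed
  then show ?case
    unfolding mem_munn_iff append_assoc bar_append[of p "q @ z"] lact_append[of I p "q @ z"]
      lact_append[of I "bar (q @ z)" "bar p"] by blast
qed auto

text \<open>The converse of \<open>munn_reduces\<close> for a path \<open>p\<close> that is itself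
  inside. Since \<open>p = p @ bar p @ q\<close> in the monoid, the idempotent of
  \<open>p @ z\<close> is the product of those of \<open>p\<close> and of \<open>q @ z\<close>, and
  both fix \<open>u\<close>.\<close>

lemma munn_lift:
  assumes "reduces I p q" "p \<in> munn u" "q @ z \<in> munn u"
  shows "p @ z \<in> munn u"
proof -
  let ?p = "lact I p" and ?p' = "lact I (bar p)" and ?q = "lact I q" and ?q' = "lact I (bar q)"
    and ?z = "lact I z" and ?z' = "lact I (bar z)" and ?u = "lact I u"
  note pq = lact_below[OF reduces_below[OF assms(1)]]
  have "inv_eq I (bar p) (bar q @ p @ bar p)"
    using inv_eq_bar[OF reduces_below[OF assms(1)]] by simp
  then have pq': "?p' X = ?q' (?p (?p' X))" for X
    by (subst lact_cong[of I "bar p" "bar q @ p @ bar p"]) simp_all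
  have 1: "?p (?p' (?u X)) = ?u X" and 2: "?q (?z (?z' (?q' (?u X)))) = ?u X" for X
    using assms(2,3) by (auto simp: mem_munn_iff)
  have "?p (?z (?z' (?p' (?u X)))) = ?u X" for X
  proof -
    have "?p (?z (?z' (?p' (?u X)))) = ?p (?p' (?q (?z (?z' (?p' (?u X))))))"
      by (rule pq)
    also have "\<dots> = ?p (?p' (?q (?z (?z' (?q' (?p (?p' (?u X))))))))"
      by (rule arg_cong[where f = "\<lambda>Z. ?p (?p' (?q (?z (?z' Z))))", OF pq'])
    also have "\<dots> = ?u X"
      by (simp only: 1 2)
    finally show ?thesis .
  qed
  then show ?thesis
    by (simp add: mem_munn_iff)
qed

text \<open>Transport of an edge along its hyperplane. Moving \<open>c\<close> in front of
  \<open>l\<close> and taking a prefix puts the edge \<open>c\<close> at \<open>m\<close> inside;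
  the path \<open>k\<close> from \<open>m\<close> is inside as well, and the hull contains the strip
  of squares that they span, because \<open>c\<close> commutes with \<open>k\<close>.\<close>

lemma munn_cross:
  assumes "\<And>d. d \<in> set k \<Longrightarrow> (gen c, gen d) \<in> I" "\<And>d. d \<in> set l \<Longrightarrow> (gen c, gen d) \<in> I"
    and "m @ k \<in> munn u" "m @ l @ [c] \<in> munn u"
  shows "m @ k @ [c] \<in> munn u"
proof -
  let ?m = "lact I m" and ?m' = "lact I (bar m)" and ?k = "lact I k" and ?k' = "lact I (bar k)"
    and ?c = "lact I [c]" and ?c' = "lact I [bar_letter c]" and ?u = "lact I u"
  have "inv_eq I (m @ l @ [c]) (m @ [c] @ l)"
    by (rule inv_eqI) (simp only: lact_append lact_commute[of l c, OF assms(2)])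
  then have "(m @ [c]) @ l \<in> munn u"
    using assms(4) munn_cong by simp
  then have "m @ [c] \<in> munn u"
    by (rule munn_prefix)
  then have 1: "?m (?c (?c' (?m' (?u X)))) = ?u X" for X
    by (simp add: mem_munn_iff lact_Cons[of "bar_letter c" "bar m"])
  have 2: "?m (?k (?k' (?m' (?u X)))) = ?u X" for X
    using assms(3) by (simp add: mem_munn_iff)
  have bar_k: "(gen c, gen d) \<in> I" if "d \<in> set (bar k)" for d
    using that assms(1) by (auto simp: bar_def)
  have ck': "?c (?k' X) = ?k' (?c X)" and ck: "?c' (?k' X) = ?k' (?c' X)" for X
    using lact_commute[of "bar k" c X] lact_commute[of "bar k" "bar_letter c" X] bar_k by auto
  have mk: "?m' (?m (?c (?c' X))) = ?c (?c' (?m' (?m X)))" for X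
    using lact_idem[of I "bar m" "[c]"] by simp
  have mk': "?m' (?m (?k (?k' X))) = ?k (?k' (?m' (?m X)))" for X
    using lact_idem[of I "bar m" k] by simp
  have "?m (?k (?c (?c' (?k' (?m' (?u X)))))) = ?u X" for X
  proof -
    have "?u X = ?m (?k (?k' (?m' (?m (?c (?c' (?m' (?u X))))))))"
      by (simp only: 1 2)
    also have "\<dots> = ?m (?m' (?m (?k (?k' (?c (?c' (?m' (?u X))))))))"
      by (simp only: mk')
    also have "\<dots> = ?m (?k (?c (?c' (?k' (?m' (?u X))))))"
      by (simp only: lact_inverse ck ck')
    finally show ?thesis
      by simp
  qed
  then show ?thesis
    by (simp add: mem_munn_iff lact_Cons[of "bar_letter c" "bar k @ bar m"])
qed

lemma munn_reverse: "p @ [c] \<in> munn u \<Longrightarrow> p @ [c, bar_letter c] \<in> munn u"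
proof -
  assume "p @ [c] \<in> munn u"
  moreover have "lact I [c, bar_letter c] X = lact I [c] (lact I [bar_letter c] X)" for X
    by (rule lact_Cons)
  moreover have "lact I [c] (lact I [bar_letter c] (lact I [c] (lact I [bar_letter c] X))) =
      lact I [c] (lact I [bar_letter c] X)" for X
    using lact_inverse[of I "[c]"] by simp
  ultimately show ?thesis
    by (simp add: mem_munn_iff lact_Cons[of c "bar_letter c # bar p"] lact_Cons[of "bar_letter c" "bar p"])
qed

text \<open>Both words lie below \<open>m\<close>, and below a fixed element a word is determined by
  its idempotent. The two memberships say that these idempotents agree.\<close>

lemma inv_eq_of_munn:
  assumes "v \<in> munn u" "u \<in> munn v" "reduces I u m" "reduces I v m"
  shows "inv_eq I u v"
proof (rule inv_eqI)
  fix X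
  let ?u = "lact I u" and ?v = "lact I v" and ?m = "lact I m"
    and ?u' = "lact I (bar u)" and ?v' = "lact I (bar v)"
  note u = lact_below[OF reduces_below[OF assms(3)]] and v = lact_below[OF reduces_below[OF assms(4)]]
  have "?u X = ?v (?v' (?u X))"
    using assms(1) by (simp add: mem_munn_iff)
  also have "\<dots> = ?v (?v' (?u (?u' (?m X))))"
    by (rule arg_cong[where f = "\<lambda>Z. ?v (?v' Z)", OF u])
  also have "\<dots> = ?u (?u' (?v (?v' (?m X))))"
    by (rule lact_idem)
  also have "\<dots> = ?u (?u' (?v X))"
    by (rule arg_cong[where f = "\<lambda>Z. ?u (?u' Z)", OF v[symmetric]])
  also have "\<dots> = ?v X"
    using assms(2) by (simp add: mem_munn_iff)
  finally show "?u X = ?v X" .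
qed


section \<open>Labels of hyperplanes and vertices\<close>

definition base :: "'a \<Rightarrow> 'a \<times> bool \<Rightarrow> int" where
  "base a = (\<lambda>s. if (a, fst s) \<in> I then 0 else if fst s = a then 2 else 1)"

text \<open>All values are positive, so the stabilizer is trivial and
  \<open>acts (bar u) one\<close> names the endpoint of \<open>u\<close>.\<close>

definition one :: "'a \<times> bool \<Rightarrow> int" where
  "one = (\<lambda>_. 1)"

text \<open>The stabilizer of \<open>base a\<close> is generated by the letters that commute with \<open>a\<close>, so
  \<open>acts (bar p) (edge c)\<close> names the hyperplane of the Cayley graph that is dual to the edge with
  label \<open>c\<close> at the vertex \<open>p\<close>. The value \<open>2\<close> at \<open>a\<close> keeps hyperplanes of different type apart.\<close>

fun edge :: "'a + 'a \<Rightarrow> 'a \<times> bool \<Rightarrow> int" where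
  "edge (Inl a) = base a"
| "edge (Inr a) = act (Inl a) (base a)"

text \<open>The action reads words from left to right, so with \<open>bar p\<close> a label depends
  only on the coset of the stabilizer at the vertex \<open>p\<close>. The labels of the tail refer
  to the vertex behind \<open>c\<close>; the inverse letter carries them back to the origin.\<close>

fun labels :: "('a + 'a) list \<Rightarrow> ('a \<times> bool \<Rightarrow> int) set" where
  "labels [] = {}"
| "labels (c # w) = insert (edge c) (act (bar_letter c) ` labels w)"

lemma labels_append: "labels (u @ v) = labels u \<union> acts (bar u) ` labels v"
  by (induction u) (auto simp: image_Un image_image)

lemma mem_labels_iff:
  "f \<in> labels w \<longleftrightarrow> (\<exists>p c q. w = p @ c # q \<and> f = acts (bar p) (edge c))"
proof
  show "\<exists>p c q. w = p @ c # q \<and> f = acts (bar p) (edge c)" if "f \<in> labels w"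
    using that
  proof (induction w arbitrary: f)
    case (Cons d w)
    then consider "f = edge d" | g where "g \<in> labels w" "f = act (bar_letter d) g"
      by auto
    then show ?case
    proof cases
      case 1
      then show ?thesis
        by (intro exI[of _ "[]"]) auto
    next
      case 2
      then obtain p c q where "w = p @ c # q" "g = acts (bar p) (edge c)"
        using Cons.IH by blast
      then show ?thesis
        using 2 by (intro exI[of _ "d # p"] exI[of _ c] exI[of _ q]) auto
    qed
  qed simp
qed (auto simp: labels_append)

lemma start_base: "start (base a)"
  by (auto simp: start_def base_def)

lemma start_one: "start one"
  by (auto simp: start_def one_def)

lemma base_inj: "base a = base b \<Longrightarrow> a = b"
  by (drule fun_cong[of _ _ "(a, False)"]) (auto simp: base_def split: if_splits)

lemma base_neq_one: "base a \<noteq> one"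
  by (auto simp: base_def one_def dest: fun_cong[of _ _ "(a, False)"])

lemma base_site_zero: "base a (site c) = 0 \<longleftrightarrow> (a, gen c) \<in> I"
  by (auto simp: base_def)

lemma act_base: "(a, gen c) \<in> I \<Longrightarrow> act c (base a) = base a"
  by (rule act_zero) (auto simp: base_def)

text \<open>The way from the current vertex to the source of the same edge in its positive
  orientation.\<close>

fun shift :: "'a + 'a \<Rightarrow> ('a + 'a) list" where
  "shift (Inl a) = []"
| "shift (Inr a) = [Inr a]"

lemma acts_edge: "acts (bar p) (edge c) = acts (bar (p @ shift c)) (base (gen c))"
  by (cases c) auto

lemma acts_commute:
  "(\<And>d. d \<in> set k \<Longrightarrow> (gen d, gen c) \<in> I) \<Longrightarrow> acts k (act c f) = act c (acts k f)"
proof (induction k arbitrary: f)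
  case (Cons d k)
  then show ?case
    using act_commute[of d c f] by simp
qed simp

lemma shift_in_lists: "c \<in> Gam \<Sigma> \<Longrightarrow> shift c \<in> lists (Gam \<Sigma>)"
  by (cases c) auto

text \<open>The two vertices differ by letters that commute with \<open>a\<close>, hence with
  \<open>x\<close>, so one more step along \<open>a\<close> leaves both at the same hyperplane
  again.\<close>

lemma base_label_extend:
  assumes "p \<in> lists (Gam \<Sigma>)" "q \<in> lists (Gam \<Sigma>)" "gen x = a"
    and "acts (bar p) (base a) = acts (bar q) (base a)"
  shows "acts (bar (p @ [x])) (base a) = acts (bar (q @ [x])) (base a)"
proof -
  have "bar p \<in> lists (Gam \<Sigma>)" "bar q \<in> lists (Gam \<Sigma>)"
    using assms by simp_all
  then obtain k l n where kln: "reduces I (bar p) (k @ n)" "reduces I (bar q) (l @ n)"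
    "\<forall>c \<in> set k. base a (site c) = 0" "\<forall>c \<in> set l. base a (site c) = 0"
    using common_normal_form[OF start_base start_base _ _ assms(4)] by blast
  have "acts j (act (bar_letter x) (base a)) = act (bar_letter x) (base a)"
    if "\<forall>c \<in> set j. base a (site c) = 0" for j
    using that acts_commute[of j "bar_letter x" "base a"] acts_zero[OF start_base, of j] assms(3)
    by (auto simp: base_site_zero I_sym)
  then show ?thesis
    using acts_reduces[OF kln(1)] acts_reduces[OF kln(2)] kln(3,4) by simp
qed

text \<open>Equal labels give reducts of \<open>p\<close> and \<open>q\<close> with a common part
  \<open>bar n\<close> followed by letters commuting with \<open>x\<close>. The edge is reduced,
  moved across by \<open>munn_cross\<close>, and lifted back to the given path
  \<open>p\<close>.\<close>

lemma munn_edge: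
  assumes "p \<in> lists (Gam \<Sigma>)" "q \<in> lists (Gam \<Sigma>)"
    and "p \<in> munn u" "q @ [x] \<in> munn u"
    and "acts (bar p) (base (gen x)) = acts (bar q) (base (gen x))"
  shows "p @ [x] \<in> munn u"
proof -
  have "bar p \<in> lists (Gam \<Sigma>)" "bar q \<in> lists (Gam \<Sigma>)"
    using assms by simp_all
  then obtain k l n where kln: "reduces I (bar p) (k @ n)" "reduces I (bar q) (l @ n)"
    "\<forall>c \<in> set k. base (gen x) (site c) = 0" "\<forall>c \<in> set l. base (gen x) (site c) = 0"
    using common_normal_form[OF start_base start_base _ _ assms(5)] by blast
  have red: "reduces I p (bar n @ bar k)" "reduces I q (bar n @ bar l)"
    using reduces_bar[OF kln(1)] reduces_bar[OF kln(2)] by simp_all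
  have "bar n @ bar k \<in> munn u"
    using munn_reduces[OF red(1), of "[]"] assms(3) by simp
  moreover have "bar n @ bar l @ [x] \<in> munn u"
    using munn_reduces[OF red(2) assms(4)] by simp
  moreover have "(gen x, gen d) \<in> I" if "d \<in> set (bar k) \<or> d \<in> set (bar l)" for d
    using that kln(3,4) by (auto simp: base_site_zero bar_def)
  ultimately have "(bar n @ bar k) @ [x] \<in> munn u"
    using munn_cross[of "bar k" x "bar l" "bar n" u] by auto
  then show ?thesis
    by (rule munn_lift[OF red(1) assms(3)])
qed

text \<open>\<open>munn_edge\<close> compares edges of equal orientation. For opposite orientations
  the edge at \<open>q\<close> is read backwards from its far end, which \<open>munn_reverse\<close>
  keeps inside the hull.\<close>

lemma munn_label:
  assumes "p \<in> lists (Gam \<Sigma>)" "q \<in> lists (Gam \<Sigma>)" "c \<in> Gam \<Sigma>" "d \<in> Gam \<Sigma>"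
    and "p \<in> munn u" "q @ [d] \<in> munn u" "gen c = gen d"
    and "acts (bar p) (edge c) = acts (bar q) (edge d)"
  shows "p @ [c] \<in> munn u"
proof -
  obtain a where a: "a = gen c"
    by simp
  have eq: "acts (bar (p @ shift c)) (base a) = acts (bar (q @ shift d)) (base a)"
    using assms(7,8) by (simp add: acts_edge a del: bar_append)
  have in_Gam: "[Inl a] \<in> lists (Gam \<Sigma>)" "[Inr a] \<in> lists (Gam \<Sigma>)"
    using assms(3) a by (auto simp: mem_Gam_iff)
  have q: "q @ [d, bar_letter d] \<in> munn u"
    by (rule munn_reverse[OF assms(6)])
  \<comment> \<open>If \<open>c = Inr a\<close>, then \<open>shift c @ [Inl a]\<close> cancels to
    nothing, so this moves the comparison of labels from the source of the positive edge to
    \<open>p\<close> itself.\<close>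
  have eq': "acts (bar (p @ shift c @ [Inl a])) (base a) = acts (bar (q @ shift d @ [Inl a])) (base a)"
    using base_label_extend[OF _ _ _ eq, of "Inl a"] assms(1-4) shift_in_lists by simp
  consider "c = Inl a" "d = Inl a" | "c = Inl a" "d = Inr a" | "c = Inr a" "d = Inl a"
    | "c = Inr a" "d = Inr a"
    using a assms(7) by (cases c; cases d) auto
  then show ?thesis
  proof cases
    case 1
    then show ?thesis
      using munn_edge[of p q u c] assms eq by simp
  next
    case 2
    then show ?thesis
      using munn_edge[of p "q @ [Inr a]" u c] assms eq q in_Gam by simp
  next
    case 3
    then show ?thesis
      using munn_edge[of p "q @ [Inl a]" u c] assms eq' q in_Gam act_bar_act(1)[of "Inr a"] by simp
  next
    case 4
    then show ?thesis
      using munn_edge[of p q u c] assms eq' act_bar_act(1)[of "Inr a"] by simp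
  qed
qed

text \<open>Endpoint and hyperplanes may share one set because \<open>one\<close> and each
  \<open>base a\<close> have disjoint orbits, see \<open>label_neq_one\<close>.\<close>

definition all_labels :: "('a + 'a) list \<Rightarrow> ('a \<times> bool \<Rightarrow> int) set" where
  "all_labels u = insert (acts (bar u) one) (labels u)"

lemma label_neq_one:
  assumes "p \<in> lists (Gam \<Sigma>)" "c \<in> Gam \<Sigma>" "u \<in> lists (Gam \<Sigma>)"
  shows "acts (bar p) (edge c) \<noteq> acts (bar u) one"
proof
  assume eq: "acts (bar p) (edge c) = acts (bar u) one"
  have "bar (p @ shift c) \<in> lists (Gam \<Sigma>)" "bar u \<in> lists (Gam \<Sigma>)"
    using assms shift_in_lists by (simp_all del: bar_append)
  then have "base (gen c) = one"
    using common_normal_form[OF start_base start_one] eq by (metis acts_edge)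
  then show False
    using base_neq_one by blast
qed

lemma label_gen:
  assumes "p \<in> lists (Gam \<Sigma>)" "c \<in> Gam \<Sigma>" "q \<in> lists (Gam \<Sigma>)" "d \<in> Gam \<Sigma>"
    and "acts (bar p) (edge c) = acts (bar q) (edge d)"
  shows "gen c = gen d"
proof -
  have "bar (p @ shift c) \<in> lists (Gam \<Sigma>)" "bar (q @ shift d) \<in> lists (Gam \<Sigma>)"
    using assms shift_in_lists by (simp_all del: bar_append)
  then have "base (gen c) = base (gen d)"
    using common_normal_form[OF start_base start_base] assms(5) by (metis acts_edge)
  then show ?thesis
    by (rule base_inj)
qed

text \<open>Walk along \<open>v\<close>: the vertex reached so far is in the hull of
  \<open>u\<close>, and the next edge is dual to a hyperplane crossed by \<open>u\<close>, so
  \<open>munn_label\<close> keeps the next vertex inside.\<close>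

lemma munn_if_labels:
  assumes "u \<in> lists (Gam \<Sigma>)" "v \<in> lists (Gam \<Sigma>)" "labels v \<subseteq> all_labels u"
  shows "v \<in> munn u"
proof -
  have "p \<in> munn u" if "v = p @ r" for p r
    using that
  proof (induction p arbitrary: r rule: rev_induct)
    case Nil
    show ?case
      using munn_prefix[of "[]" u u] munn_self by simp
  next
    case (snoc c p)
    have p: "p \<in> lists (Gam \<Sigma>)" "c \<in> Gam \<Sigma>"
      using snoc.prems assms(2) by auto
    have "acts (bar p) (edge c) \<in> labels v"
      unfolding mem_labels_iff using snoc.prems by (intro exI[of _ p] exI[of _ c] exI[of _ r]) simp
    then have "acts (bar p) (edge c) \<in> labels u"
      using assms(3) label_neq_one[OF p assms(1)] by (auto simp: all_labels_def)
    then obtain q d s where q: "u = q @ d # s" "acts (bar p) (edge c) = acts (bar q) (edge d)"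
      by (auto simp: mem_labels_iff)
    have qd: "q \<in> lists (Gam \<Sigma>)" "d \<in> Gam \<Sigma>" "q @ [d] \<in> munn u"
      using q(1) assms(1) munn_prefix[of "q @ [d]" s u] munn_self[of u] by auto
    show ?case
      using munn_label[OF p(1) qd(1) p(2) qd(2) snoc.IH qd(3) label_gen[OF p qd(1,2) q(2)] q(2)]
        snoc.prems by simp
  qed
  then show ?thesis
    by simp
qed

text \<open>The endpoint label of \<open>v\<close> cannot be an edge label of \<open>u\<close>, so
  the endpoints agree. As \<open>one\<close> has no zeros, no stabilizer part remains and both words
  reduce to the same word; the edge labels put each word into the hull of the other.\<close>

lemma inv_eq_if_labels:
  assumes "u \<in> lists (Gam \<Sigma>)" "v \<in> lists (Gam \<Sigma>)" "all_labels u = all_labels v"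
  shows "inv_eq I u v"
proof -
  have "acts (bar v) one \<notin> labels u"
  proof
    assume "acts (bar v) one \<in> labels u"
    then obtain p c q where "u = p @ c # q" "acts (bar v) one = acts (bar p) (edge c)"
      unfolding mem_labels_iff by blast
    moreover from this have "p \<in> lists (Gam \<Sigma>)" "c \<in> Gam \<Sigma>"
      using assms(1) by auto
    ultimately show False
      using label_neq_one[of p c v] assms(2) by metis
  qed
  then have "acts (bar u) one = acts (bar v) one"
    using assms(3)[unfolded all_labels_def] by (metis insertI1 insertE)
  moreover have "bar u \<in> lists (Gam \<Sigma>)" "bar v \<in> lists (Gam \<Sigma>)"
    using assms by simp_all
  ultimately obtain k l n where kln: "reduces I (bar u) (k @ n)" "reduces I (bar v) (l @ n)"
    "\<forall>c \<in> set k. one (site c) = 0" "\<forall>c \<in> set l. one (site c) = 0"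
    using common_normal_form[OF start_one start_one, of "bar u" "bar v"] by blast
  have "k = []" "l = []"
    using kln(3,4) by (cases k; cases l; simp add: one_def)+
  then have "reduces I (bar u) n" "reduces I (bar v) n"
    using kln(1,2) by simp_all
  then have "reduces I u (bar n)" "reduces I v (bar n)"
    using reduces_bar by fastforce+
  moreover have "v \<in> munn u" "u \<in> munn v"
    using munn_if_labels[of u v] munn_if_labels[of v u] assms unfolding all_labels_def by blast+
  ultimately show ?thesis
    by (intro inv_eq_of_munn)
qed

lemma act_edge: "act c (edge c) = edge (bar_letter c)"
  using act_bar_act(1)[of "Inl a" for a] by (cases c) auto

lemma act_edge_commute: "(gen c, gen d) \<in> I \<Longrightarrow> act c (edge d) = edge d"
  using act_commute[of c "Inl (gen d)"] by (cases d) (auto simp: act_base I_sym)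

lemma labels_bar: "labels (bar w) = acts w ` labels w"
  by (induction w) (auto simp: labels_append act_edge image_image)

lemma commuting_letters:
  assumes "(gen c, gen d) \<in> I"
  shows "acts [c, d] = acts [d, c]" "acts (bar [c, d]) = acts (bar [d, c])"
    "labels [c, d] = labels [d, c]"
proof -
  show "acts [c, d] = acts [d, c]" "acts (bar [c, d]) = acts (bar [d, c])"
    using act_commute[OF assms] act_commute[of "bar_letter c" "bar_letter d"] assms by auto
  show "labels [c, d] = labels [d, c]"
    using act_edge_commute[of "bar_letter c" d] act_edge_commute[of "bar_letter d" c]
      assms I_sym[OF assms] by auto
qed

text \<open>The labels of a concatenation involve \<open>acts (bar u)\<close>, and those of an
  inverse involve \<open>acts\<close>, so the three invariants are carried through the induction
  together.\<close>

lemma inv_eq_sound: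
  assumes "inv_eq I u v"
  shows "acts u = acts v \<and> acts (bar u) = acts (bar v) \<and> labels u = labels v"
  using assms
proof induction
  case (inv_eq_append u v u' v')
  then show ?case
    by (auto simp: fun_eq_iff[of "acts _"] labels_append)
next
  case (inv_eq_inverse x)
  then show ?case
    by (auto simp: fun_eq_iff[of "acts _"] labels_append labels_bar image_image image_Un)
next
  case (inv_eq_idem x y)
  then show ?case
    by (auto simp: fun_eq_iff[of "acts _"] labels_append labels_bar image_image image_Un)
next
  case (inv_eq_pos a b)
  then show ?case
    using commuting_letters[of "Inl a" "Inl b"] by (simp only: gen.simps simp_thms)
next
  case (inv_eq_neg a b)
  then show ?case
    using commuting_letters[of "Inr a" "Inl b"] by (simp only: gen.simps simp_thms)
next
  case (inv_eq_sym u v)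
  then show ?case
    by metis
next
  case (inv_eq_trans u v w)
  then show ?case
    by metis
next
  case (inv_eq_refl w)
  show ?case
    by simp
qed

theorem inv_eq_iff_labels:
  assumes "u \<in> lists (Gam \<Sigma>)" "v \<in> lists (Gam \<Sigma>)"
  shows "inv_eq I u v \<longleftrightarrow> all_labels u = all_labels v"
  using inv_eq_if_labels[OF assms] inv_eq_sound[of u v] unfolding all_labels_def by metis

end


section \<open>From congruent words to the iterated quotient monoid\<close>

lemma carrier_FIM: "carrier (FIM \<Sigma>) = fim_val \<Sigma> ` lists (Gam \<Sigma>)"
  by (auto simp: FIM_def quot_monoid_def fim_val_def quot_class_def quotient_def free_monoid_def)

lemma fim_val_closed: "u \<in> lists (Gam \<Sigma>) \<Longrightarrow> fim_val \<Sigma> u \<in> carrier (FIM \<Sigma>)"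
  unfolding carrier_FIM by (rule imageI)

lemma fim_val_append:
  assumes "u \<in> lists (Gam \<Sigma>)" "v \<in> lists (Gam \<Sigma>)"
  shows "fim_val \<Sigma> (u @ v) = fim_val \<Sigma> u \<otimes>\<^bsub>FIM \<Sigma>\<^esub> fim_val \<Sigma> v"
  using hom_mult[OF fim_val_hom, of u \<Sigma> v] assms by (simp add: free_monoid_def)

lemma fpcim_val_append:
  assumes "u \<in> lists (Gam \<Sigma>)" "v \<in> lists (Gam \<Sigma>)"
  shows "fpcim_val \<Sigma> I (u @ v) = fpcim_val \<Sigma> I u \<otimes>\<^bsub>FPCIM \<Sigma> I\<^esub> fpcim_val \<Sigma> I v"
  using hom_mult[OF fpcim_val_hom, of u \<Sigma> v I] assms by (simp add: free_monoid_def)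

lemma fim_val_eq_iff:
  assumes "u \<in> lists (Gam \<Sigma>)" "v \<in> lists (Gam \<Sigma>)"
  shows "fim_val \<Sigma> u = fim_val \<Sigma> v \<longleftrightarrow>
    (u, v) \<in> cong_gen (free_monoid (Gam \<Sigma>)) (fim_rels \<Sigma>)"
  unfolding fim_val_def
  by (rule quot_class_eq_iff[OF monoid_free_monoid]) (use assms in \<open>simp_all add: free_monoid_def\<close>)

lemma fpcim_val_eq_iff:
  assumes "u \<in> lists (Gam \<Sigma>)" "v \<in> lists (Gam \<Sigma>)"
  shows "fpcim_val \<Sigma> I u = fpcim_val \<Sigma> I v \<longleftrightarrow>
    (fim_val \<Sigma> u, fim_val \<Sigma> v) \<in> cong_gen (FIM \<Sigma>) (comm_rels \<Sigma> I)"
  unfolding fpcim_val_def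
  by (rule quot_class_eq_iff[OF monoid_FIM fim_val_closed fim_val_closed]) (use assms in auto)

lemma fpcim_val_eqI:
  assumes "u \<in> lists (Gam \<Sigma>)" "v \<in> lists (Gam \<Sigma>)" "(fim_val \<Sigma> u, fim_val \<Sigma> v) \<in> comm_rels \<Sigma> I"
  shows "fpcim_val \<Sigma> I u = fpcim_val \<Sigma> I v"
  using assms by (simp only: fpcim_val_eq_iff cong_gen.gen fim_val_closed)

lemma fim_val_eqI: "(u, v) \<in> fim_rels \<Sigma> \<Longrightarrow> fim_val \<Sigma> u = fim_val \<Sigma> v"
proof -
  assume uv: "(u, v) \<in> fim_rels \<Sigma>"
  then have "u \<in> lists (Gam \<Sigma>)" "v \<in> lists (Gam \<Sigma>)"
    by (auto simp: fim_rels_def bar_def mem_Gam_iff)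
  with uv show ?thesis
    by (simp add: fim_val_eq_iff cong_gen.gen free_monoid_def)
qed

lemma inv_eq_if_fim_val:
  assumes "fim_val \<Sigma> u = fim_val \<Sigma> v" "u \<in> lists (Gam \<Sigma>)" "v \<in> lists (Gam \<Sigma>)"
  shows "inv_eq I u v"
proof -
  have "(u, v) \<in> cong_gen (free_monoid (Gam \<Sigma>)) (fim_rels \<Sigma>)"
    using assms by (simp add: fim_val_eq_iff)
  then show ?thesis
  proof induction
    case (gen x y)
    then show ?case
      using inv_eq_inverse[of I "bar z" for z]
      by (auto simp: fim_rels_def intro: inv_eq_inverse inv_eq_idem)
  qed (auto simp: free_monoid_def intro: inv_eq_refl inv_eq_append
        elim: inv_eq_sym inv_eq_trans)
qed

text \<open>The outer congruence lives on classes of words. Intermediate classes are given by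
  arbitrary representatives over the alphabet; \<open>inv_eq_if_fim_val\<close> makes the choice
  irrelevant.\<close>

lemma inv_eq_if_fpcim_val:
  assumes "fpcim_val \<Sigma> I u = fpcim_val \<Sigma> I v" "u \<in> lists (Gam \<Sigma>)" "v \<in> lists (Gam \<Sigma>)"
    and "I \<subseteq> \<Sigma> \<times> \<Sigma>"
  shows "inv_eq I u v"
proof -
  have "(fim_val \<Sigma> u, fim_val \<Sigma> v) \<in> cong_gen (FIM \<Sigma>) (comm_rels \<Sigma> I)"
    using assms by (simp add: fpcim_val_eq_iff)
  moreover have "inv_eq I u v"
    if "(X, Y) \<in> cong_gen (FIM \<Sigma>) (comm_rels \<Sigma> I)" "X = fim_val \<Sigma> u" "Y = fim_val \<Sigma> v"
      "u \<in> lists (Gam \<Sigma>)" "v \<in> lists (Gam \<Sigma>)" for X Y u v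
    using that
  proof (induction arbitrary: u v)
    case (gen X Y)
    then obtain a b where "(a, b) \<in> I"
      "X = fim_val \<Sigma> [Inl a, Inl b] \<and> Y = fim_val \<Sigma> [Inl b, Inl a] \<or>
        X = fim_val \<Sigma> [Inr a, Inl b] \<and> Y = fim_val \<Sigma> [Inl b, Inr a]"
      unfolding comm_rels_def by blast
    then obtain c d where cd: "X = fim_val \<Sigma> [c, d]" "Y = fim_val \<Sigma> [d, c]"
      "inv_eq I [c, d] [d, c]" "[c, d] \<in> lists (Gam \<Sigma>)" "[d, c] \<in> lists (Gam \<Sigma>)"
      using assms(4) that inv_eq_pos[of a b I] inv_eq_neg[of a b I] by (auto simp: mem_Gam_iff)
    then have "inv_eq I u [c, d]" "inv_eq I [d, c] v"
      using gen by (auto intro: inv_eq_if_fim_val simp del: in_lists_conv_set)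
    with cd(3) show ?case
      by (blast intro: inv_eq_trans)
  next
    case (refl X)
    then show ?case
      by (auto intro: inv_eq_if_fim_val)
  next
    case (sym X Y)
    then show ?case
      by (blast intro: inv_eq_sym)
  next
    case (trans X Y Z)
    have "Y \<in> carrier (FIM \<Sigma>)"
      using cong_gen_closed[OF monoid_FIM trans.hyps(1)] by simp
    then obtain y where "Y = fim_val \<Sigma> y" "y \<in> lists (Gam \<Sigma>)"
      unfolding carrier_FIM by blast
    then show ?case
      using trans by (blast intro: inv_eq_trans)
  next
    case (mult X Y X' Y')
    have "X \<in> carrier (FIM \<Sigma>)" "Y \<in> carrier (FIM \<Sigma>)" "X' \<in> carrier (FIM \<Sigma>)" "Y' \<in> carrier (FIM \<Sigma>)"
      using cong_gen_closed[OF monoid_FIM mult.hyps(1)] cong_gen_closed[OF monoid_FIM mult.hyps(2)]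
      by simp_all
    then obtain x y x' y' where xy: "X = fim_val \<Sigma> x" "Y = fim_val \<Sigma> y" "X' = fim_val \<Sigma> x'"
      "Y' = fim_val \<Sigma> y'" "x \<in> lists (Gam \<Sigma>)" "y \<in> lists (Gam \<Sigma>)" "x' \<in> lists (Gam \<Sigma>)"
      "y' \<in> lists (Gam \<Sigma>)"
      unfolding carrier_FIM by blast
    then have "inv_eq I (x @ x') (y @ y')"
      using mult.IH by (intro inv_eq_append) blast+
    moreover have "fim_val \<Sigma> u = fim_val \<Sigma> (x @ x')" "fim_val \<Sigma> (y @ y') = fim_val \<Sigma> v"
      using mult.prems(1,2) xy by (simp_all only: fim_val_append)
    then have "inv_eq I u (x @ x')" "inv_eq I (y @ y') v"
      using mult.prems(3,4) xy by (simp_all add: inv_eq_if_fim_val)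
    ultimately show ?case
      by (blast intro: inv_eq_trans)
  qed
  ultimately show ?thesis
    using assms by blast
qed

text \<open>A derivation of \<open>inv_eq\<close> may pass through letters outside the alphabet.
  Erasing them commutes with \<open>bar\<close> and respects every rule, so the erased derivation is
  one in the monoid.\<close>

lemma fpcim_val_if_inv_eq:
  assumes "inv_eq I u v" "I \<subseteq> \<Sigma> \<times> \<Sigma>"
  shows "fpcim_val \<Sigma> I (filter (\<lambda>c. c \<in> Gam \<Sigma>) u) = fpcim_val \<Sigma> I (filter (\<lambda>c. c \<in> Gam \<Sigma>) v)"
  using assms(1)
proof induction
  case (inv_eq_append u v u' v')
  have "filter (\<lambda>c. c \<in> Gam \<Sigma>) x \<in> lists (Gam \<Sigma>)" for x :: "('a + 'a) list"
    by auto
  then show ?case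
    using inv_eq_append by (simp only: filter_append fpcim_val_append)
next
  let ?f = "filter (\<lambda>c. c \<in> Gam \<Sigma>)"
  have f: "?f (bar x) = bar (?f x)" for x :: "('a + 'a) list"
    by (induction x) (auto simp: mem_Gam_iff)
  have fl: "?f x \<in> lists (Gam \<Sigma>)" for x :: "('a + 'a) list"
    by auto
  {
    case (inv_eq_inverse x)
    have "fim_val \<Sigma> (?f x @ bar (?f x) @ ?f x) = fim_val \<Sigma> (?f x)"
      using fl[of x] by (intro fim_val_eqI) (unfold fim_rels_def, blast)
    then show ?case
      by (simp add: f fpcim_val_def)
  next
    case (inv_eq_idem x y)
    have "fim_val \<Sigma> (?f x @ bar (?f x) @ ?f y @ bar (?f y)) =
      fim_val \<Sigma> (?f y @ bar (?f y) @ ?f x @ bar (?f x))"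
      using fl[of x] fl[of y] by (intro fim_val_eqI) (unfold fim_rels_def, blast)
    then show ?case
      by (simp add: f fpcim_val_def)
  }
next
  case (inv_eq_pos a b)
  then have "[Inl a, Inl b] \<in> lists (Gam \<Sigma>)" "[Inl b, Inl a] \<in> lists (Gam \<Sigma>)"
    using assms(2) by (auto simp: mem_Gam_iff)
  moreover have "(fim_val \<Sigma> [Inl a, Inl b], fim_val \<Sigma> [Inl b, Inl a]) \<in> comm_rels \<Sigma> I"
    using inv_eq_pos by (auto simp: comm_rels_def)
  ultimately have "fpcim_val \<Sigma> I [Inl a, Inl b] = fpcim_val \<Sigma> I [Inl b, Inl a]"
    by (rule fpcim_val_eqI)
  then show ?case
    using inv_eq_pos assms(2) by (auto simp: mem_Gam_iff)
next
  case (inv_eq_neg a b)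
  then have "[Inr a, Inl b] \<in> lists (Gam \<Sigma>)" "[Inl b, Inr a] \<in> lists (Gam \<Sigma>)"
    using assms(2) by (auto simp: mem_Gam_iff)
  moreover have "(fim_val \<Sigma> [Inr a, Inl b], fim_val \<Sigma> [Inl b, Inr a]) \<in> comm_rels \<Sigma> I"
    using inv_eq_neg by (auto simp: comm_rels_def)
  ultimately have "fpcim_val \<Sigma> I [Inr a, Inl b] = fpcim_val \<Sigma> I [Inl b, Inr a]"
    by (rule fpcim_val_eqI)
  then show ?case
    using inv_eq_neg assms(2) by (auto simp: mem_Gam_iff)
qed simp_all

theorem (in numbers_game) fpcim_val_eq_iff_labels:
  assumes "u \<in> lists (Gam \<Sigma>)" "v \<in> lists (Gam \<Sigma>)" "I \<subseteq> \<Sigma> \<times> \<Sigma>"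
  shows "fpcim_val \<Sigma> I u = fpcim_val \<Sigma> I v \<longleftrightarrow> all_labels u = all_labels v"
proof -
  have "fpcim_val \<Sigma> I u = fpcim_val \<Sigma> I v" if "inv_eq I u v"
  proof -
    have "filter (\<lambda>c. c \<in> Gam \<Sigma>) u = u" "filter (\<lambda>c. c \<in> Gam \<Sigma>) v = v"
      using assms(1,2) by (auto simp: filter_id_conv)
    then show ?thesis
      using fpcim_val_if_inv_eq[OF that assms(3)] by simp
  qed
  then show ?thesis
    using inv_eq_if_fpcim_val[of \<Sigma> I u v] inv_eq_iff_labels[OF assms(1,2)] assms by blast
qed


section \<open>Counter programs in logarithmic space\<close>

datatype ('c, 'r) com =
    Skip
  | Inc 'r
  | Dec 'r
  | Move head_move
  | Seq "('c, 'r) com" "('c, 'r) com" (infixr ";;" 60)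
  | If "'c input_symbol \<Rightarrow> ('r \<Rightarrow> bool) \<Rightarrow> bool" "('c, 'r) com" "('c, 'r) com"
  | While "'c input_symbol \<Rightarrow> ('r \<Rightarrow> bool) \<Rightarrow> bool" "('c, 'r) com"

text \<open>Registers hold natural numbers up to \<open>B\<close>; a command that would exceed the bound has no
  result. Tests see the scanned input symbol and which registers are zero.\<close>

inductive exec :: "'c list \<Rightarrow> nat \<Rightarrow> ('c, 'r) com \<Rightarrow> nat \<times> ('r \<Rightarrow> nat) \<Rightarrow> nat \<times> ('r \<Rightarrow> nat) \<Rightarrow> bool"
  for w B where
  exec_Skip: "exec w B Skip s s"
| exec_Inc: "st r < B \<Longrightarrow> exec w B (Inc r) (p, st) (p, st(r := Suc (st r)))"
| exec_Dec: "0 < st r \<Longrightarrow> exec w B (Dec r) (p, st) (p, st(r := st r - 1))"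
| exec_Move: "exec w B (Move d) (p, st) (move_input (length w) d p, st)"
| exec_Seq: "exec w B c s s' \<Longrightarrow> exec w B c' s' s'' \<Longrightarrow> exec w B (c ;; c') s s''"
| exec_If: "exec w B (if t (input_at w (fst s)) (\<lambda>r. snd s r = 0) then c else c') s s'
    \<Longrightarrow> exec w B (If t c c') s s'"
| exec_While_False: "\<not> t (input_at w (fst s)) (\<lambda>r. snd s r = 0) \<Longrightarrow> exec w B (While t c) s s"
| exec_While_True: "t (input_at w (fst s)) (\<lambda>r. snd s r = 0) \<Longrightarrow> exec w B c s s'
    \<Longrightarrow> exec w B (While t c) s' s'' \<Longrightarrow> exec w B (While t c) s s''"

fun regs :: "('c, 'r) com \<Rightarrow> 'r set" where
  "regs (Inc r) = {r}"
| "regs (Dec r) = {r}"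
| "regs (c ;; c') = regs c \<union> regs c'"
| "regs (If t c c') = regs c \<union> regs c'"
| "regs (While t c) = regs c"
| "regs _ = {}"

lemma finite_regs: "finite (regs c)"
  by (induction c) auto

text \<open>Registers are stored in bijective base 2, least significant digit first, so that a register
  is zero iff the first cell is blank.\<close>

fun binc :: "nat list \<Rightarrow> nat list" where
  "binc [] = [1]"
| "binc (d # ds) = (if d = 2 then 1 # binc ds else Suc d # ds)"

fun bdec :: "nat list \<Rightarrow> nat list" where
  "bdec [] = []"
| "bdec (d # ds) = (if d = 2 then 1 # ds else if ds = [] then [] else 2 # bdec ds)"

definition digits :: "nat \<Rightarrow> nat list" where
  "digits v = (binc ^^ v) []"

lemma digits_0 [simp]: "digits 0 = []"
  and digits_Suc [simp]: "digits (Suc v) = binc (digits v)"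
  by (simp_all add: digits_def)

lemma binc_neq_Nil [simp]: "binc ds \<noteq> []"
  by (cases ds) auto

lemma set_binc: "set ds \<subseteq> {1, 2} \<Longrightarrow> set (binc ds) \<subseteq> {1, 2}"
  by (induction ds) auto

lemma set_digits: "set (digits v) \<subseteq> {1, 2}"
proof (induction v)
  case (Suc v)
  then show ?case
    using set_binc by simp
qed simp

lemma bdec_binc: "set ds \<subseteq> {1, 2} \<Longrightarrow> bdec (binc ds) = ds"
  by (induction ds) auto

lemma bdec_digits: "0 < v \<Longrightarrow> bdec (digits v) = digits (v - 1)"
  using bdec_binc[OF set_digits] by (cases v) auto

lemma digits_eq_Nil_iff [simp]: "digits v = [] \<longleftrightarrow> v = 0"
  by (cases v) auto

fun bval :: "nat list \<Rightarrow> nat" where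
  "bval [] = 0"
| "bval (d # ds) = d + 2 * bval ds"

lemma bval_binc: "set ds \<subseteq> {1, 2} \<Longrightarrow> bval (binc ds) = Suc (bval ds)"
  by (induction ds) auto

lemma bval_digits: "bval (digits v) = v"
  by (induction v) (simp_all add: bval_binc[OF set_digits])

text \<open>Each digit is at least 1, so \<open>k\<close> digits have value at least
  \<open>2 ^ k - 1\<close>. This makes the tapes logarithmically short.\<close>

lemma length_le_bval: "set ds \<subseteq> {1, 2} \<Longrightarrow> 2 ^ length ds \<le> Suc (bval ds)"
  by (induction ds) auto

lemma length_digits: "2 ^ length (digits v) \<le> Suc v"
  using length_le_bval[OF set_digits, of v] by (simp add: bval_digits)

section \<open>Digit strings on tapes\<close>

definition tape :: "nat list \<Rightarrow> int \<Rightarrow> nat" where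
  "tape ds z = (if 0 \<le> z \<and> z < int (length ds) then ds ! nat z else 0)"

lemma tape_Nil: "tape [] = (\<lambda>_. 0)"
  by (auto simp: tape_def)

lemma tape_at: "tape (pre @ d # ds) (int (length pre)) = d"
  by (simp add: tape_def)

lemma tape_end: "tape ds (int (length ds)) = 0"
  by (simp add: tape_def)

lemma tape_minus_one [simp]: "tape ds (- 1) = 0"
  by (simp add: tape_def)

lemma tape_update: "(tape (pre @ d # ds))(int (length pre) := e) = tape (pre @ e # ds)"
  by (auto simp: tape_def fun_eq_iff nth_append nth_Cons split: nat.split)

lemma tape_extend: "(tape pre)(int (length pre) := e) = tape (pre @ [e])"
  by (auto simp: tape_def fun_eq_iff nth_append)

lemma tape_erase: "(tape (pre @ [d]))(int (length pre) := 0) = tape pre"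
  by (auto simp: tape_def fun_eq_iff nth_append)

lemma tape_pos:
  assumes "set ds \<subseteq> {1, 2}" "0 \<le> h" "h < int (length ds)"
  shows "tape ds h \<noteq> 0"
proof -
  have "ds ! nat h \<in> set ds"
    using assms(2,3) by simp
  then have "ds ! nat h \<in> {1, 2}"
    using assms(1) by blast
  then show ?thesis
    using assms(2,3) by (auto simp: tape_def)
qed

lemma tape_digits_0: "tape (digits v) 0 = 0 \<longleftrightarrow> v = 0"
  using tape_pos[OF set_digits, of 0 v] by (cases "v = 0") (auto simp: tape_Nil)

text \<open>The control of the simulating machine: a stack of pending commands, or one of the phases of
  an increment or decrement of register \<open>r\<close>.\<close>

datatype ('c, 'r) control =
    Run "('c, 'r) com list"
  | Carry 'r "('c, 'r) com list"
  | Borrow 'r "('c, 'r) com list"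
  | Erase 'r "('c, 'r) com list"
  | Rewind 'r "('c, 'r) com list"
  | Halt bool

definition idle :: "('r \<Rightarrow> nat) \<Rightarrow> 'r \<Rightarrow> nat \<times> head_move" where
  "idle ss = (\<lambda>r. (ss r, Stay))"

text \<open>\<open>Borrow\<close> turns ones into twos on its way right, in the hope of a digit 2.
  If it meets the blank instead, all digits were 1 and the result is one digit shorter:
  \<open>Erase\<close> removes the last tentative 2. For \<open>Carry\<close> a blank counts as
  digit 0, so the successor of the scanned symbol is right at the end of the string too.
  \<open>Rewind\<close> finds the front by the blank in cell \<open>-1\<close>.\<close>

fun delta :: "'r \<Rightarrow> ('c, 'r) control \<Rightarrow> 'c input_symbol \<Rightarrow> ('r \<Rightarrow> nat)
    \<Rightarrow> ('c, 'r) control \<times> head_move \<times> ('r \<Rightarrow> nat \<times> head_move)" where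
  "delta acc (Run []) x ss = (Halt (ss acc = 0), Stay, idle ss)"
| "delta acc (Run (Skip # K)) x ss = (Run K, Stay, idle ss)"
| "delta acc (Run (Inc r # K)) x ss = (Carry r K, Stay, idle ss)"
| "delta acc (Run (Dec r # K)) x ss = (Borrow r K, Stay, idle ss)"
| "delta acc (Run (Move d # K)) x ss = (Run K, d, idle ss)"
| "delta acc (Run ((c ;; c') # K)) x ss = (Run (c # c' # K), Stay, idle ss)"
| "delta acc (Run (If t c c' # K)) x ss =
    (Run ((if t x (\<lambda>r. ss r = 0) then c else c') # K), Stay, idle ss)"
| "delta acc (Run (While t c # K)) x ss =
    (Run (if t x (\<lambda>r. ss r = 0) then c # While t c # K else K), Stay, idle ss)"
| "delta acc (Carry r K) x ss =
    (if ss r = 2 then (Carry r K, Stay, (idle ss)(r := (1, Go_Right)))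
     else (Rewind r K, Stay, (idle ss)(r := (Suc (ss r), Stay))))"
| "delta acc (Borrow r K) x ss =
    (if ss r = 1 then (Borrow r K, Stay, (idle ss)(r := (2, Go_Right)))
     else if ss r = 2 then (Rewind r K, Stay, (idle ss)(r := (1, Stay)))
     else (Erase r K, Stay, (idle ss)(r := (0, Go_Left))))"
| "delta acc (Erase r K) x ss = (Rewind r K, Stay, (idle ss)(r := (0, Go_Left)))"
| "delta acc (Rewind r K) x ss =
    (if ss r = 0 then (Run K, Stay, (idle ss)(r := (0, Go_Right)))
     else (Rewind r K, Stay, (idle ss)(r := (ss r, Go_Left))))"
| "delta acc (Halt b) x ss = (Halt b, Stay, idle ss)"

text \<open>The pending stacks that occur from the start of \<open>c\<close> until only
  \<open>K\<close> is left. The set is finite because a loop pushes its body onto the very stack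
  that it started from, so iterations do not pile up.\<close>

fun stacks :: "('c, 'r) com \<Rightarrow> ('c, 'r) com list \<Rightarrow> ('c, 'r) com list set" where
  "stacks (c ;; c') K = insert ((c ;; c') # K) (stacks c (c' # K) \<union> stacks c' K)"
| "stacks (If t c c') K = insert (If t c c' # K) (stacks c K \<union> stacks c' K)"
| "stacks (While t c) K = insert (While t c # K) (stacks c (While t c # K))"
| "stacks c K = {c # K}"

fun succs :: "('c, 'r) com list \<Rightarrow> ('c, 'r) com list set" where
  "succs [] = {}"
| "succs ((c ;; c') # K) = {c # c' # K}"
| "succs (If t c c' # K) = {c # K, c' # K}"
| "succs (While t c # K) = {c # While t c # K, K}"
| "succs (c # K) = {K}"

lemma finite_stacks: "finite (stacks c K)"
  by (induction c arbitrary: K) auto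

lemma Cons_in_stacks: "c # K \<in> stacks c K"
  by (cases c) auto

lemma succs_stacks: "L \<in> stacks c K \<Longrightarrow> succs L \<subseteq> insert K (stacks c K)"
proof (induction c arbitrary: K)
  case (Seq c c')
  then consider "L = (c ;; c') # K" | "L \<in> stacks c (c' # K)" | "L \<in> stacks c' K"
    by auto
  then show ?case
    using Seq.IH(1)[of "c' # K"] Seq.IH(2)[of K] Cons_in_stacks[of c "c' # K"]
      Cons_in_stacks[of c' K]
    by cases auto
next
  case (If t c c')
  then consider "L = If t c c' # K" | "L \<in> stacks c K" | "L \<in> stacks c' K"
    by auto
  then show ?case
    using If.IH(1)[of K] If.IH(2)[of K] Cons_in_stacks[of c K] Cons_in_stacks[of c' K]
    by cases auto
next
  case (While t c)
  then consider "L = While t c # K" | "L \<in> stacks c (While t c # K)"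
    by auto
  then show ?case
    using While.IH[of "While t c # K"] Cons_in_stacks[of c "While t c # K"]
    by cases auto
qed auto

lemma hd_stacks:
  "L \<in> stacks c K \<Longrightarrow> L = Inc r # K' \<or> L = Dec r # K' \<Longrightarrow> r \<in> regs c"
  by (induction c arbitrary: K) auto

definition controls :: "'r \<Rightarrow> ('c, 'r) com \<Rightarrow> ('c, 'r) control set" where
  "controls acc c =
    (let KS = insert [] (stacks c []); R = insert acc (regs c) in
      {Halt True, Halt False} \<union> Run ` KS \<union>
      (\<Union>r \<in> R. Carry r ` KS \<union> Borrow r ` KS \<union> Erase r ` KS \<union> Rewind r ` KS))"

lemma finite_controls: "finite (controls acc c)"
  by (simp add: controls_def Let_def finite_stacks finite_regs)

lemma delta_closed:
  assumes "q \<in> controls acc c"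
  shows "fst (delta acc q x ss) \<in> controls acc c"
proof -
  define KS where "KS = insert [] (stacks c [])"
  define R where "R = insert acc (regs c)"
  have ctl: "controls acc c = {Halt True, Halt False} \<union> Run ` KS \<union>
      (\<Union>r \<in> R. Carry r ` KS \<union> Borrow r ` KS \<union> Erase r ` KS \<union> Rewind r ` KS)"
    unfolding controls_def KS_def R_def Let_def by (rule HOL.refl)
  have succ: "succs K \<subseteq> KS" if "K \<in> KS" for K
    using that succs_stacks[of K c "[]"] by (auto simp: KS_def)
  have hd: "r \<in> R" if "K \<in> KS" "K = Inc r # K' \<or> K = Dec r # K'" for K K' r
    using that hd_stacks[of K c "[]" r K'] by (auto simp: KS_def R_def)
  consider K where "q = Run K" "K \<in> KS" | r K where "r \<in> R" "K \<in> KS"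
      "q \<in> {Carry r K, Borrow r K, Erase r K, Rewind r K}" | b where "q = Halt b"
    using assms by (auto simp: ctl)
  then show ?thesis
  proof cases
    case 1
    show ?thesis
    proof (cases K)
      case Nil
      then show ?thesis
        using 1 by (auto simp: ctl)
    next
      case (Cons d L)
      then show ?thesis
        using 1 succ[of K] hd[of K] by (cases d) (auto simp: ctl)
    qed
  next
    case 2
    then have "Run K \<in> controls acc c" "Carry r K \<in> controls acc c" "Borrow r K \<in> controls acc c"
      "Erase r K \<in> controls acc c" "Rewind r K \<in> controls acc c"
      unfolding ctl by blast+
    then show ?thesis
      using 2(3) by auto
  next
    case 3
    then show ?thesis
      by (cases b) (auto simp: ctl)
  qed
qed

lemma delta_symbols:
  assumes "\<And>r. ss r < 3"
  shows "fst ((snd (snd (delta acc q x ss))) r) < 3"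
proof -
  have "ss r \<noteq> 2 \<Longrightarrow> Suc (ss r) < 3" for r
    using assms[of r] by linarith
  then show ?thesis
    by (cases "(acc, q, x, ss)" rule: delta.cases) (auto simp: idle_def assms)
qed

lemma delta_outside:
  assumes "q \<in> controls acc c" "r \<notin> insert acc (regs c)"
  shows "snd (snd (delta acc q x ss)) r = (ss r, Stay)"
  using assms
  by (cases "(acc, q, x, ss)" rule: delta.cases) (auto simp: idle_def controls_def)

section \<open>Simulation with one tape for each register\<close>

type_synonym ('c, 'r) config = "('c, 'r) control \<times> nat \<times> ('r \<Rightarrow> int \<times> (int \<Rightarrow> nat))"

fun put :: "nat \<times> head_move \<Rightarrow> int \<times> (int \<Rightarrow> nat) \<Rightarrow> int \<times> (int \<Rightarrow> nat)" where
  "put (s, e) (h, T) = (move_work e h, T(h := s))"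

definition scanned :: "('r \<Rightarrow> int \<times> (int \<Rightarrow> nat)) \<Rightarrow> 'r \<Rightarrow> nat" where
  "scanned g = (\<lambda>r. snd (g r) (fst (g r)))"

lemma scanned_update [simp]: "scanned (g(r := (h, T))) r = T h"
  by (simp add: scanned_def)

lemma put_scanned [simp]: "put (scanned g r, Stay) (g r) = g r"
  by (cases "g r") (simp add: scanned_def)

lemma put_read: "put (snd (g x) (fst (g x)), Stay) (g x) = g x"
  by (cases "g x") simp

fun next_config :: "'r \<Rightarrow> 'c list \<Rightarrow> ('c, 'r) config \<Rightarrow> ('c, 'r) config" where
  "next_config acc w (q, p, g) =
    (case delta acc q (input_at w p) (scanned g) of
      (q', d, a) \<Rightarrow> (q', move_input (length w) d p, \<lambda>r. put (a r) (g r)))"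

lemma put_idle [simp]: "(\<lambda>r. put (idle (scanned g) r) (g r)) = g"
  by (simp add: idle_def)

lemma put_idle_update [simp]:
  "(\<lambda>x. put (((idle (scanned (g(r := hT))))(r := se)) x) ((g(r := hT)) x)) = g(r := put se hT)"
  by (auto simp: idle_def fun_eq_iff scanned_def put_read)

declare next_config.simps [simp del]

lemma next_Run:
  "next_config acc w (Run (Inc r # K), p, g) = (Carry r K, p, g)"
  "next_config acc w (Run (Dec r # K), p, g) = (Borrow r K, p, g)"
  by (simp_all add: next_config.simps)

lemma next_Carry:
  "next_config acc w (Carry r K, p, g(r := (h, T))) =
    (if T h = 2 then (Carry r K, p, g(r := (h + 1, T(h := 1))))
     else (Rewind r K, p, g(r := (h, T(h := Suc (T h))))))"
  by (simp add: next_config.simps del: fun_upd_apply)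

lemma next_Borrow:
  "next_config acc w (Borrow r K, p, g(r := (h, T))) =
    (if T h = 1 then (Borrow r K, p, g(r := (h + 1, T(h := 2))))
     else if T h = 2 then (Rewind r K, p, g(r := (h, T(h := 1))))
     else (Erase r K, p, g(r := (h - 1, T(h := 0)))))"
  by (simp add: next_config.simps del: fun_upd_apply)

lemma next_Erase:
  "next_config acc w (Erase r K, p, g(r := (h, T))) = (Rewind r K, p, g(r := (h - 1, T(h := 0))))"
  by (simp add: next_config.simps del: fun_upd_apply)

lemma next_Rewind:
  "next_config acc w (Rewind r K, p, g(r := (h, T))) =
    (if T h = 0 then (Run K, p, g(r := (h + 1, T))) else (Rewind r K, p, g(r := (h - 1, T))))"
  using fun_upd_idem[of T h 0] by (simp add: next_config.simps del: fun_upd_apply)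

fun heads_within :: "nat \<Rightarrow> ('c, 'r) config \<Rightarrow> bool" where
  "heads_within n (q, p, g) \<longleftrightarrow> (\<forall>r. - 1 \<le> fst (g r) \<and> fst (g r) \<le> int n)"

text \<open>A computation together with its space bound: every configuration that is left has its
  heads in range. The final one is exempt, so that computations can be concatenated.\<close>

inductive steps :: "'r \<Rightarrow> 'c list \<Rightarrow> nat \<Rightarrow> ('c, 'r) config \<Rightarrow> ('c, 'r) config \<Rightarrow> bool"
  for acc w n where
  steps_refl: "steps acc w n x x"
| steps_step: "heads_within n x \<Longrightarrow> steps acc w n (next_config acc w x) y \<Longrightarrow> steps acc w n x y"

lemma steps_trans: "steps acc w n x y \<Longrightarrow> steps acc w n y z \<Longrightarrow> steps acc w n x z"
  by (induction rule: steps.induct) (auto intro: steps.intros)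

lemma steps_stepI:
  "next_config acc w x = y \<Longrightarrow> steps acc w n y z \<Longrightarrow> heads_within n x \<Longrightarrow> z = z' \<Longrightarrow>
    steps acc w n x z'"
  by (blast intro: steps_step)

lemma steps_single: "heads_within n x \<Longrightarrow> steps acc w n x (next_config acc w x)"
  by (rule steps_step[OF _ steps_refl])

lemma steps_Rewind:
  assumes "\<And>x. - 1 \<le> fst (g x) \<and> fst (g x) \<le> int n"
    and "set ds \<subseteq> {1, 2}" "- 1 \<le> h" "h < int (length ds)" "length ds \<le> n"
  shows "steps acc w n (Rewind r K, p, g(r := (h, tape ds))) (Run K, p, g(r := (0, tape ds)))"
  using assms(3,4)
proof (induction "nat (h + 1)" arbitrary: h)
  case 0
  then have h: "h = - 1"
    by simp
  have "next_config acc w (Rewind r K, p, g(r := (h, tape ds))) = (Run K, p, g(r := (0, tape ds)))"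
    by (simp add: h next_Rewind)
  then show ?case
    by (rule steps_stepI[OF _ steps_refl]) (use assms(1) h in auto)
next
  case (Suc k)
  then have h: "0 \<le> h"
    by simp
  have "next_config acc w (Rewind r K, p, g(r := (h, tape ds))) = (Rewind r K, p, g(r := (h - 1, tape ds)))"
    using tape_pos[OF assms(2) h] Suc.prems by (simp add: next_Rewind)
  moreover have "steps acc w n (Rewind r K, p, g(r := (h - 1, tape ds))) (Run K, p, g(r := (0, tape ds)))"
    by (rule Suc.hyps(1)) (use Suc h in auto)
  ultimately show ?case
    by (rule steps_stepI) (use assms(1,5) Suc.prems in auto)
qed

lemma steps_Carry:
  assumes "\<And>x. - 1 \<le> fst (g x) \<and> fst (g x) \<le> int n"
    and "set (pre @ ds) \<subseteq> {1, 2}" "length (pre @ binc ds) \<le> n"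
  shows "steps acc w n (Carry r K, p, g(r := (int (length pre), tape (pre @ ds))))
    (Run K, p, g(r := (0, tape (pre @ binc ds))))"
  using assms(2,3)
proof (induction ds arbitrary: pre)
  case Nil
  have "next_config acc w (Carry r K, p, g(r := (int (length pre), tape (pre @ [])))) =
      (Rewind r K, p, g(r := (int (length pre), tape (pre @ [1]))))"
    using tape_extend[of pre 1] by (simp add: next_Carry tape_end)
  moreover have "steps acc w n (Rewind r K, p, g(r := (int (length pre), tape (pre @ [1]))))
      (Run K, p, g(r := (0, tape (pre @ [1]))))"
    using assms(1) Nil by (intro steps_Rewind) auto
  ultimately show ?case
    by (rule steps_stepI) (use assms(1) Nil in auto)
next
  case (Cons d ds)
  show ?case
  proof (cases "d = 2")
    case True
    have "next_config acc w (Carry r K, p, g(r := (int (length pre), tape (pre @ d # ds)))) =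
        (Carry r K, p, g(r := (int (length (pre @ [1])), tape ((pre @ [1]) @ ds))))"
      using True by (simp add: next_Carry next_Borrow tape_at tape_update add.commute)
    moreover have "steps acc w n (Carry r K, p, g(r := (int (length (pre @ [1])), tape ((pre @ [1]) @ ds))))
        (Run K, p, g(r := (0, tape ((pre @ [1]) @ binc ds))))"
      using Cons.prems True by (intro Cons.IH) auto
    ultimately show ?thesis
      by (rule steps_stepI) (use assms(1) Cons.prems True in auto)
  next
    case False
    have "next_config acc w (Carry r K, p, g(r := (int (length pre), tape (pre @ d # ds)))) =
        (Rewind r K, p, g(r := (int (length pre), tape (pre @ Suc d # ds))))"
      using False by (simp add: next_Carry next_Borrow tape_at tape_update)
    moreover have "steps acc w n (Rewind r K, p, g(r := (int (length pre), tape (pre @ Suc d # ds))))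
        (Run K, p, g(r := (0, tape (pre @ Suc d # ds))))"
      using assms(1) Cons.prems False by (intro steps_Rewind) auto
    ultimately show ?thesis
      by (rule steps_stepI) (use assms(1) Cons.prems False in auto)
  qed
qed

lemma steps_Borrow:
  assumes "\<And>x. - 1 \<le> fst (g x) \<and> fst (g x) \<le> int n"
    and "set (pre @ ds) \<subseteq> {1, 2}" "length (pre @ ds) \<le> n" "ds \<noteq> []"
  shows "steps acc w n (Borrow r K, p, g(r := (int (length pre), tape (pre @ ds))))
    (Run K, p, g(r := (0, tape (pre @ bdec ds))))"
  using assms(2-)
proof (induction ds arbitrary: pre)
  case (Cons d ds)
  show ?case
  proof (cases "d = 2")
    case True
    have "next_config acc w (Borrow r K, p, g(r := (int (length pre), tape (pre @ d # ds)))) =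
        (Rewind r K, p, g(r := (int (length pre), tape (pre @ 1 # ds))))"
      using True by (simp add: next_Carry next_Borrow tape_at tape_update)
    moreover have "steps acc w n (Rewind r K, p, g(r := (int (length pre), tape (pre @ 1 # ds))))
        (Run K, p, g(r := (0, tape (pre @ 1 # ds))))"
      using assms(1) Cons.prems by (intro steps_Rewind) auto
    ultimately show ?thesis
      by (rule steps_stepI) (use assms(1) Cons.prems True in auto)
  next
    case False
    then have d: "d = 1"
      using Cons.prems by simp
    have step: "next_config acc w (Borrow r K, p, g(r := (int (length pre), tape (pre @ d # ds)))) =
        (Borrow r K, p, g(r := (int (length (pre @ [2])), tape ((pre @ [2]) @ ds))))"
      using d by (simp add: next_Carry next_Borrow tape_at tape_update add.commute)
    show ?thesis
    \<comment> \<open>A digit 1 at the end of the string has to disappear. The head learns only from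
      the blank behind it that this was the end, and steps back to erase the 2 just written.\<close>
    proof (cases "ds = []")
      case True
      let ?h = "int (length pre)"
      have S1: "next_config acc w (Borrow r K, p, g(r := (?h + 1, tape (pre @ [2])))) =
          (Erase r K, p, g(r := (?h, tape (pre @ [2]))))"
        using tape_end[of "pre @ [2]"] fun_upd_triv[of "tape (pre @ [2])" "?h + 1"]
        by (simp add: next_Borrow add.commute)
      have S2: "next_config acc w (Erase r K, p, g(r := (?h, tape (pre @ [2])))) =
          (Rewind r K, p, g(r := (?h - 1, tape pre)))"
        by (simp add: next_Erase tape_erase)
      have S3: "steps acc w n (Rewind r K, p, g(r := (?h - 1, tape pre)))
          (Run K, p, g(r := (0, tape pre)))"
        using assms(1) Cons.prems by (intro steps_Rewind) auto
      have "steps acc w n (Erase r K, p, g(r := (?h, tape (pre @ [2])))) (Run K, p, g(r := (0, tape pre)))"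
        by (rule steps_stepI[OF S2 S3]) (use assms(1) Cons.prems in auto)
      then have "steps acc w n (Borrow r K, p, g(r := (?h + 1, tape (pre @ [2]))))
          (Run K, p, g(r := (0, tape pre)))"
        by (rule steps_stepI[OF S1]) (use assms(1) Cons.prems in auto)
      then have "steps acc w n (Borrow r K, p, g(r := (int (length (pre @ [2])), tape ((pre @ [2]) @ ds))))
          (Run K, p, g(r := (0, tape (pre @ bdec (d # ds)))))"
        using True d by (simp add: add.commute)
      with step show ?thesis
        by (rule steps_stepI) (use assms(1) Cons.prems in auto)
    next
      case False
      have "steps acc w n (Borrow r K, p, g(r := (int (length (pre @ [2])), tape ((pre @ [2]) @ ds))))
          (Run K, p, g(r := (0, tape ((pre @ [2]) @ bdec ds))))"
        using Cons.prems False by (intro Cons.IH) auto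
      then have "steps acc w n (Borrow r K, p, g(r := (int (length (pre @ [2])), tape ((pre @ [2]) @ ds))))
          (Run K, p, g(r := (0, tape (pre @ bdec (d # ds)))))"
        using False d by simp
      with step show ?thesis
        by (rule steps_stepI) (use assms(1) Cons.prems in auto)
    qed
  qed
qed simp

definition tapes :: "('r \<Rightarrow> nat) \<Rightarrow> 'r \<Rightarrow> int \<times> (int \<Rightarrow> nat)" where
  "tapes st = (\<lambda>r. (0, tape (digits (st r))))"

lemma tapes_update: "tapes (st(r := v)) = (tapes st)(r := (0, tape (digits v)))"
  by (auto simp: tapes_def)

lemma scanned_tapes: "(\<lambda>r. scanned (tapes st) r = 0) = (\<lambda>r. st r = 0)"
  by (simp add: scanned_def tapes_def tape_digits_0)

text \<open>Between commands all heads are on cell 0 and each tape holds exactly the digits of its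
  register. As \<open>K\<close> is arbitrary, the claim for a sequence or a loop is composed from
  those for its parts.\<close>

lemma steps_exec:
  assumes "exec w B c s s'" "\<And>v. v \<le> B \<Longrightarrow> length (digits v) \<le> n" "\<And>r. snd s r \<le> B"
  shows "steps acc w n (Run (c # K), fst s, tapes (snd s)) (Run K, fst s', tapes (snd s')) \<and>
    (\<forall>r. snd s' r \<le> B)"
  using assms(1,3)
proof (induction arbitrary: K)
  have tapes_ok: "- 1 \<le> fst (tapes st x) \<and> fst (tapes st x) \<le> int n" for st :: "'b \<Rightarrow> nat" and x
    by (simp add: tapes_def)
  have one_step: "steps acc w n (q, p, tapes st) y"
    if "next_config acc w (q, p, tapes st) = y" for q p and st :: "'b \<Rightarrow> nat" and y
    using steps_single[of n "(q, p, tapes st)" acc w] that tapes_ok by simp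
  {
    case (exec_Skip s)
    then show ?case
      by (auto intro!: one_step simp: next_config.simps)
  next
    case (exec_Inc st r p)
    let ?ds = "digits (st r)"
    have "steps acc w n (Carry r K, p, (tapes st)(r := (int (length ([] :: nat list)), tape ([] @ ?ds))))
        (Run K, p, (tapes st)(r := (0, tape ([] @ binc ?ds))))"
      using assms(2)[of "Suc (st r)"] exec_Inc set_digits[of "st r"] tapes_ok
      by (intro steps_Carry) auto
    moreover have "(tapes st)(r := (int (length ([] :: nat list)), tape ([] @ ?ds))) = tapes st"
      by (simp add: tapes_def fun_upd_idem)
    ultimately have "steps acc w n (Carry r K, p, tapes st) (Run K, p, tapes (st(r := Suc (st r))))"
      by (simp add: tapes_update)
    then have "steps acc w n (Run (Inc r # K), p, tapes st) (Run K, p, tapes (st(r := Suc (st r))))"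
      using tapes_ok by (intro steps_stepI[OF next_Run(1)]) simp_all
    moreover have "(st(r := Suc (st r))) x \<le> B" for x
      using exec_Inc by auto
    ultimately show ?case
      by (simp del: fun_upd_apply)
  next
    case (exec_Dec st r p)
    let ?ds = "digits (st r)"
    have "steps acc w n (Borrow r K, p, (tapes st)(r := (int (length ([] :: nat list)), tape ([] @ ?ds))))
        (Run K, p, (tapes st)(r := (0, tape ([] @ bdec ?ds))))"
      using assms(2)[of "st r"] exec_Dec set_digits[of "st r"] tapes_ok
      by (intro steps_Borrow) auto
    moreover have "(tapes st)(r := (int (length ([] :: nat list)), tape ([] @ ?ds))) = tapes st"
      by (simp add: tapes_def fun_upd_idem)
    ultimately have "steps acc w n (Borrow r K, p, tapes st) (Run K, p, tapes (st(r := st r - 1)))"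
      using exec_Dec.hyps by (simp add: tapes_update bdec_digits)
    then have "steps acc w n (Run (Dec r # K), p, tapes st) (Run K, p, tapes (st(r := st r - 1)))"
      using tapes_ok by (intro steps_stepI[OF next_Run(2)]) simp_all
    moreover have "(st(r := st r - 1)) x \<le> B" for x
      using exec_Dec(2)[of x] by auto
    ultimately show ?case
      by (simp del: fun_upd_apply)
  next
    case (exec_Move d p st)
    then show ?case
      by (auto intro!: one_step simp: next_config.simps)
  next
    case (exec_Seq c s s' c' s'')
    have "steps acc w n (Run ((c ;; c') # K), fst s, tapes (snd s)) (Run (c # c' # K), fst s, tapes (snd s))"
      by (rule one_step) (simp add: next_config.simps)
    then show ?case
      using exec_Seq by (meson steps_trans)
  next
    case (exec_If t s c c' s')
    have "steps acc w n (Run (If t c c' # K), fst s, tapes (snd s))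
        (Run ((if t (input_at w (fst s)) (\<lambda>r. snd s r = 0) then c else c') # K), fst s, tapes (snd s))"
      by (rule one_step) (simp add: scanned_tapes next_config.simps)
    then show ?case
      using exec_If by (meson steps_trans)
  next
    case (exec_While_False t s c)
    then show ?case
      by (auto intro!: one_step simp: scanned_tapes next_config.simps)
  next
    case (exec_While_True t s c s' s'')
    have "steps acc w n (Run (While t c # K), fst s, tapes (snd s))
        (Run (c # While t c # K), fst s, tapes (snd s))"
      using exec_While_True.hyps(1) by (intro one_step) (simp add: scanned_tapes next_config.simps)
    then show ?case
      using exec_While_True by (meson steps_trans)
  }
qed

text \<open>Space is measured over all times. A halted configuration is a fixed point, so the bound
  for the finite computation extends to all of them.\<close>

lemma steps_halt:
  assumes "steps acc w n x y" "next_config acc w y = y" "heads_within n y"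
  shows "(\<exists>t. (next_config acc w ^^ t) x = y) \<and> (\<forall>t. heads_within n ((next_config acc w ^^ t) x))"
  using assms
proof (induction rule: steps.induct)
  case (steps_refl x)
  have "(next_config acc w ^^ t) x = x" for t
    by (induction t) (simp_all add: steps_refl)
  then show ?case
    using steps_refl by auto
next
  case (steps_step x y)
  then obtain t where "(next_config acc w ^^ t) (next_config acc w x) = y"
    by auto
  then have "(next_config acc w ^^ Suc t) x = y"
    by (simp only: funpow_Suc_right o_apply)
  moreover have "heads_within n ((next_config acc w ^^ t) x)" for t
    using steps_step by (cases t) (simp_all only: funpow_0 funpow_Suc_right o_apply)
  ultimately show ?case
    by blast
qed

section \<open>The Turing machine of a program\<close>

definition tm_of :: "'r \<Rightarrow> ('c, 'r) com \<Rightarrow> 'r list \<Rightarrow> (('c, 'r) control \<Rightarrow> nat) \<Rightarrow> 'c tm" where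
  "tm_of acc c rs enc =
    \<lparr>num_states = card (controls acc c), num_symbols = 3, num_tapes = length rs,
     start_state = enc (Run [c]), accept_state = enc (Halt True), reject_state = enc (Halt False),
     trans_fun = (\<lambda>q x ss.
       case delta acc (inv_into (controls acc c) enc q) x
         (\<lambda>r. case map_of (zip rs ss) r of None \<Rightarrow> 0 | Some s \<Rightarrow> s) of
         (q', d, a) \<Rightarrow> (enc q', d, map a rs))\<rparr>"

context
  fixes acc :: 'r and c :: "('c, 'r) com" and rs :: "'r list"
    and enc :: "('c, 'r) control \<Rightarrow> nat" and w :: "'c list"
  assumes enc: "bij_betw enc (controls acc c) {..<card (controls acc c)}"
    and rs: "set rs = insert acc (regs c)"
begin

lemma inv_enc: "q \<in> controls acc c \<Longrightarrow> inv_into (controls acc c) enc (enc q) = q"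
  using enc by (auto simp: bij_betw_def)

lemma enc_less: "q \<in> controls acc c \<Longrightarrow> enc q < card (controls acc c)"
  using enc by (auto simp: bij_betw_def)

lemma enc_eq: "q \<in> controls acc c \<Longrightarrow> q' \<in> controls acc c \<Longrightarrow> enc q = enc q' \<longleftrightarrow> q = q'"
  using enc by (auto simp: bij_betw_def inj_on_def)

lemma basic_controls: "Halt b \<in> controls acc c" "Run [c] \<in> controls acc c"
  using Cons_in_stacks[of c "[]"] unfolding controls_def Let_def by (cases b; blast)+

lemma wf_tm_of: "wf_tm A (tm_of acc c rs enc)"
proof -
  have "case trans_fun (tm_of acc c rs enc) q x ss of (q', d, acts) \<Rightarrow>
      q' < card (controls acc c) \<and> length acts = length rs \<and> fst ` set acts \<subseteq> {..<3}"
    if q: "q < card (controls acc c)" and ss: "set ss \<subseteq> {..<3}" for q x and ss :: "nat list"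
  proof -
    let ?q = "inv_into (controls acc c) enc q"
      and ?ss = "\<lambda>r. case map_of (zip rs ss) r of None \<Rightarrow> 0 | Some s \<Rightarrow> s"
    have "?q \<in> controls acc c"
      using q enc by (auto simp: bij_betw_def intro: inv_into_into)
    then have "fst (delta acc ?q x ?ss) \<in> controls acc c"
      by (rule delta_closed)
    moreover have "?ss r < 3" for r
      using ss by (auto split: option.split dest!: map_of_SomeD set_zip_rightD)
    then have "fst (snd (snd (delta acc ?q x ?ss)) r) < 3" for r
      by (rule delta_symbols)
    ultimately show ?thesis
      by (auto simp: tm_of_def enc_less split: prod.splits)
  qed
  then show ?thesis
    using basic_controls by (auto simp: wf_tm_def enc_less enc_eq tm_of_def)
qed

fun tm_config_of :: "('c, 'r) config \<Rightarrow> tm_config" where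
  "tm_config_of (q, p, g) = (enc q, p, map g rs)"

text \<open>Tests may look at any register, but only those in \<open>rs\<close> have a tape. The
  others remain blank, which agrees with the default 0 that \<open>tm_of\<close> reads for
  them.\<close>

fun valid_config :: "('c, 'r) config \<Rightarrow> bool" where
  "valid_config (q, p, g) \<longleftrightarrow> q \<in> controls acc c \<and> (\<forall>r. r \<notin> set rs \<longrightarrow> g r = (0, \<lambda>_. 0))"

lemma valid_next_config: "valid_config x \<Longrightarrow> valid_config (next_config acc w x)"
proof -
  assume valid: "valid_config x"
  obtain q p g where x: "x = (q, p, g)"
    by (cases x)
  obtain q' d a where da: "delta acc q (input_at w p) (scanned g) = (q', d, a)"
    by (cases "delta acc q (input_at w p) (scanned g)")
  have "q' \<in> controls acc c"
    using delta_closed[of q acc c "input_at w p" "scanned g"] valid x da by simp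
  moreover have "put (a r) (g r) = (0, \<lambda>_. 0)" if "r \<notin> set rs" for r
    using delta_outside[of q acc c r "input_at w p" "scanned g"] that valid x da rs
    by (simp add: scanned_def fun_eq_iff)
  ultimately show ?thesis
    using x da by (simp add: next_config.simps)
qed

lemma tm_step_of:
  assumes "valid_config x"
  shows "tm_step (tm_of acc c rs enc) w (tm_config_of x) = tm_config_of (next_config acc w x)"
proof -
  obtain q p g where x: "x = (q, p, g)"
    by (cases x)
  have q: "q \<in> controls acc c" and g: "\<And>r. r \<notin> set rs \<Longrightarrow> g r = (0, \<lambda>_. 0)"
    using assms x by auto
  show ?thesis
  proof (cases "\<exists>b. q = Halt b")
    case True
    then obtain b where "q = Halt b"
      by blast
    then show ?thesis
      using x by (cases b) (auto simp: tm_of_def next_config.simps)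
  next
    case False
    then have "enc q \<noteq> enc (Halt True)" "enc q \<noteq> enc (Halt False)"
      using q basic_controls by (auto simp: enc_eq)
    moreover have "(\<lambda>(h, T). T h) \<circ> g = scanned g"
      by (auto simp: scanned_def fun_eq_iff split: prod.split)
    moreover have "(case map_of (zip rs (map (scanned g) rs)) r of None \<Rightarrow> 0 | Some s \<Rightarrow> s) = scanned g r" for r
      using g[of r] by (simp add: map_of_zip_map scanned_def)
    moreover have "map2 (\<lambda>(h, T) (s, e). (move_work e h, T(h := s))) (map g rs) (map a rs) =
        map (\<lambda>r. put (a r) (g r)) rs" for a
      by (induction rs) (auto split: prod.split)
    ultimately show ?thesis
      using x by (simp add: tm_of_def next_config.simps inv_enc[OF q] split: prod.split)
  qed
qed

lemma tm_run_of:
  "tm_run (tm_of acc c rs enc) w t =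
    tm_config_of ((next_config acc w ^^ t) (Run [c], 0, tapes (\<lambda>_. 0)))"
proof -
  let ?x = "(Run [c], 0, tapes (\<lambda>_. 0))"
  have "valid_config ((next_config acc w ^^ t) ?x)" for t
    using basic_controls by (induction t) (auto simp: tapes_def tape_Nil intro: valid_next_config)
  moreover have "tm_init (tm_of acc c rs enc) = tm_config_of ?x"
    by (simp add: tm_init_def tm_of_def tapes_def tape_Nil map_replicate_const)
  ultimately show ?thesis
    by (induction t) (simp_all add: tm_run_def tm_step_of)
qed

lemma tm_of_exec:
  assumes "exec w B c (0, \<lambda>_. 0) (p, st)" "\<And>v. v \<le> B \<Longrightarrow> length (digits v) \<le> n"
  shows "\<exists>t. fst (tm_run (tm_of acc c rs enc) w t) = enc (Halt (st acc = 0))"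
    and "work_cells (tm_of acc c rs enc) w \<subseteq> {..<length rs} \<times> {- 1..int n}"
proof -
  let ?x = "(Run [c], 0, tapes (\<lambda>_. 0))" and ?y = "(Halt (st acc = 0), p, tapes st)"
  have "steps acc w n ?x (Run [], p, tapes st)"
    using steps_exec[OF assms, of acc "[]"] by simp
  moreover have "next_config acc w (Run [], p, tapes st) = ?y"
    by (simp add: next_config.simps scanned_tapes[THEN fun_cong])
  then have "steps acc w n (Run [], p, tapes st) ?y"
    using steps_single[of n "(Run [], p, tapes st)" acc w] by (simp add: tapes_def)
  ultimately have "steps acc w n ?x ?y"
    by (rule steps_trans)
  moreover have "next_config acc w ?y = ?y" "heads_within n ?y"
    by (simp_all add: next_config.simps tapes_def)
  ultimately obtain t where t: "(next_config acc w ^^ t) ?x = ?y"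
    and ok: "\<And>t. heads_within n ((next_config acc w ^^ t) ?x)"
    using steps_halt[of acc w n ?x ?y] by blast
  show "\<exists>t. fst (tm_run (tm_of acc c rs enc) w t) = enc (Halt (st acc = 0))"
    by (intro exI[of _ t]) (simp only: tm_run_of t tm_config_of.simps fst_conv)
  have "- 1 \<le> fst (snd (snd (tm_run (tm_of acc c rs enc) w t)) ! i) \<and>
      fst (snd (snd (tm_run (tm_of acc c rs enc) w t)) ! i) \<le> int n" if "i < length rs" for i t
  proof -
    obtain q p g where "(next_config acc w ^^ t) ?x = (q, p, g)"
      by (cases "(next_config acc w ^^ t) ?x")
    then show ?thesis
      using ok[of t] that by (simp add: tm_run_of)
  qed
  then show "work_cells (tm_of acc c rs enc) w \<subseteq> {..<length rs} \<times> {- 1..int n}"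
    by (auto simp: work_cells_def tm_of_def)
qed

end

theorem in_DLOGSPACE_if_exec:
  assumes "finite A" "L \<subseteq> lists A"
    and run: "\<And>w. w \<in> lists A \<Longrightarrow>
      \<exists>p st. exec w (k * length w + k) c (0, \<lambda>_. 0) (p, st) \<and> (st acc = 0 \<longleftrightarrow> w \<in> L)"
  shows "in_DLOGSPACE A L"
proof -
  obtain enc where enc: "bij_betw enc (controls acc c) {..<card (controls acc c)}"
    using ex_bij_betw_finite_nat[OF finite_controls[of acc c]] by (auto simp: atLeast0LessThan)
  obtain rs where rs: "set rs = insert acc (regs c)" "distinct rs"
    using finite_distinct_list[of "insert acc (regs c)"] finite_regs by auto
  define M where "M = tm_of acc c rs enc"
  \<comment> \<open>A value \<open>v\<close> has at most \<open>log 2 (v + 1)\<close> digits. The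
    heads range over these cells and the blanks on both sides, hence the \<open>n l + 2\<close> in
    \<open>s\<close>.\<close>
  define n where "n = (\<lambda>l. nat \<lfloor>log 2 (real (k * l + k + 1))\<rfloor>)"
  define s where "s = (\<lambda>l. length rs * (n l + 2))"
  have n: "length (digits v) \<le> n l" if "v \<le> k * l + k" for v l
  proof -
    have "2 ^ length (digits v) \<le> real (k * l + k + 1)"
    proof -
      have "2 ^ length (digits v) \<le> k * l + k + 1"
        using length_digits[of v] that by linarith
      then show ?thesis
        by (metis of_nat_le_iff of_nat_numeral of_nat_power)
    qed
    then have "real (length (digits v)) \<le> log 2 (real (k * l + k + 1))"
      by (intro le_log_of_power) simp_all
    then show ?thesis
      unfolding n_def by linarith
  qed
  have "tm_decides A M L"
    unfolding tm_decides_def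
  proof
    fix w assume "w \<in> lists A"
    then obtain p st where "exec w (k * length w + k) c (0, \<lambda>_. 0) (p, st)" "st acc = 0 \<longleftrightarrow> w \<in> L"
      using run[of w] by metis
    moreover from tm_of_exec(1)[OF enc rs(1) this(1) n]
    obtain t where "fst (tm_run M w t) = enc (Halt (st acc = 0))"
      unfolding M_def by blast
    moreover have "accept_state M = enc (Halt True)" "reject_state M = enc (Halt False)"
      by (simp_all add: M_def tm_of_def)
    ultimately show "\<exists>t. fst (tm_run M w t) = (if w \<in> L then accept_state M else reject_state M)"
      by (intro exI[of _ t]) simp
  qed
  moreover have "tm_space A M s"
    unfolding tm_space_def
  proof
    fix w assume "w \<in> lists A"
    then obtain p st where "exec w (k * length w + k) c (0, \<lambda>_. 0) (p, st)"
      using run[of w] by metis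
    from tm_of_exec(2)[OF enc rs(1) this n]
    have sub: "work_cells M w \<subseteq> {..<length rs} \<times> {- 1..int (n (length w))}"
      unfolding M_def .
    have "card ({..<length rs} \<times> {- 1..int (n (length w))}) = s (length w)"
      by (simp add: s_def card_cartesian_product nat_add_distrib)
    then show "finite (work_cells M w) \<and> card (work_cells M w) \<le> s (length w)"
      using finite_subset[OF sub] card_mono[OF _ sub] by simp
  qed
  moreover have "wf_tm A M"
    unfolding M_def by (rule wf_tm_of[OF enc rs(1)])
  moreover have "(\<lambda>l. real (s l)) \<in> O(\<lambda>l. log 2 (real l))"
  proof (rule bigoI)
    \<comment> \<open>For \<open>l \<ge> 2\<close> we have
      \<open>k * l + k + 1 \<le> (2 * k + 1) * l\<close> and \<open>1 \<le> log 2 l\<close>. The 3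
      pays for \<open>log 2 l\<close> once and for the two additional cells.\<close>
    let ?C = "real (length rs) * (log 2 (real (2 * k + 1)) + 3)"
    show "eventually (\<lambda>l. norm (real (s l)) \<le> ?C * norm (log 2 (real l))) sequentially"
      using eventually_ge_at_top[of 2]
    proof eventually_elim
      fix l :: nat assume l: "2 \<le> l"
      then have "1 \<le> log 2 (real l)"
        by simp
      have "k \<le> k * l"
        using l by simp
      then have "k * l + k + 1 \<le> k * l + k * l + l"
        using l by linarith
      then have "k * l + k + 1 \<le> (2 * k + 1) * l"
        by (simp add: algebra_simps)
      then have "real (k * l + k + 1) \<le> real (2 * k + 1) * real l"
        by (metis of_nat_le_iff of_nat_mult)
      then have "log 2 (real (k * l + k + 1)) \<le> log 2 (real (2 * k + 1) * real l)"
        by (subst log_le_cancel_iff) (use l in \<open>auto intro: add_pos_nonneg\<close>)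
      also have "\<dots> = log 2 (real (2 * k + 1)) + log 2 (real l)"
        using l by (simp add: log_mult)
      finally have "log 2 (real (k * l + k + 1)) \<le> log 2 (real (2 * k + 1)) + log 2 (real l)" .
      moreover have "real (n l) \<le> log 2 (real (k * l + k + 1))"
      proof -
        have "1 \<le> real (k * l + k + 1)"
          by (simp add: add_nonneg_nonneg)
        then have "0 \<le> log 2 (real (k * l + k + 1))"
          by (simp del: of_nat_add of_nat_mult)
        then show ?thesis
          unfolding n_def by linarith
      qed
      moreover have "0 \<le> log 2 (real (2 * k + 1))"
        by simp
      then have "log 2 (real (2 * k + 1)) * 1 \<le> log 2 (real (2 * k + 1)) * log 2 (real l)"
        using \<open>1 \<le> log 2 (real l)\<close> by (intro mult_left_mono) auto
      ultimately have "real (n l + 2) \<le> (log 2 (real (2 * k + 1)) + 3) * log 2 (real l)"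
        using \<open>1 \<le> log 2 (real l)\<close> by (simp add: algebra_simps)
      then have "real (length rs) * real (n l + 2) \<le>
          real (length rs) * ((log 2 (real (2 * k + 1)) + 3) * log 2 (real l))"
        by (intro mult_left_mono) auto
      then show "norm (real (s l)) \<le> ?C * norm (log 2 (real l))"
        using \<open>1 \<le> log 2 (real l)\<close> by (simp add: s_def mult.assoc algebra_simps)
    qed
  qed
  ultimately show ?thesis
    using assms(1,2) unfolding in_DLOGSPACE_def in_DSPACE_def by blast
qed


section \<open>Total correctness of programs\<close>

text \<open>A total-correctness triple in the form of a weakest precondition: the postcondition of
  the first command of a sequence is the triple of the second, so proofs follow the program
  text.\<close>

definition runs :: "'c list \<Rightarrow> nat \<Rightarrow> ('c, 'r) com \<Rightarrow> nat \<Rightarrow> ('r \<Rightarrow> nat)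
    \<Rightarrow> (nat \<Rightarrow> ('r \<Rightarrow> nat) \<Rightarrow> bool) \<Rightarrow> bool" where
  "runs w B c p st Q \<longleftrightarrow> (\<exists>p' st'. exec w B c (p, st) (p', st') \<and> Q p' st')"

lemma runs_conseq: "runs w B c p st Q \<Longrightarrow> (\<And>p' st'. Q p' st' \<Longrightarrow> Q' p' st') \<Longrightarrow> runs w B c p st Q'"
  unfolding runs_def by blast

lemma runs_Skip: "Q p st \<Longrightarrow> runs w B Skip p st Q"
  unfolding runs_def by (blast intro: exec_Skip)

lemma runs_Inc: "st r < B \<Longrightarrow> Q p (st(r := Suc (st r))) \<Longrightarrow> runs w B (Inc r) p st Q"
  unfolding runs_def by (blast intro: exec_Inc)

lemma runs_Dec: "0 < st r \<Longrightarrow> Q p (st(r := st r - 1)) \<Longrightarrow> runs w B (Dec r) p st Q"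
  unfolding runs_def by (blast intro: exec_Dec)

lemma runs_Move: "Q (move_input (length w) d p) st \<Longrightarrow> runs w B (Move d) p st Q"
  unfolding runs_def by (blast intro: exec_Move)

lemma runs_Seq: "runs w B c p st (\<lambda>p' st'. runs w B c' p' st' Q) \<Longrightarrow> runs w B (c ;; c') p st Q"
  unfolding runs_def by (blast intro: exec_Seq)

lemma runs_If:
  assumes "t (input_at w p) (\<lambda>r. st r = 0) \<Longrightarrow> runs w B c p st Q"
    and "\<not> t (input_at w p) (\<lambda>r. st r = 0) \<Longrightarrow> runs w B c' p st Q"
  shows "runs w B (If t c c') p st Q"
proof -
  have "runs w B (if t (input_at w p) (\<lambda>r. st r = 0) then c else c') p st Q"
    using assms by simp
  then obtain p' st' where *: "exec w B (if t (input_at w p) (\<lambda>r. st r = 0) then c else c') (p, st) (p', st')"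
    "Q p' st'"
    unfolding runs_def by blast
  have "exec w B (If t c c') (p, st) (p', st')"
    by (rule exec_If) (use * in simp)
  with * show ?thesis
    unfolding runs_def by blast
qed

lemma runs_While:
  fixes \<mu> :: "nat \<Rightarrow> ('r \<Rightarrow> nat) \<Rightarrow> nat"
  assumes "J p st"
    and "\<And>p st. J p st \<Longrightarrow> t (input_at w p) (\<lambda>r. st r = 0) \<Longrightarrow>
      runs w B c p st (\<lambda>p' st'. J p' st' \<and> \<mu> p' st' < \<mu> p st)"
    and "\<And>p st. J p st \<Longrightarrow> \<not> t (input_at w p) (\<lambda>r. st r = 0) \<Longrightarrow> Q p st"
  shows "runs w B (While t c) p st Q"
  using assms(1)
proof (induction "\<mu> p st" arbitrary: p st rule: less_induct)
  case less
  show ?case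
  proof (cases "t (input_at w p) (\<lambda>r. st r = 0)")
    case True
    then obtain p' st' where "exec w B c (p, st) (p', st')" "J p' st'" "\<mu> p' st' < \<mu> p st"
      using assms(2)[OF less.prems] unfolding runs_def by blast
    moreover from this obtain p'' st'' where "exec w B (While t c) (p', st') (p'', st'')" "Q p'' st''"
      using less.hyps unfolding runs_def by blast
    ultimately show ?thesis
      using True exec_While_True[of t w "(p, st)" B c] unfolding runs_def by (metis fst_conv snd_conv)
  next
    case False
    then show ?thesis
      using assms(3)[OF less.prems] exec_While_False[of t w "(p, st)"] unfolding runs_def by auto
  qed
qed

abbreviation nonzero :: "'r \<Rightarrow> 'c input_symbol \<Rightarrow> ('r \<Rightarrow> bool) \<Rightarrow> bool" where
  "nonzero r \<equiv> \<lambda>x z. \<not> z r"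

definition loop :: "'r \<Rightarrow> ('c, 'r) com \<Rightarrow> ('c, 'r) com" where
  "loop r c = While (nonzero r) (Dec r ;; c)"

text \<open>The index of \<open>J\<close> counts the iterations still to come, that is, the
  remaining value of \<open>r\<close>.\<close>

lemma runs_loop:
  assumes "J (st r) p st"
    and "\<And>k p st. J (Suc k) p st \<Longrightarrow> st r = Suc k \<Longrightarrow>
      runs w B c p (st(r := k)) (\<lambda>p' st'. J k p' st' \<and> st' r = k)"
    and "\<And>p st. J 0 p st \<Longrightarrow> st r = 0 \<Longrightarrow> Q p st"
  shows "runs w B (loop r c) p st Q"
  unfolding loop_def
proof (rule runs_While[where J = "\<lambda>p st. J (st r) p st" and \<mu> = "\<lambda>p st. st r"])
  fix p st assume J: "J (st r) p st" and "\<not> st r = 0"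
  then obtain k where k: "st r = Suc k"
    by (cases "st r") auto
  then have "runs w B c p (st(r := k)) (\<lambda>p' st'. J (st' r) p' st' \<and> st' r < st r)"
    using assms(2)[of k p st] J by (auto elim: runs_conseq)
  then show "runs w B (Dec r ;; c) p st (\<lambda>p' st'. J (st' r) p' st' \<and> st' r < st r)"
    using k by (intro runs_Seq runs_Dec) simp_all
qed (use assms(1,3) in auto)

definition clear :: "'r \<Rightarrow> ('c, 'r) com" where
  "clear r = loop r Skip"

lemma runs_clear:
  assumes "Q p (st(r := 0))"
  shows "runs w B (clear r) p st Q"
  unfolding clear_def
proof (rule runs_loop[where J = "\<lambda>k p' st'. p' = p \<and> st' = st(r := k)"])
  fix k p' st' assume "p' = p \<and> st' = st(r := Suc k)"
  then show "runs w B Skip p' (st'(r := k)) (\<lambda>p' st'. (p' = p \<and> st' = st(r := k)) \<and> st' r = k)"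
    by (intro runs_Skip) simp
qed (use assms in simp_all)

definition shift_reg :: "'r \<Rightarrow> 'r \<Rightarrow> ('c, 'r) com" where
  "shift_reg r s = loop r (Inc s)"

lemma runs_shift_reg:
  assumes "r \<noteq> s" "st r + st s \<le> B" "Q p (st(r := 0, s := st s + st r))"
  shows "runs w B (shift_reg r s) p st Q"
  unfolding shift_reg_def
proof (rule runs_loop[where
      J = "\<lambda>k p' st'. p' = p \<and> k \<le> st r \<and> st' = st(r := k, s := st s + (st r - k))"])
  fix k p' st' assume "p' = p \<and> Suc k \<le> st r \<and> st' = st(r := Suc k, s := st s + (st r - Suc k))"
  then show "runs w B (Inc s) p' (st'(r := k))
      (\<lambda>p' st'. (p' = p \<and> k \<le> st r \<and> st' = st(r := k, s := st s + (st r - k))) \<and> st' r = k)"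
    using assms by (intro runs_Inc) (auto simp: fun_eq_iff)
qed (use assms in \<open>simp_all add: fun_upd_twist\<close>)

text \<open>A register can be read only by emptying it. So \<open>r\<close> is drained into
  \<open>s\<close> and \<open>t\<close> at once and then restored from \<open>t\<close>.\<close>

definition copy_reg :: "'r \<Rightarrow> 'r \<Rightarrow> 'r \<Rightarrow> ('c, 'r) com" where
  "copy_reg t r s = clear s ;; loop r (Inc s ;; Inc t) ;; shift_reg t r"

lemma runs_copy_reg:
  assumes "distinct [t, r, s]" "st t = 0" "st r \<le> B" "Q p (st(s := st r))"
  shows "runs w B (copy_reg t r s) p st Q"
  unfolding copy_reg_def
proof (intro runs_Seq runs_clear)
  show "runs w B (loop r (Inc s ;; Inc t)) p (st(s := 0)) (\<lambda>p' st'. runs w B (shift_reg t r) p' st' Q)"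
  proof (rule runs_loop[where
        J = "\<lambda>k p' st'. p' = p \<and> k \<le> st r \<and> st' = st(r := k, s := st r - k, t := st r - k)"])
    fix k p' st' assume "p' = p \<and> Suc k \<le> st r \<and>
      st' = st(r := Suc k, s := st r - Suc k, t := st r - Suc k)"
    then show "runs w B (Inc s ;; Inc t) p' (st'(r := k))
        (\<lambda>p' st'. (p' = p \<and> k \<le> st r \<and> st' = st(r := k, s := st r - k, t := st r - k)) \<and> st' r = k)"
      using assms by (intro runs_Seq runs_Inc) (auto simp: fun_eq_iff)
  next
    fix p' st' assume "p' = p \<and> 0 \<le> st r \<and> st' = st(r := 0, s := st r - 0, t := st r - 0)"
    moreover have "st(r := 0, s := st r, t := st r, t := 0, r := 0 + st r) = st(s := st r)"
      using assms by (auto simp: fun_eq_iff)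
    ultimately show "runs w B (shift_reg t r) p' st' Q"
      using assms by (intro runs_shift_reg) auto
  qed (use assms in \<open>auto simp: fun_eq_iff\<close>)
qed

definition raise_reg :: "'r \<Rightarrow> ('c, 'r) com" where
  "raise_reg r = clear r ;; Inc r"

lemma runs_raise_reg: "0 < B \<Longrightarrow> Q p (st(r := 1)) \<Longrightarrow> runs w B (raise_reg r) p st Q"
  unfolding raise_reg_def by (intro runs_Seq runs_clear runs_Inc) simp_all

text \<open>A residue modulo \<open>m\<close> is stored as a pair of registers with sum \<open>m\<close>, where \<open>0\<close> and \<open>m\<close> both
  represent zero. Exchanging the two registers negates the residue.\<close>

definition inc_mod :: "'r \<Rightarrow> 'r \<Rightarrow> ('c, 'r) com" where
  "inc_mod x y = If (nonzero y) Skip (shift_reg x y) ;; Dec y ;; Inc x"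

lemma runs_inc_mod:
  assumes "x \<noteq> y" "st x + st y = m" "0 < m" "m \<le> B"
    and "\<And>v v'. v + v' = m \<Longrightarrow> [int v = int (st x) + 1] (mod int m) \<Longrightarrow> Q p (st(x := v, y := v'))"
  shows "runs w B (inc_mod x y) p st Q"
  unfolding inc_mod_def
proof (intro runs_Seq runs_If runs_Skip runs_Dec runs_Inc)
  assume y: "\<not> st y = 0"
  show "0 < st y"
    using y by simp
  show "(st(y := st y - 1)) x < B"
    using assms y by simp
  have "st(y := st y - 1, x := Suc ((st(y := st y - 1)) x)) = st(x := Suc (st x), y := st y - 1)"
    using assms(1) by (auto simp: fun_eq_iff)
  then show "Q p (st(y := st y - 1, x := Suc ((st(y := st y - 1)) x)))"
    using assms(2) assms(5)[of "Suc (st x)" "st y - 1"] y by (simp add: add.commute)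
next
  assume y: "\<not> \<not> st y = 0"
  \<comment> \<open>Here \<open>x = m\<close> represents zero; it is replaced by the other
    representation \<open>x = 0\<close>, \<open>y = m\<close>, after which \<open>y\<close> can be
    decremented.\<close>
  let ?st = "st(x := 0, y := st y + st x)"
  have "?st(y := ?st y - 1, x := Suc ((?st(y := ?st y - 1)) x)) = st(x := 1, y := m - 1)"
    using assms y by (auto simp: fun_eq_iff)
  moreover have "[int 1 = int (st x) + 1] (mod int m)"
    using assms(2) y by (simp add: cong_iff_dvd_diff)
  ultimately show "runs w B (shift_reg x y) p st (\<lambda>p' st'. runs w B (Dec y ;; Inc x) p' st' Q)"
    using assms y by (intro runs_shift_reg runs_Seq runs_Dec runs_Inc) auto
qed

definition seqs :: "('c, 'r) com list \<Rightarrow> ('c, 'r) com" where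
  "seqs cs = foldr (;;) cs Skip"

lemma seqs_simps [simp]: "seqs [] = Skip" "seqs (c # cs) = c ;; seqs cs"
  by (simp_all add: seqs_def)

definition differ_on :: "'r set \<Rightarrow> ('r \<Rightarrow> nat) \<Rightarrow> ('r \<Rightarrow> nat) \<Rightarrow> bool" where
  "differ_on X st st' \<longleftrightarrow> (\<forall>r. r \<notin> X \<longrightarrow> st' r = st r)"

lemma differ_on_refl [simp]: "differ_on X st st"
  by (simp add: differ_on_def)

lemma differ_onD: "differ_on X st st' \<Longrightarrow> r \<notin> X \<Longrightarrow> st' r = st r"
  by (simp add: differ_on_def)

lemma differ_on_upd: "differ_on X st st' \<Longrightarrow> r \<in> X \<Longrightarrow> differ_on X st (st'(r := v))"
  by (auto simp: differ_on_def)

lemma differ_on_trans: "differ_on X st st' \<Longrightarrow> differ_on X st' st'' \<Longrightarrow> differ_on X st st''"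
  by (simp add: differ_on_def)

lemma differ_on_mono: "differ_on X st st' \<Longrightarrow> X \<subseteq> Y \<Longrightarrow> differ_on Y st st'"
  by (auto simp: differ_on_def)

lemma runs_seqs_map:
  assumes "J {} p st" "distinct xs"
    and "\<And>A x p st. J A p st \<Longrightarrow> x \<in> set xs \<Longrightarrow> x \<notin> A \<Longrightarrow> A \<subseteq> set xs \<Longrightarrow> runs w B (c x) p st (J (insert x A))"
    and "\<And>p st. J (set xs) p st \<Longrightarrow> Q p st"
  shows "runs w B (seqs (map c xs)) p st Q"
proof -
  have "runs w B (seqs (map c ys)) p st Q" if "J (set zs) p st" "xs = zs @ ys" for zs ys p st
    using that
  proof (induction ys arbitrary: zs p st)
    case Nil
    then show ?case
      using assms(4) by (auto intro: runs_Skip)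
  next
    case (Cons y ys)
    have "runs w B (c y) p st (J (insert y (set zs)))"
      using Cons.prems assms(2) by (intro assms(3)) auto
    then have "runs w B (c y) p st (\<lambda>p' st'. runs w B (seqs (map c ys)) p' st' Q)"
      by (rule runs_conseq) (use Cons.IH[of "zs @ [y]"] Cons.prems in auto)
    then show ?case
      by (auto intro: runs_Seq)
  qed
  from this[of "[]"] show ?thesis
    using assms(1) by simp
qed

lemma runs_seqs_replicate:
  assumes "J 0 p st"
    and "\<And>k p st. J k p st \<Longrightarrow> k < n \<Longrightarrow> runs w B c p st (J (Suc k))"
    and "\<And>p st. J n p st \<Longrightarrow> Q p st"
  shows "runs w B (seqs (replicate n c)) p st Q"
proof -
  have "runs w B (seqs (replicate i c)) p st Q" if "J (n - i) p st" "i \<le> n" for i p st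
    using that
  proof (induction i arbitrary: p st)
    case 0
    then show ?case
      using assms(3) by (auto intro: runs_Skip)
  next
    case (Suc i)
    have "runs w B c p st (J (Suc (n - Suc i)))"
      using Suc.prems by (intro assms(2)) auto
    then have "runs w B c p st (\<lambda>p' st'. runs w B (seqs (replicate i c)) p' st' Q)"
      by (rule runs_conseq) (use Suc in \<open>auto simp: Suc_diff_Suc\<close>)
    then show ?case
      by (auto intro: runs_Seq)
  qed
  from this[of n] show ?thesis
    using assms(1) by simp
qed

text \<open>Input positions are stored in registers because every scan moves the only input head.
  Counting from the left end marker makes position \<open>p\<close> the same as \<open>p\<close>
  moves to the right.\<close>

definition goto :: "'r \<Rightarrow> 'r \<Rightarrow> ('c, 'r) com" where
  "goto t r = While (\<lambda>x z. x \<noteq> Left_End) (Move Go_Left) ;; loop r (Inc t ;; Move Go_Right) ;; shift_reg t r"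

lemma input_at_eq_Left_End [simp]: "input_at w p = Left_End \<longleftrightarrow> p = 0"
  by (simp add: input_at_def)

lemma runs_goto:
  assumes "t \<noteq> r" "st t = 0" "st r \<le> B" "st r \<le> Suc (length w)" "Q (st r) st"
  shows "runs w B (goto t r) p st Q"
  unfolding goto_def
proof (intro runs_Seq)
  have loop: "runs w B (loop r (Inc t ;; Move Go_Right)) 0 st (\<lambda>p' st'. runs w B (shift_reg t r) p' st' Q)"
  proof (rule runs_loop[where
        J = "\<lambda>k p' st'. k \<le> st r \<and> p' = st r - k \<and> st' = st(r := k, t := st r - k)"])
    fix k p' st' assume "Suc k \<le> st r \<and> p' = st r - Suc k \<and> st' = st(r := Suc k, t := st r - Suc k)"
    then show "runs w B (Inc t ;; Move Go_Right) p' (st'(r := k)) (\<lambda>p' st'. (k \<le> st r \<and>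
        p' = st r - k \<and> st' = st(r := k, t := st r - k)) \<and> st' r = k)"
      using assms by (intro runs_Seq runs_Inc runs_Move) (auto simp: fun_eq_iff)
  next
    fix p' st' assume J: "0 \<le> st r \<and> p' = st r - 0 \<and> st' = st(r := 0, t := st r - 0)"
    then have "st'(t := 0, r := st' r + st' t) = st"
      using assms by (auto simp: fun_eq_iff)
    then show "runs w B (shift_reg t r) p' st' Q"
      using assms J by (intro runs_shift_reg) auto
  qed (use assms in \<open>auto simp: fun_eq_iff\<close>)
  show "runs w B (While (\<lambda>x z. x \<noteq> Left_End) (Move Go_Left)) p st
      (\<lambda>p' st'. runs w B (loop r (Inc t ;; Move Go_Right) ;; shift_reg t r) p' st' Q)"
    by (rule runs_While[where J = "\<lambda>p' st'. st' = st" and \<mu> = "\<lambda>p' st'. p'"])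
      (use loop in \<open>auto intro: runs_Move runs_Seq\<close>)
qed


section \<open>A program for the word problem\<close>

text \<open>\<open>Pos1\<close> and \<open>Pos2\<close> are the two positions compared and
  \<open>Md\<close> is the current modulus. The Boolean index selects the bank of residues for the
  label at \<open>Pos1\<close> (\<open>False\<close>) or \<open>Pos2\<close> (\<open>True\<close>);
  \<open>Side\<close> tells from which of the two words that label comes. \<open>Diff\<close>,
  \<open>Found\<close> and \<open>Fail\<close> are flags: mismatch for this pair of positions,
  partner found for \<open>Pos1\<close>, input rejected.\<close>

datatype 'a reg =
    Tmp
  | Seps
  | Len
  | Bnd
  | Pos1
  | Pos2
  | Md
  | Diff
  | Found
  | Fail
  | Side bool
  | Val bool "'a \<times> bool"
  | Cpl bool "'a \<times> bool"

type_synonym 'a program = "(('a + 'a) option, 'a reg) com"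

definition bank :: "bool \<Rightarrow> ('a \<times> bool) set \<Rightarrow> 'a reg set" where
  "bank b A = Val b ` A \<union> Cpl b ` A"

lemma mem_bank [simp]:
  "Val b s \<in> bank b' A \<longleftrightarrow> b = b' \<and> s \<in> A" "Cpl b s \<in> bank b' A \<longleftrightarrow> b = b' \<and> s \<in> A"
  "Tmp \<notin> bank b' A" "Seps \<notin> bank b' A" "Len \<notin> bank b' A" "Bnd \<notin> bank b' A"
  "Pos1 \<notin> bank b' A" "Pos2 \<notin> bank b' A" "Md \<notin> bank b' A" "Diff \<notin> bank b' A"
  "Found \<notin> bank b' A" "Fail \<notin> bank b' A" "Side b \<notin> bank b' A"
  by (auto simp: bank_def)

lemma bank_mono: "A \<subseteq> C \<Longrightarrow> bank b A \<subseteq> bank b C"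
  by (auto simp: bank_def)

definition residues :: "bool \<Rightarrow> nat \<Rightarrow> ('a \<times> bool) set \<Rightarrow> ('a \<times> bool \<Rightarrow> int) \<Rightarrow> ('a reg \<Rightarrow> nat) \<Rightarrow> bool" where
  "residues b m A f st \<longleftrightarrow>
    (\<forall>s \<in> A. st (Val b s) + st (Cpl b s) = m \<and> [int (st (Val b s)) = f s] (mod int m))"

lemma residuesD:
  "residues b m A f st \<Longrightarrow> s \<in> A \<Longrightarrow> st (Val b s) + st (Cpl b s) = m"
  "residues b m A f st \<Longrightarrow> s \<in> A \<Longrightarrow> [int (st (Val b s)) = f s] (mod int m)"
  by (auto simp: residues_def)

lemma residues_cong:
  assumes "\<And>s. s \<in> A \<Longrightarrow> [f s = g s] (mod int m)"
    and "\<And>s. s \<in> A \<Longrightarrow> st' (Val b s) = st (Val b s) \<and> st' (Cpl b s) = st (Cpl b s)"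
    and "residues b m A f st"
  shows "residues b m A g st'"
  using assms unfolding residues_def by (metis cong_trans)

lemma residues_differ:
  assumes "differ_on X st st'" "bank b A \<inter> X = {}" "residues b m A f st"
  shows "residues b m A f st'"
proof (rule residues_cong[OF _ _ assms(3)])
  fix s assume "s \<in> A"
  then have "Val b s \<notin> X" "Cpl b s \<notin> X"
    using assms(2) mem_bank(1,2)[of b s b A] by blast+
  then show "st' (Val b s) = st (Val b s) \<and> st' (Cpl b s) = st (Cpl b s)"
    using differ_onD[OF assms(1)] by blast
qed simp

lemma residues_subset: "residues b m A f st \<Longrightarrow> A' \<subseteq> A \<Longrightarrow> residues b m A' f st"
  by (auto simp: residues_def)

abbreviation inc_site :: "bool \<Rightarrow> 'a \<times> bool \<Rightarrow> 'a program" where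
  "inc_site b s \<equiv> inc_mod (Val b s) (Cpl b s)"

lemma runs_inc_site:
  assumes "residues b m A f st" "s \<in> A" "0 < m" "m \<le> B"
    and "\<And>st'. residues b m A (f(s := f s + 1)) st' \<Longrightarrow> differ_on (bank b {s}) st st' \<Longrightarrow> Q p st'"
  shows "runs w B (inc_site b s) p st Q"
proof (rule runs_inc_mod[of _ _ st m])
  fix v v' assume v: "v + v' = m" "[int v = int (st (Val b s)) + 1] (mod int m)"
  let ?st = "st(Val b s := v, Cpl b s := v')"
  have "[int v = f s + 1] (mod int m)"
    using v(2) cong_add[OF residuesD(2)[OF assms(1,2)] cong_refl[of 1]] by (blast intro: cong_trans)
  then have "residues b m A (f(s := f s + 1)) ?st"
    using assms(1) v(1) by (auto simp: residues_def)
  moreover have "differ_on (bank b {s}) st ?st"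
    by (intro differ_on_upd) auto
  ultimately show "Q p ?st"
    by (rule assms(5))
qed (use assms residuesD(1)[OF assms(1,2)] in auto)

definition dispatch :: "('a + 'a) list \<Rightarrow> ('a + 'a \<Rightarrow> 'a program) \<Rightarrow> 'a program" where
  "dispatch cs k = foldr (\<lambda>c K. If (\<lambda>x z. x = Input (Some c)) (k c) K) cs Skip"

lemma runs_dispatch:
  assumes "\<And>c. c \<in> set cs \<Longrightarrow> input_at w p = Input (Some c) \<Longrightarrow> runs w B (k c) p st Q"
    and "\<exists>c \<in> set cs. input_at w p = Input (Some c)"
  shows "runs w B (dispatch cs k) p st Q"
  using assms
proof (induction cs)
  case (Cons c cs)
  then show ?case
    by (auto simp: dispatch_def intro!: runs_If)
qed simp

lemma input_at_Some:
  assumes "w \<in> lists (pair_alphabet A)" "input_at w p = Input (Some c)"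
  shows "c \<in> A" "0 < p" "p \<le> length w"
proof -
  show "0 < p" "p \<le> length w"
    using assms(2) by (auto simp: input_at_def split: if_splits)
  then have "Some c \<in> set w"
    using assms(2) nth_mem[of "p - 1" w] by (auto simp: input_at_def split: if_splits)
  then show "c \<in> A"
    using assms(1) by (auto simp: pair_alphabet_def)
qed

locale label_program = numbers_game +
  fixes sites :: "('a \<times> bool) list" and letters :: "('a + 'a) list"
  assumes set_sites: "set sites = \<Sigma> \<times> UNIV" and distinct_sites: "distinct sites"
    and set_letters: "set letters = Gam \<Sigma>"
begin

definition spread :: "bool \<Rightarrow> 'a \<times> bool \<Rightarrow> 'a program" where
  "spread b s = seqs (map (\<lambda>t. inc_site b t ;; inc_site b t) (filter (nbr s) sites))"

text \<open>The set \<open>A\<close> holds the sites whose registers currently represent residues.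
  In \<open>fire_com\<close> this excludes \<open>s\<close>, which is being drained.\<close>

lemma runs_spread:
  assumes "residues b m A f st" "A \<subseteq> set sites" "\<And>t. nbr s t \<Longrightarrow> t \<in> A" "0 < m" "m \<le> B"
    and "\<And>st'. residues b m A (\<lambda>t. if nbr s t then f t + 2 else f t) st' \<Longrightarrow>
      differ_on (bank b {t. nbr s t}) st st' \<Longrightarrow> Q p st'"
  shows "runs w B (spread b s) p st Q"
proof -
  define J where "J = (\<lambda>X p' st'. p' = p \<and>
    residues b m A (\<lambda>t. if t \<in> X then f t + 2 else f t) st' \<and> differ_on (bank b {t. nbr s t}) st st')"
  show ?thesis
    unfolding spread_def
  proof (rule runs_seqs_map[where J = J])
    fix X t p' st1
    assume "J X p' st1" and t: "t \<in> set (filter (nbr s) sites)" "t \<notin> X"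
    note J = this(1)[unfolded J_def]
    have tA: "t \<in> A"
      using t assms(3) by simp
    show "runs w B (inc_site b t ;; inc_site b t) p' st1 (J (insert t X))"
    proof (intro runs_Seq, rule runs_inc_site[OF conjunct1[OF conjunct2[OF J]] tA assms(4,5)],
        rule runs_inc_site[OF _ tA assms(4,5)], assumption)
      fix st2 st3
      assume r: "residues b m A
          (((\<lambda>t. if t \<in> X then f t + 2 else f t)(t := (if t \<in> X then f t + 2 else f t) + 1))
            (t := ((\<lambda>t. if t \<in> X then f t + 2 else f t)(t := (if t \<in> X then f t + 2 else f t) + 1)) t + 1)) st3"
        and d: "differ_on (bank b {t}) st1 st2" "differ_on (bank b {t}) st2 st3"
      have "bank b {t} \<subseteq> bank b {t. nbr s t}"
        using t by (intro bank_mono) auto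
      then have "differ_on (bank b {t. nbr s t}) st st3"
        using J d by (blast intro: differ_on_trans differ_on_mono)
      moreover have "residues b m A (\<lambda>u. if u \<in> insert t X then f u + 2 else f u) st3"
        by (rule residues_cong[OF _ _ r]) (use t(2) in \<open>auto simp: algebra_simps\<close>)
      ultimately show "J (insert t X) p' st3"
        using J unfolding J_def by blast
    qed
  next
    fix p' st' assume "J (set (filter (nbr s) sites)) p' st'"
    note J = this[unfolded J_def]
    have "t \<in> set (filter (nbr s) sites) \<longleftrightarrow> nbr s t" for t
      using assms(2) assms(3)[of t] by auto
    then show "Q p' st'"
      using J assms(6) by simp
  qed (use assms distinct_sites in \<open>auto simp: J_def\<close>)
qed

text \<open>Draining \<open>Val b s\<close> into \<open>Tmp\<close> adds 2 to all neighbours for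
  each unit. Moving the complement to \<open>Val b s\<close> and the drained value to
  \<open>Cpl b s\<close> then exchanges the pair, which negates the residue.\<close>

definition fire_com :: "bool \<Rightarrow> 'a \<times> bool \<Rightarrow> 'a program" where
  "fire_com b s = loop (Val b s) (Inc Tmp ;; spread b s) ;;
    shift_reg (Cpl b s) (Val b s) ;; shift_reg Tmp (Cpl b s)"

lemma runs_fire_com:
  assumes res: "residues b m (set sites) f st" and s: "s \<in> set sites" and "st Tmp = 0" "0 < m" "m \<le> B"
    and post: "\<And>st'. residues b m (set sites) (fire s f) st' \<Longrightarrow>
      differ_on (bank b (set sites)) st st' \<Longrightarrow> Q p st'"
  shows "runs w B (fire_com b s) p st Q"
  unfolding fire_com_def
proof (intro runs_Seq)
  define x where "x = st (Val b s)"
  define A where "A = set sites - {s}"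
  have x: "x + st (Cpl b s) = m" "[int x = f s] (mod int m)"
    using residuesD[OF res s] by (simp_all add: x_def)
  have nbr_A: "t \<in> A" if "nbr s t" for t
    using that set_sites by (auto simp: nbr_def A_def mem_Times_iff)
  define J where "J = (\<lambda>k p' st'. p' = p \<and> k \<le> x \<and> st' Tmp = x - k \<and> st' (Cpl b s) = st (Cpl b s) \<and>
    residues b m A (\<lambda>t. if nbr s t then f t + 2 * int (x - k) else f t) st' \<and>
    differ_on (insert Tmp (bank b (set sites))) st st')"
  show "runs w B (loop (Val b s) (Inc Tmp ;; spread b s)) p st
      (\<lambda>p' st'. runs w B (shift_reg (Cpl b s) (Val b s) ;; shift_reg Tmp (Cpl b s)) p' st' Q)"
  proof (rule runs_loop[where J = J])
    have "residues b m A (\<lambda>t. if nbr s t then f t + 2 * int (x - st (Val b s)) else f t) st"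
      using residues_subset[OF res, of A] by (auto simp: A_def x_def cong: if_cong)
    then show "J (st (Val b s)) p st"
      using assms(3) by (simp add: J_def x_def)
  next
    fix k p' st1
    assume "J (Suc k) p' st1" and k: "st1 (Val b s) = Suc k"
    note J = this(1)[unfolded J_def]
    let ?st2 = "st1(Val b s := k, Tmp := Suc (x - Suc k))"
    have r2: "residues b m A (\<lambda>t. if nbr s t then f t + 2 * int (x - Suc k) else f t) ?st2"
      by (rule residues_cong[OF _ _ conjunct1[OF conjunct2[OF conjunct2[OF conjunct2[OF conjunct2[OF J]]]]]])
        (auto simp: A_def)
    show "runs w B (Inc Tmp ;; spread b s) p' (st1(Val b s := k)) (\<lambda>p' st'. J k p' st' \<and> st' (Val b s) = k)"
    proof (intro runs_Seq runs_Inc)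
      show "(st1(Val b s := k)) Tmp < B"
        using J x assms(5) by auto
      have eq: "(st1(Val b s := k))(Tmp := Suc ((st1(Val b s := k)) Tmp)) = ?st2"
        using J by auto
      show "runs w B (spread b s) p' ((st1(Val b s := k))(Tmp := Suc ((st1(Val b s := k)) Tmp)))
        (\<lambda>p' st'. J k p' st' \<and> st' (Val b s) = k)"
        unfolding eq
      proof (rule runs_spread[OF r2 _ nbr_A assms(4,5)])
        fix st3
        assume r3: "residues b m A (\<lambda>t. if nbr s t then
              (if nbr s t then f t + 2 * int (x - Suc k) else f t) + 2
            else if nbr s t then f t + 2 * int (x - Suc k) else f t) st3"
          and d3: "differ_on (bank b {t. nbr s t}) ?st2 st3"
        have "st3 Tmp = x - k" "st3 (Cpl b s) = st (Cpl b s)" "st3 (Val b s) = k"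
          using differ_onD[OF d3, of Tmp] differ_onD[OF d3, of "Cpl b s"]
            differ_onD[OF d3, of "Val b s"] J by auto
        moreover have "residues b m A (\<lambda>t. if nbr s t then f t + 2 * int (x - k) else f t) st3"
          by (rule residues_cong[OF _ _ r3]) (use J in \<open>auto simp: of_nat_diff\<close>)
        moreover have "differ_on (insert Tmp (bank b (set sites))) st st3"
        proof -
          have "bank b {t. nbr s t} \<subseteq> bank b (set sites)"
            using nbr_A by (intro bank_mono) (auto simp: A_def)
          then have "differ_on (insert Tmp (bank b (set sites))) ?st2 st3"
            using differ_on_mono[OF d3] by blast
          moreover have "differ_on (insert Tmp (bank b (set sites))) st ?st2"
            using J s by (intro differ_on_upd) auto
          ultimately show ?thesis
            by (meson differ_on_trans)
        qed
        ultimately show "J k p' st3 \<and> st3 (Val b s) = k"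
          using J by (simp add: J_def)
      qed (auto simp: A_def)
    qed
  next
    fix p' st1
    assume "J 0 p' st1" and 0: "st1 (Val b s) = 0"
    note J = this(1)[unfolded J_def]
    let ?st2 = "st1(Cpl b s := 0, Val b s := st (Cpl b s), Tmp := 0, Cpl b s := x)"
    have r1: "residues b m A (\<lambda>t. if nbr s t then f t + 2 * int x else f t) st1"
      using J by (simp cong: if_cong)
    have "residues b m A (fire s f) ?st2"
    proof (rule residues_cong[OF _ _ r1])
      fix t assume "t \<in> A"
      then show "[(if nbr s t then f t + 2 * int x else f t) = fire s f t] (mod int m)"
        using cong_add[OF cong_refl cong_mult[OF cong_refl x(2)], of "f t" 2]
        by (auto simp: fire_def A_def)
      show "?st2 (Val b t) = st1 (Val b t) \<and> ?st2 (Cpl b t) = st1 (Cpl b t)"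
        using \<open>t \<in> A\<close> by (auto simp: A_def)
    qed
    moreover have "[int (st (Cpl b s)) = - f s] (mod int m)"
    proof -
      have "int (st (Cpl b s)) = - int x + int m"
        using x(1) by simp
      moreover have "[- int x + int m = - f s + 0] (mod int m)"
        using x(2) by (intro cong_add) (simp_all add: cong_minus_minus_iff cong_0_iff)
      ultimately show ?thesis
        by simp
    qed
    ultimately have "residues b m (set sites) (fire s f) ?st2"
      using x(1) by (auto simp: residues_def A_def fire_def)
    moreover have "differ_on (bank b (set sites)) st ?st2"
      unfolding differ_on_def
    proof (intro allI impI)
      fix r :: "'a reg" assume "r \<notin> bank b (set sites)"
      then show "?st2 r = st r"
        using J s assms(3) differ_onD[of "insert Tmp (bank b (set sites))" st st1 r] by (cases "r = Tmp") auto
    qed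
    ultimately have "Q p ?st2"
      by (rule post)
    moreover have "st1(Cpl b s := 0, Val b s := st1 (Val b s) + st1 (Cpl b s)) =
        st1(Cpl b s := 0, Val b s := st (Cpl b s))"
      using J 0 by auto
    ultimately show "runs w B (shift_reg (Cpl b s) (Val b s) ;; shift_reg Tmp (Cpl b s)) p' st1 Q"
      using J 0 x(1) assms(5) by (intro runs_Seq runs_shift_reg) auto
  qed
qed

definition act_com :: "bool \<Rightarrow> 'a + 'a \<Rightarrow> 'a program" where
  "act_com b c = fire_com b (site c) ;; fire_com b (site (bar_letter c))"

lemma runs_act_com:
  assumes "residues b m (set sites) f st" "c \<in> Gam \<Sigma>" "st Tmp = 0" "0 < m" "m \<le> B"
    and "\<And>st'. residues b m (set sites) (act c f) st' \<Longrightarrow>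
      differ_on (bank b (set sites)) st st' \<Longrightarrow> Q p st'"
  shows "runs w B (act_com b c) p st Q"
proof -
  have in_sites: "site c \<in> set sites" "site (bar_letter c) \<in> set sites"
    using assms(2) set_sites by (simp_all add: mem_Gam_iff mem_Times_iff)
  show ?thesis
    unfolding act_com_def
  proof (rule runs_Seq, rule runs_fire_com[OF assms(1) in_sites(1) assms(3-5)])
    fix st1 assume 1: "residues b m (set sites) (fire (site c) f) st1" "differ_on (bank b (set sites)) st st1"
    then have "st1 Tmp = 0"
      using assms(3) differ_onD[of "bank b (set sites)" st st1 Tmp] by simp
    then show "runs w B (fire_com b (site (bar_letter c))) p st1 Q"
    proof (rule runs_fire_com[OF 1(1) in_sites(2) _ assms(4,5)])
      fix st2 assume "residues b m (set sites) (fire (site (bar_letter c)) (fire (site c) f)) st2"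
        "differ_on (bank b (set sites)) st1 st2"
      then show "Q p st2"
        using 1(2) assms(6) by (auto simp: act_def intro: differ_on_trans)
    qed
  qed
qed

definition add_com :: "bool \<Rightarrow> ('a \<times> bool \<Rightarrow> int) \<Rightarrow> 'a program" where
  "add_com b f = seqs (map (\<lambda>s. seqs (replicate (nat (f s)) (inc_site b s))) sites)"

lemma runs_add_com:
  assumes "residues b m (set sites) (\<lambda>_. 0) st" "\<And>s. 0 \<le> f s" "0 < m" "m \<le> B"
    and "\<And>st'. residues b m (set sites) f st' \<Longrightarrow> differ_on (bank b (set sites)) st st' \<Longrightarrow> Q p st'"
  shows "runs w B (add_com b f) p st Q"
proof -
  define J where "J = (\<lambda>g p' st'. p' = p \<and> residues b m (set sites) g st' \<and>
    differ_on (bank b (set sites)) st st')"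
  define part where "part = (\<lambda>X t. if t \<in> X then f t else 0)"
  have J_cong: "J h p' st'" if "J g p' st'" "\<And>t. t \<in> set sites \<Longrightarrow> g t = h t" for g h p' st'
    using that residues_cong[of "set sites" g h m st' b st'] by (auto simp: J_def)
  show ?thesis
    unfolding add_com_def
  proof (rule runs_seqs_map[where J = "\<lambda>X. J (part X)"])
    fix X s p1 st1
    assume J: "J (part X) p1 st1" and s: "s \<in> set sites" "s \<notin> X"
    show "runs w B (seqs (replicate (nat (f s)) (inc_site b s))) p1 st1 (J (part (insert s X)))"
    proof (rule runs_seqs_replicate[where J = "\<lambda>k. J ((part X)(s := int k))"])
      show "J ((part X)(s := int 0)) p1 st1"
        by (rule J_cong[OF J]) (use s in \<open>auto simp: part_def\<close>)
    next
      fix k p2 st2 assume "J ((part X)(s := int k)) p2 st2"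
      then have J2: "p2 = p" "residues b m (set sites) ((part X)(s := int k)) st2"
        "differ_on (bank b (set sites)) st st2"
        by (simp_all add: J_def)
      show "runs w B (inc_site b s) p2 st2 (J ((part X)(s := int (Suc k))))"
      proof (rule runs_inc_site[OF J2(2) s(1) assms(3,4)])
        fix st3
        assume r: "residues b m (set sites)
            ((part X)(s := int k, s := ((part X)(s := int k)) s + 1)) st3"
          and d: "differ_on (bank b {s}) st2 st3"
        have "differ_on (bank b (set sites)) st st3"
          using J2(3) d s bank_mono[of "{s}" "set sites" b]
          by (blast intro: differ_on_trans differ_on_mono)
        with r show "J ((part X)(s := int (Suc k))) p2 st3"
          using J2(1) by (simp add: J_def add.commute)
      qed
    next
      fix p2 st2 assume "J ((part X)(s := int (nat (f s)))) p2 st2"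
      then show "J (part (insert s X)) p2 st2"
        by (rule J_cong) (use assms(2) in \<open>auto simp: part_def\<close>)
    qed
  next
    fix p1 st1 assume "J (part (set sites)) p1 st1"
    then have "J f p1 st1"
      by (rule J_cong) (simp add: part_def)
    then show "Q p1 st1"
      using assms(5) by (simp add: J_def)
  qed (use assms distinct_sites in \<open>auto simp: J_def part_def\<close>)
qed

definition init_com :: "bool \<Rightarrow> 'a program" where
  "init_com b = seqs (map (\<lambda>s. clear (Val b s) ;; copy_reg Tmp Md (Cpl b s)) sites)"

lemma runs_init_com:
  assumes "st Tmp = 0" "st Md \<le> B"
    and "\<And>st'. residues b (st Md) (set sites) (\<lambda>_. 0) st' \<Longrightarrow> differ_on (bank b (set sites)) st st' \<Longrightarrow> Q p st'"
  shows "runs w B (init_com b) p st Q"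
  unfolding init_com_def
proof (rule runs_seqs_map[where J = "\<lambda>X p' st'. p' = p \<and> residues b (st Md) X (\<lambda>_. 0) st' \<and>
      differ_on (bank b (set sites)) st st'"])
  fix X s p1 st1
  assume J: "p1 = p \<and> residues b (st Md) X (\<lambda>_. 0) st1 \<and> differ_on (bank b (set sites)) st st1"
    and s: "s \<in> set sites" "s \<notin> X"
  have eq: "st1 Tmp = 0" "st1 Md = st Md"
    using J assms(1) differ_onD[of "bank b (set sites)" st st1 Tmp] differ_onD[of "bank b (set sites)" st st1 Md] by simp_all
  let ?st2 = "st1(Val b s := 0, Cpl b s := st Md)"
  have "residues b (st Md) (insert s X) (\<lambda>_. 0) ?st2"
    using J s by (auto simp: residues_def)
  moreover have "differ_on (bank b (set sites)) st ?st2"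
    using J s by (intro differ_on_upd) auto
  ultimately show "runs w B (clear (Val b s) ;; copy_reg Tmp Md (Cpl b s)) p1 st1 (\<lambda>p' st'. p' = p \<and>
      residues b (st Md) (insert s X) (\<lambda>_. 0) st' \<and> differ_on (bank b (set sites)) st st')"
    using J eq assms(2) by (intro runs_Seq runs_clear runs_copy_reg) simp_all
qed (use assms distinct_sites in \<open>auto simp: residues_def\<close>)

section \<open>Labels read off the input\<close>

fun lscan :: "('a + 'a) option list \<Rightarrow> nat \<Rightarrow> ('a \<times> bool \<Rightarrow> int) \<Rightarrow> 'a \<times> bool \<Rightarrow> int" where
  "lscan w 0 f = f"
| "lscan w (Suc p) f =
    (case input_at w (Suc p) of Input (Some c) \<Rightarrow> lscan w p (act (bar_letter c) f) | _ \<Rightarrow> f)"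

fun lside :: "('a + 'a) option list \<Rightarrow> nat \<Rightarrow> bool" where
  "lside w 0 = False"
| "lside w (Suc p) =
    (case input_at w (Suc p) of Input (Some c) \<Rightarrow> lside w p | Input None \<Rightarrow> True | _ \<Rightarrow> False)"

text \<open>A letter position yields the label of its edge; the separator and the right end marker
  yield the endpoint of the word to their left. For \<open>Inr a\<close> the scan includes the
  letter itself, since \<open>act (Inl a)\<close> turns \<open>base a\<close> into
  \<open>edge (Inr a)\<close>.\<close>

definition label_at :: "('a + 'a) option list \<Rightarrow> nat \<Rightarrow> 'a \<times> bool \<Rightarrow> int" where
  "label_at w p =
    (case input_at w p of
      Input (Some c) \<Rightarrow> lscan w (case c of Inl a \<Rightarrow> p - 1 | Inr a \<Rightarrow> p) (base (gen c))
    | _ \<Rightarrow> lscan w (p - 1) one)"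

lemma lscan_letter:
  "input_at w p = Input (Some c) \<Longrightarrow> lscan w p f = lscan w (p - 1) (act (bar_letter c) f)"
  by (cases p) (auto simp: input_at_def)

lemma lscan_stop: "(\<And>c. input_at w p \<noteq> Input (Some c)) \<Longrightarrow> lscan w p f = f"
  by (cases p) (auto split: input_symbol.split option.split)

lemma lside_letter: "input_at w p = Input (Some c) \<Longrightarrow> lside w p = lside w (p - 1)"
  by (cases p) (auto simp: input_at_def)

lemma lside_stop: "(\<And>c. input_at w p \<noteq> Input (Some c)) \<Longrightarrow> lside w p \<longleftrightarrow> input_at w p = Input None"
proof (cases p)
  case (Suc q)
  then show "(\<And>c. input_at w p \<noteq> Input (Some c)) \<Longrightarrow> ?thesis"
    by (auto split: input_symbol.split option.split)
qed (simp add: input_at_def)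

definition is_letter :: "('a + 'a) option input_symbol \<Rightarrow> ('a reg \<Rightarrow> bool) \<Rightarrow> bool" where
  "is_letter x z \<longleftrightarrow> (\<exists>c. x = Input (Some c))"

text \<open>The head stays on \<open>Inr a\<close> so that the loop processes this letter as well.
  The loop ends on the separator or on the left end marker, and this symbol reveals which word was
  scanned.\<close>

definition scan_com :: "bool \<Rightarrow> 'a program" where
  "scan_com b = init_com b ;;
    If is_letter (dispatch letters (\<lambda>c. add_com b (base (gen c)))) (add_com b one) ;;
    If (\<lambda>x z. \<exists>a. x = Input (Some (Inr a))) Skip (Move Go_Left) ;;
    While is_letter (dispatch letters (\<lambda>c. act_com b (bar_letter c)) ;; Move Go_Left) ;;
    clear (Side b) ;; If (\<lambda>x z. x = Input None) (Inc (Side b)) Skip"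

context
  fixes w :: "('a + 'a) option list" and B :: nat
  assumes w: "w \<in> lists (pair_alphabet (Gam \<Sigma>))"
begin

lemma runs_scan_com:
  assumes "st Tmp = 0" "st Md = m" "0 < m" "m \<le> B" "0 < p"
    and post: "\<And>p' st'. residues b m (set sites) (label_at w p) st' \<Longrightarrow>
      (st' (Side b) = 0 \<longleftrightarrow> \<not> lside w (p - 1)) \<Longrightarrow>
      differ_on (insert (Side b) (bank b (set sites))) st st' \<Longrightarrow> Q p' st'"
  shows "runs w B (scan_com b) p st Q"
proof -
  let ?S = "set sites" and ?X = "bank b (set sites)"
  define c5 :: "'a program" where "c5 = clear (Side b) ;; If (\<lambda>x z. x = Input None) (Inc (Side b)) Skip"
  define c4 :: "'a program" where "c4 = While is_letter (dispatch letters (\<lambda>c. act_com b (bar_letter c)) ;; Move Go_Left) ;; c5"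
  define c3 :: "'a program" where "c3 = If (\<lambda>x z. \<exists>a. x = Input (Some (Inr a))) Skip (Move Go_Left) ;; c4"
  define c2 :: "'a program" where "c2 = If is_letter (dispatch letters (\<lambda>c. add_com b (base (gen c)))) (add_com b one) ;; c3"
  have tmp: "st' Tmp = 0" if "differ_on ?X st st'" for st'
    using differ_onD[OF that, of Tmp] assms(1) by simp
  have 5: "runs w B c5 q st' Q"
    if "residues b m ?S (label_at w p) st'" "differ_on ?X st st'"
      "input_at w q = Input None \<longleftrightarrow> lside w (p - 1)" for q st'
  proof -
    have upd: "Q q (st'(Side b := v))" if "v = 0 \<longleftrightarrow> \<not> lside w (p - 1)" for v
    proof (rule post)
      show "residues b m ?S (label_at w p) (st'(Side b := v))"
        by (rule residues_cong[OF _ _ \<open>residues b m ?S (label_at w p) st'\<close>]) auto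
      show "differ_on (insert (Side b) ?X) st (st'(Side b := v))"
        using differ_on_mono[OF \<open>differ_on ?X st st'\<close>, of "insert (Side b) ?X"]
        by (intro differ_on_upd) auto
    qed (use that in simp)
    show ?thesis
      unfolding c5_def using assms(3,4) that(3) upd[of 0] upd[of 1]
      by (intro runs_Seq runs_clear runs_If runs_Inc runs_Skip) auto
  qed
  \<comment> \<open>The invariant looks ahead: scanning on from \<open>q\<close> with the vector in
    the registers would give the wanted label.\<close>
  define J where "J = (\<lambda>q st'. \<exists>f. residues b m ?S f st' \<and> differ_on ?X st st' \<and>
    lscan w q f = label_at w p \<and> lside w q = lside w (p - 1))"
  have 4: "runs w B c4 q st' Q"
    if "residues b m ?S f st'" "differ_on ?X st st'" "lscan w q f = label_at w p"
      "lside w q = lside w (p - 1)" for q st' f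
    unfolding c4_def
  proof (rule runs_Seq, rule runs_While[where J = J and \<mu> = "\<lambda>q st'. q"])
    show "J q st'"
      using that by (auto simp: J_def)
  next
    fix q st1
    assume "J q st1" and "is_letter (input_at w q) (\<lambda>r. st1 r = 0)"
    then obtain f c where f: "residues b m ?S f st1" "differ_on ?X st st1"
      "lscan w q f = label_at w p" "lside w q = lside w (p - 1)" and c: "input_at w q = Input (Some c)"
      by (auto simp: J_def is_letter_def)
    have cq: "c \<in> Gam \<Sigma>" "0 < q"
      using input_at_Some[OF w c] by auto
    show "runs w B (dispatch letters (\<lambda>c. act_com b (bar_letter c)) ;; Move Go_Left) q st1
        (\<lambda>p' st'. J p' st' \<and> p' < q)"
    proof (rule runs_Seq, rule runs_dispatch)
      fix d assume "input_at w q = Input (Some d)"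
      then have d: "d = c"
        using c by simp
      have bc: "bar_letter c \<in> Gam \<Sigma>"
        using cq by (simp add: mem_Gam_iff)
      show "runs w B (act_com b (bar_letter d)) q st1 (\<lambda>p' st'. runs w B (Move Go_Left) p' st'
          (\<lambda>p' st'. J p' st' \<and> p' < q))"
        unfolding d
      proof (rule runs_act_com[OF f(1) bc tmp[OF f(2)] assms(3,4)], rule runs_Move)
        fix st2 assume 2: "residues b m ?S (act (bar_letter c) f) st2" "differ_on ?X st1 st2"
        have "differ_on ?X st st2"
          using f(2) 2(2) by (rule differ_on_trans)
        then show "J (move_input (length w) Go_Left q) st2 \<and> move_input (length w) Go_Left q < q"
          using 2(1) f(3,4) lscan_letter[OF c, of f] lside_letter[OF c] cq(2) by (auto simp: J_def)
      qed
    qed (use c cq set_letters in auto)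
  next
    fix q st1
    assume "J q st1" and stop: "\<not> is_letter (input_at w q) (\<lambda>r. st1 r = 0)"
    then obtain f where f: "residues b m ?S f st1" "differ_on ?X st st1"
      "lscan w q f = label_at w p" "lside w q = lside w (p - 1)"
      by (auto simp: J_def)
    have "\<And>c. input_at w q \<noteq> Input (Some c)"
      using stop by (auto simp: is_letter_def)
    then show "runs w B c5 q st1 Q"
      using f lscan_stop[of w q f] lside_stop[of w q] by (intro 5) simp_all
  qed
  have 3: "runs w B c3 p st' Q"
    if "residues b m ?S (case input_at w p of Input (Some c) \<Rightarrow> base (gen c) | _ \<Rightarrow> one) st'"
      "differ_on ?X st st'" for st'
    unfolding c3_def
  proof (rule runs_Seq, rule runs_If)
    assume "\<exists>a. input_at w p = Input (Some (Inr a))"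
    then obtain a where a: "input_at w p = Input (Some (Inr a))"
      by blast
    then show "runs w B Skip p st' (\<lambda>p' st'. runs w B c4 p' st' Q)"
      using that lside_letter[OF a] by (intro runs_Skip 4[OF that]) (simp_all add: label_at_def)
  next
    assume "\<nexists>a. input_at w p = Input (Some (Inr a))"
    then have "lscan w (p - 1) (case input_at w p of Input (Some c) \<Rightarrow> base (gen c) | _ \<Rightarrow> one) = label_at w p"
      using assms(5) by (auto simp: label_at_def split: input_symbol.split option.split sum.split)
    then show "runs w B (Move Go_Left) p st' (\<lambda>p' st'. runs w B c4 p' st' Q)"
      by (intro runs_Move 4[OF that]) simp_all
  qed
  have 2: "runs w B c2 p st' Q"
    if "residues b m ?S (\<lambda>_. 0) st'" "differ_on ?X st st'" for st'
    unfolding c2_def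
  proof (rule runs_Seq, rule runs_If)
    assume "is_letter (input_at w p) (\<lambda>r. st' r = 0)"
    then obtain c where c: "input_at w p = Input (Some c)"
      by (auto simp: is_letter_def)
    show "runs w B (dispatch letters (\<lambda>c. add_com b (base (gen c)))) p st' (\<lambda>p' st'. runs w B c3 p' st' Q)"
    proof (rule runs_dispatch, rule runs_add_com[OF that(1) _ assms(3,4)])
      fix d st2 assume "input_at w p = Input (Some d)" "residues b m ?S (base (gen d)) st2"
        "differ_on ?X st' st2"
      then show "runs w B c3 p st2 Q"
        using that(2) by (intro 3) (auto intro: differ_on_trans)
    qed (use c input_at_Some[OF w c] set_letters in \<open>auto simp: base_def\<close>)
  next
    assume nl: "\<not> is_letter (input_at w p) (\<lambda>r. st' r = 0)"
    show "runs w B (add_com b one) p st' (\<lambda>p' st'. runs w B c3 p' st' Q)"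
    proof (rule runs_add_com[OF that(1) _ assms(3,4)])
      fix st2 assume "residues b m ?S one st2" "differ_on ?X st' st2"
      then show "runs w B c3 p st2 Q"
        using that(2) nl
        by (intro 3) (auto simp: is_letter_def intro: differ_on_trans split: input_symbol.split option.split)
    qed (simp add: one_def)
  qed
  have "runs w B (init_com b ;; c2) p st Q"
    by (rule runs_Seq, rule runs_init_com) (use assms(1-4) 2 in auto)
  then show ?thesis
    by (simp add: scan_com_def c2_def c3_def c4_def c5_def)
qed

end

end

section \<open>Comparing the labels at two positions\<close>

context label_program
begin

text \<open>The first residue is added to the complement of the second, which gives their
  difference. This destroys both, but they are recomputed for the next modulus anyway.\<close>

definition compare_site :: "'a \<times> bool \<Rightarrow> 'a program" where
  "compare_site s = loop (Val False s) (inc_mod (Cpl True s) (Val True s)) ;;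
    If (\<lambda>x z. z (Val True s) \<or> z (Cpl True s)) Skip (raise_reg Diff)"

lemma runs_compare_site:
  assumes "[int (st (Val False s)) = f] (mod int m)" "[int (st (Val True s)) = g] (mod int m)"
    and "st (Val True s) + st (Cpl True s) = m" "0 < m" "m \<le> B"
    and post: "\<And>st'. (st' Diff = 0 \<longleftrightarrow> st Diff = 0 \<and> [f = g] (mod int m)) \<Longrightarrow>
      differ_on ({Diff} \<union> bank False {s} \<union> bank True {s}) st st' \<Longrightarrow> Q p st'"
  shows "runs w B (compare_site s) p st Q"
  unfolding compare_site_def
proof (intro runs_Seq)
  let ?x = "Val False s" and ?y = "Val True s" and ?z = "Cpl True s"
  let ?X = "{Diff} \<union> bank False {s} \<union> bank True {s}"
  define c where "c = int (st ?x) + int (st ?z)"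
  show "runs w B (loop ?x (inc_mod ?z ?y)) p st
      (\<lambda>p' st'. runs w B (If (\<lambda>x z. z ?y \<or> z ?z) Skip (raise_reg Diff)) p' st' Q)"
  proof (rule runs_loop[where J = "\<lambda>k p' st'. p' = p \<and> st' ?y + st' ?z = m \<and>
        [int k + int (st' ?z) = c] (mod int m) \<and> st' Diff = st Diff \<and> differ_on ?X st st'"])
    fix k p1 st1
    assume J: "p1 = p \<and> st1 ?y + st1 ?z = m \<and> [int (Suc k) + int (st1 ?z) = c] (mod int m) \<and>
      st1 Diff = st Diff \<and> differ_on ?X st st1"
    show "runs w B (inc_mod ?z ?y) p1 (st1(?x := k)) (\<lambda>p' st'. (p' = p \<and> st' ?y + st' ?z = m \<and>
        [int k + int (st' ?z) = c] (mod int m) \<and> st' Diff = st Diff \<and> differ_on ?X st st') \<and> st' ?x = k)"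
    proof (rule runs_inc_mod[of _ _ _ m])
      fix v v' assume v: "v + v' = m" "[int v = int ((st1(?x := k)) ?z) + 1] (mod int m)"
      let ?st2 = "st1(?x := k, ?z := v, ?y := v')"
      have "[int k + int v = int k + (int (st1 ?z) + 1)] (mod int m)"
        using v(2) by (intro cong_add) simp_all
      moreover have "int k + (int (st1 ?z) + 1) = int (Suc k) + int (st1 ?z)"
        by simp
      ultimately have "[int k + int v = c] (mod int m)"
        using J by (metis cong_trans)
      moreover have "differ_on ?X st ?st2"
        using J by (intro differ_on_upd) auto
      ultimately show "(p1 = p \<and> ?st2 ?y + ?st2 ?z = m \<and> [int k + int (?st2 ?z) = c] (mod int m) \<and>
          ?st2 Diff = st Diff \<and> differ_on ?X st ?st2) \<and> ?st2 ?x = k"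
        using J v(1) by simp
    qed (use J assms(4,5) in auto)
  next
    fix p1 st1
    assume J: "p1 = p \<and> st1 ?y + st1 ?z = m \<and> [int 0 + int (st1 ?z) = c] (mod int m) \<and>
      st1 Diff = st Diff \<and> differ_on ?X st st1"
    \<comment> \<open>The pair has sum \<open>m\<close>, so its residue is zero exactly if one of
      the two registers is empty.\<close>
    have "st1 ?y = 0 \<or> st1 ?z = 0 \<longleftrightarrow> [int (st1 ?z) = 0] (mod int m)"
    proof
      assume "[int (st1 ?z) = 0] (mod int m)"
      then have "m dvd st1 ?z"
        by (simp add: cong_0_iff)
      then show "st1 ?y = 0 \<or> st1 ?z = 0"
        using J by (metis add.commute add_diff_cancel_left' diff_is_0_eq' dvd_imp_le gr0I)
    qed (use J in \<open>auto simp: cong_0_iff\<close>)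
    also have "\<dots> \<longleftrightarrow> [c = 0] (mod int m)"
      using J by (metis add_0 cong_sym cong_trans of_nat_0)
    also have "\<dots> \<longleftrightarrow> [f = g] (mod int m)"
    proof -
      have z: "int (st ?z) = int m - int (st ?y)"
        using assms(3) by simp
      have "[c = f + (0 - g)] (mod int m)"
        unfolding c_def z by (intro cong_add cong_diff assms(1,2)) (simp add: cong_0_iff)
      then have "[c = 0] (mod int m) \<longleftrightarrow> [f - g = 0] (mod int m)"
        by (metis cong_sym cong_trans add_uminus_conv_diff diff_0)
      then show ?thesis
        by (simp add: cong_diff_iff_cong_0)
    qed
    finally have eq: "st1 ?y = 0 \<or> st1 ?z = 0 \<longleftrightarrow> [f = g] (mod int m)" .
    show "runs w B (If (\<lambda>x z. z ?y \<or> z ?z) Skip (raise_reg Diff)) p1 st1 Q"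
    proof (rule runs_If)
      assume "st1 ?y = 0 \<or> st1 ?z = 0"
      then show "runs w B Skip p1 st1 Q"
        using J eq by (intro runs_Skip) (use post in simp)
    next
      assume "\<not> (st1 ?y = 0 \<or> st1 ?z = 0)"
      moreover have "differ_on ?X st (st1(Diff := 1))"
        using J by (intro differ_on_upd) auto
      ultimately show "runs w B (raise_reg Diff) p1 st1 Q"
        using J eq assms(4,5) post[of "st1(Diff := 1)"] by (intro runs_raise_reg) auto
    qed
  qed (use assms(3) in \<open>auto simp: c_def\<close>)
qed

definition compare_com :: "'a program" where
  "compare_com = seqs (map compare_site sites)"

lemma runs_compare_com:
  assumes "residues False m (set sites) f st" "residues True m (set sites) g st" "0 < m" "m \<le> B"
    and post: "\<And>st'. (st' Diff = 0 \<longleftrightarrow> st Diff = 0 \<and> (\<forall>s \<in> set sites. [f s = g s] (mod int m))) \<Longrightarrow>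
      differ_on ({Diff} \<union> bank False (set sites) \<union> bank True (set sites)) st st' \<Longrightarrow> Q p st'"
  shows "runs w B compare_com p st Q"
proof -
  let ?Y = "{Diff} \<union> bank False (set sites) \<union> bank True (set sites)"
  define J where "J = (\<lambda>X p' st'. p' = p \<and>
    (st' Diff = 0 \<longleftrightarrow> st Diff = 0 \<and> (\<forall>s \<in> X. [f s = g s] (mod int m))) \<and>
    residues False m (set sites - X) f st' \<and> residues True m (set sites - X) g st' \<and>
    differ_on ?Y st st')"
  show ?thesis
    unfolding compare_com_def
  proof (rule runs_seqs_map[where J = J])
    fix X s p1 st1
    assume "J X p1 st1" and s: "s \<in> set sites" "s \<notin> X"
    note J = this(1)[unfolded J_def]
    have r: "residues False m (set sites - X) f st1" "residues True m (set sites - X) g st1"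
      and sX: "s \<in> set sites - X"
      using J s by auto
    show "runs w B (compare_site s) p1 st1 (J (insert s X))"
    proof (rule runs_compare_site[OF residuesD(2)[OF r(1) sX] residuesD(2)[OF r(2) sX]
          residuesD(1)[OF r(2) sX] assms(3,4)])
      fix st2
      assume 2: "st2 Diff = 0 \<longleftrightarrow> st1 Diff = 0 \<and> [f s = g s] (mod int m)"
        "differ_on ({Diff} \<union> bank False {s} \<union> bank True {s}) st1 st2"
      have "residues False m (set sites - insert s X) f st2"
        by (rule residues_differ[OF 2(2) _ residues_subset[OF r(1)]]) (auto simp: bank_def)
      moreover have "residues True m (set sites - insert s X) g st2"
        by (rule residues_differ[OF 2(2) _ residues_subset[OF r(2)]]) (auto simp: bank_def)
      moreover have "{Diff} \<union> bank False {s} \<union> bank True {s} \<subseteq> ?Y"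
        using s by (auto simp: bank_def)
      then have "differ_on ?Y st st2"
        using J differ_on_mono[OF 2(2)] by (meson differ_on_trans)
      ultimately show "J (insert s X) p1 st2"
        using J 2(1) unfolding J_def by auto
    qed
  qed (use assms distinct_sites in \<open>auto simp: J_def\<close>)
qed

text \<open>The side is looked up at \<open>i - 1\<close> because the separator belongs to the first
  word and the right end marker to the second, as carriers of the endpoint labels.\<close>

definition match_mod :: "('a + 'a) option list \<Rightarrow> nat \<Rightarrow> nat \<Rightarrow> nat \<Rightarrow> bool" where
  "match_mod w m i j \<longleftrightarrow> lside w (i - 1) \<noteq> lside w (j - 1) \<and>
    (\<forall>s \<in> set sites. [label_at w i s = label_at w j s] (mod int m))"

definition all_match :: "('a + 'a) option list \<Rightarrow> nat \<Rightarrow> nat \<Rightarrow> nat \<Rightarrow> bool" where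
  "all_match w N i j \<longleftrightarrow> (\<forall>m \<in> {1..N}. match_mod w m i j)"

definition check_end :: "'a program" where
  "check_end = If (\<lambda>x z. z (Side False) = z (Side True)) (raise_reg Diff) Skip ;; Dec Md"

definition check_body :: "'a program" where
  "check_body = goto Tmp Pos1 ;; scan_com False ;; goto Tmp Pos2 ;; scan_com True ;; compare_com ;; check_end"

definition check_com :: "'a program" where
  "check_com = clear Diff ;; copy_reg Tmp Bnd Md ;;
    While (nonzero Md)
      check_body"

definition work_regs :: "'a reg set" where
  "work_regs = {Md, Diff, Side False, Side True} \<union> bank False (set sites) \<union> bank True (set sites)"

lemma mem_work_regs [simp]:
  "Tmp \<notin> work_regs" "Seps \<notin> work_regs" "Len \<notin> work_regs" "Bnd \<notin> work_regs" "Pos1 \<notin> work_regs"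
  "Pos2 \<notin> work_regs" "Found \<notin> work_regs" "Fail \<notin> work_regs"
  "Md \<in> work_regs" "Diff \<in> work_regs"
  by (auto simp: work_regs_def)

context
  fixes w :: "('a + 'a) option list" and B :: nat
  assumes w: "w \<in> lists (pair_alphabet (Gam \<Sigma>))"
begin

lemma runs_check_body:
  assumes "st Tmp = 0" "st Md = m" "0 < m" "m \<le> B" "st Pos1 = i" "st Pos2 = j"
    and "0 < i" "i \<le> Suc (length w)" "0 < j" "j \<le> Suc (length w)" "Suc (length w) \<le> B"
    and post: "\<And>p' st'. (st' Diff = 0 \<longleftrightarrow> st Diff = 0 \<and> match_mod w m i j) \<Longrightarrow> st' Md = m - 1 \<Longrightarrow>
      differ_on work_regs st st' \<Longrightarrow> Q p' st'"
  shows "runs w B check_body p st Q"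
  unfolding check_body_def
proof (intro runs_Seq, rule runs_goto; (rule runs_Seq)?)
  show "runs w B (scan_com False) (st Pos1) st (\<lambda>p' st'. runs w B (goto Tmp Pos2 ;; scan_com True ;;
      compare_com ;; check_end) p' st' Q)"
  proof (rule runs_scan_com[OF w assms(1-4)])
    fix p1 st1
    let ?X1 = "insert (Side False) (bank False (set sites))"
    assume 1: "residues False m (set sites) (label_at w (st Pos1)) st1"
      "st1 (Side False) = 0 \<longleftrightarrow> \<not> lside w (st Pos1 - 1)" "differ_on ?X1 st st1"
    have eq1: "st1 Tmp = 0" "st1 Md = m" "st1 Pos2 = j" "st1 Diff = st Diff"
      using assms differ_onD[OF 1(3)] by auto
    show "runs w B (goto Tmp Pos2 ;; scan_com True ;;
        compare_com ;; check_end) p1 st1 Q"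
    proof (rule runs_Seq, rule runs_goto; (rule runs_Seq)?)
      show "runs w B (scan_com True) (st1 Pos2) st1 (\<lambda>p' st'. runs w B
          (compare_com ;; check_end) p' st' Q)"
      proof (rule runs_scan_com[OF w eq1(1,2) assms(3,4)])
        fix p2 st2
        let ?X2 = "insert (Side True) (bank True (set sites))"
        assume 2: "residues True m (set sites) (label_at w (st1 Pos2)) st2"
          "st2 (Side True) = 0 \<longleftrightarrow> \<not> lside w (st1 Pos2 - 1)" "differ_on ?X2 st1 st2"
        have eq2: "st2 Md = m" "st2 Diff = st Diff" "st2 (Side False) = st1 (Side False)"
          using eq1 differ_onD[OF 2(3)] by auto
        have r2: "residues False m (set sites) (label_at w i) st2"
          using residues_differ[OF 2(3) _ 1(1)] assms(5) by (auto simp: bank_def)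
        have r2': "residues True m (set sites) (label_at w j) st2"
          using 2(1) eq1 by simp
        show "runs w B (compare_com ;; check_end) p2 st2 Q"
        proof (rule runs_Seq, rule runs_compare_com[OF r2 r2' assms(3,4)])
          fix st3
          let ?X3 = "{Diff} \<union> bank False (set sites) \<union> bank True (set sites)"
          assume 3: "st3 Diff = 0 \<longleftrightarrow>
              st2 Diff = 0 \<and> (\<forall>s \<in> set sites. [label_at w i s = label_at w j s] (mod int m))"
            "differ_on ?X3 st2 st3"
          have eq3: "st3 Md = m" "st3 (Side False) = st1 (Side False)" "st3 (Side True) = st2 (Side True)"
            using eq2 differ_onD[OF 3(2)] by auto
          have d3: "differ_on work_regs st st3"
            using differ_on_mono[OF 1(3), of work_regs] differ_on_mono[OF 2(3), of work_regs]
              differ_on_mono[OF 3(2), of work_regs]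
            by (auto simp: work_regs_def intro: differ_on_trans)
          show "runs w B (check_end) p2 st3 Q"
            unfolding check_end_def
            proof (rule runs_Seq, rule runs_If)
              assume "(st3 (Side False) = 0) = (st3 (Side True) = 0)"
              then have "\<not> match_mod w m i j"
                using eq3 1(2) 2(2) assms(5,6) eq1 by (simp add: match_mod_def)
              moreover have "differ_on work_regs st (st3(Diff := 1, Md := m - 1))"
                using d3 by (intro differ_on_upd) auto
              ultimately show "runs w B (raise_reg Diff) p2 st3 (\<lambda>p' st'. runs w B (Dec Md) p' st' Q)"
                using eq3 assms(3,4) by (intro runs_raise_reg runs_Dec) (auto intro!: post)
            next
              assume "(st3 (Side False) = 0) \<noteq> (st3 (Side True) = 0)"
              then have "st3 Diff = 0 \<longleftrightarrow> st Diff = 0 \<and> match_mod w m i j"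
                using eq3 eq2 1(2) 2(2) 3(1) assms(5,6) eq1 by (auto simp: match_mod_def)
              moreover have "differ_on work_regs st (st3(Md := m - 1))"
                using d3 by (intro differ_on_upd) auto
              ultimately show "runs w B Skip p2 st3 (\<lambda>p' st'. runs w B (Dec Md) p' st' Q)"
                using eq3 assms(3,4) by (intro runs_Skip runs_Dec) (auto intro!: post)
            qed
        qed
      qed (use eq1 assms in auto)
    qed (use eq1 assms in auto)
  qed (use assms in auto)
qed (use assms in auto)

lemma runs_check_com:
  assumes "st Tmp = 0" "st Bnd \<le> B" "st Pos1 = i" "st Pos2 = j"
    and "0 < i" "i \<le> Suc (length w)" "0 < j" "j \<le> Suc (length w)" "Suc (length w) \<le> B"
    and post: "\<And>p' st'. (st' Diff = 0 \<longleftrightarrow> (\<forall>m \<in> {1..st Bnd}. match_mod w m i j)) \<Longrightarrow>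
      differ_on work_regs st st' \<Longrightarrow> Q p' st'"
  shows "runs w B check_com p st Q"
  unfolding check_com_def
proof (rule runs_Seq, rule runs_clear, rule runs_Seq, rule runs_copy_reg)
  let ?st1 = "st(Diff := 0, Md := (st(Diff := 0)) Bnd)"
  define J where "J = (\<lambda>(p' :: nat) st'. st' Md \<le> st Bnd \<and>
    (st' Diff = 0 \<longleftrightarrow> (\<forall>m \<in> {st' Md<..st Bnd}. match_mod w m i j)) \<and> differ_on work_regs st st')"
  show "runs w B (While (nonzero Md)
      check_body) p ?st1 Q"
  proof (rule runs_While[where \<mu> = "\<lambda>p' st'. st' Md" and J = J])
    have "differ_on work_regs st ?st1"
      by (intro differ_on_upd) auto
    then show "J p ?st1"
      by (simp add: J_def)
  next
    fix p2 st2
    assume "J p2 st2" and m: "\<not> st2 Md = 0"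
    note J = this(1)[unfolded J_def]
    have eq: "st2 Tmp = 0" "st2 Pos1 = i" "st2 Pos2 = j"
      using assms J by (simp_all add: differ_onD[of work_regs st st2])
    show "runs w B check_body p2 st2
       (\<lambda>p' st'. J p' st' \<and> st' Md < st2 Md)"
    proof (rule runs_check_body[OF eq(1) HOL.refl _ _ eq(2,3) assms(5-9)])
      fix p3 st3
      assume 3: "st3 Diff = 0 \<longleftrightarrow> st2 Diff = 0 \<and> match_mod w (st2 Md) i j" "st3 Md = st2 Md - 1"
        "differ_on work_regs st2 st3"
      have "{st3 Md<..st Bnd} = insert (st2 Md) {st2 Md<..st Bnd}"
        using J m 3(2) by auto
      moreover have "differ_on work_regs st st3"
        using J 3(3) by (blast intro: differ_on_trans)
      ultimately show "J p3 st3 \<and> st3 Md < st2 Md"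
        using J m 3(1,2) by (auto simp: J_def)
    qed (use J m assms(2) in auto)
  next
    fix p2 st2
    assume "J p2 st2" and m: "\<not> \<not> st2 Md = 0"
    note J = this(1)[unfolded J_def]
    have "{st2 Md<..st Bnd} = {1..st Bnd}"
      using m by auto
    then show "Q p2 st2"
      using J by (intro post) simp_all
  qed
qed (use assms in auto)

end

definition search_com :: "'a program" where
  "search_com = clear Found ;; copy_reg Tmp Len Pos2 ;;
    While (nonzero Pos2) (check_com ;; If (\<lambda>x z. z Diff) (raise_reg Found) Skip ;; Dec Pos2)"

context
  fixes w :: "('a + 'a) option list" and B :: nat
  assumes w: "w \<in> lists (pair_alphabet (Gam \<Sigma>))" and B: "Suc (length w) \<le> B"
begin

lemma runs_search_com:
  assumes "st Tmp = 0" "st Bnd = N" "N \<le> B" "st Pos1 = i" "st Len = Suc (length w)"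
    and "0 < i" "i \<le> Suc (length w)"
    and post: "\<And>p' st'. (st' Found = 0 \<longleftrightarrow> \<not> (\<exists>j \<in> {1..Suc (length w)}. all_match w N i j)) \<Longrightarrow>
      differ_on ({Found, Pos2} \<union> work_regs) st st' \<Longrightarrow> Q p' st'"
  shows "runs w B search_com p st Q"
  unfolding search_com_def
proof (rule runs_Seq, rule runs_clear, rule runs_Seq, rule runs_copy_reg)
  let ?X = "{Found, Pos2} \<union> work_regs" and ?L = "Suc (length w)"
  let ?st1 = "st(Found := 0, Pos2 := (st(Found := 0)) Len)"
  define J where "J = (\<lambda>(p' :: nat) st'. st' Pos2 \<le> ?L \<and>
    (st' Found = 0 \<longleftrightarrow> \<not> (\<exists>j \<in> {st' Pos2<..?L}. all_match w N i j)) \<and> differ_on ?X st st')"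
  show "runs w B (While (nonzero Pos2) (check_com ;; If (\<lambda>x z. z Diff) (raise_reg Found) Skip ;; Dec Pos2)) p ?st1 Q"
  proof (rule runs_While[where \<mu> = "\<lambda>p' st'. st' Pos2" and J = J])
    have "differ_on ?X st ?st1"
      by (intro differ_on_upd) auto
    then show "J p ?st1"
      using assms(5) by (simp add: J_def)
  next
    fix p2 st2
    assume J: "J p2 st2" and j: "\<not> st2 Pos2 = 0"
    have eq: "st2 Tmp = 0" "st2 Bnd = N" "st2 Pos1 = i"
      using assms(1-5) J by (simp_all add: J_def differ_onD[of ?X st st2])
    have "{st2 Pos2 - 1<..?L} = insert (st2 Pos2) {st2 Pos2<..?L}"
      using J j by (auto simp: J_def)
    then have ex: "(\<exists>j \<in> {st2 Pos2 - 1<..?L}. all_match w N i j) \<longleftrightarrow>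
        all_match w N i (st2 Pos2) \<or> (\<exists>j \<in> {st2 Pos2<..?L}. all_match w N i j)"
      by auto
    show "runs w B (check_com ;; If (\<lambda>x z. z Diff) (raise_reg Found) Skip ;; Dec Pos2) p2 st2
        (\<lambda>p' st'. J p' st' \<and> st' Pos2 < st2 Pos2)"
    proof (rule runs_Seq, rule runs_check_com[OF w eq(1) _ eq(3) HOL.refl assms(6,7) _ _ B])
      fix p3 st3
      assume 3: "st3 Diff = 0 \<longleftrightarrow> (\<forall>m \<in> {1..st2 Bnd}. match_mod w m i (st2 Pos2))"
        "differ_on work_regs st2 st3"
      have eq3: "st3 Pos2 = st2 Pos2" "st3 Found = st2 Found"
        by (simp_all add: differ_onD[OF 3(2)])
      have m3: "st3 Diff = 0 \<longleftrightarrow> all_match w N i (st2 Pos2)"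
        using 3(1) eq by (simp add: all_match_def)
      have d3: "differ_on ?X st st3"
        using J differ_on_mono[OF 3(2), of ?X] by (auto simp: J_def intro: differ_on_trans)
      show "runs w B (If (\<lambda>x z. z Diff) (raise_reg Found) Skip ;; Dec Pos2) p3 st3
          (\<lambda>p' st'. J p' st' \<and> st' Pos2 < st2 Pos2)"
      proof (rule runs_Seq, rule runs_If)
        assume "st3 Diff = 0"
        then have "\<exists>j \<in> {st2 Pos2 - 1<..?L}. all_match w N i j"
          using m3 ex by simp
        moreover have "differ_on ?X st (st3(Found := 1, Pos2 := st2 Pos2 - 1))"
          using d3 by (intro differ_on_upd) auto
        ultimately have "J p3 (st3(Found := 1, Pos2 := st2 Pos2 - 1))"
          using J by (auto simp: J_def)
        then show "runs w B (raise_reg Found) p3 st3 (\<lambda>p' st'. runs w B (Dec Pos2) p' st'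
            (\<lambda>p' st'. J p' st' \<and> st' Pos2 < st2 Pos2))"
          using B j eq3 by (intro runs_raise_reg runs_Dec) auto
      next
        assume "\<not> st3 Diff = 0"
        moreover have "differ_on ?X st (st3(Pos2 := st2 Pos2 - 1))"
          using d3 by (intro differ_on_upd) auto
        ultimately have "J p3 (st3(Pos2 := st2 Pos2 - 1))"
          using J m3 ex eq3 unfolding J_def by auto
        then show "runs w B Skip p3 st3 (\<lambda>p' st'. runs w B (Dec Pos2) p' st'
            (\<lambda>p' st'. J p' st' \<and> st' Pos2 < st2 Pos2))"
          using j eq3 by (intro runs_Skip runs_Dec) auto
      qed
    qed (use eq assms(3) J j in \<open>auto simp: J_def\<close>)
  next
    fix p2 st2
    assume J: "J p2 st2" and j: "\<not> \<not> st2 Pos2 = 0"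
    have "{st2 Pos2<..?L} = {1..?L}"
      using j by auto
    then show "Q p2 st2"
      using J unfolding J_def by (intro post) simp_all
  qed
qed (use assms B in auto)

end

end

lemma runs_incs:
  assumes "st r + k \<le> B" "Q p (st(r := st r + k))"
  shows "runs w B (seqs (replicate k (Inc r))) p st Q"
proof (rule runs_seqs_replicate[where J = "\<lambda>i p' st'. p' = p \<and> st' = st(r := st r + i)"])
  fix i p' st' assume "p' = p \<and> st' = st(r := st r + i)" "i < k"
  then show "runs w B (Inc r) p' st' (\<lambda>p' st'. p' = p \<and> st' = st(r := st r + Suc i))"
    using assms(1) by (intro runs_Inc) auto
qed (use assms(2) in auto)

lemma input_at_Suc: "q < length w \<Longrightarrow> input_at w (Suc q) = Input (w ! q)"
  by (simp add: input_at_def)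

lemma input_at_end: "input_at w (Suc (length w)) = Right_End"
  by (simp add: input_at_def)

definition num_seps :: "'b option list \<Rightarrow> nat" where
  "num_seps w = length (filter (\<lambda>x. x = None) w)"

text \<open>\<open>Bnd\<close> becomes \<open>8 * length w + 6\<close>, the largest modulus needed
  in \<open>all_match_iff\<close>. \<open>Len\<close> becomes \<open>length w + 1\<close>, the last
  position that carries a label.\<close>

definition count_com :: "'a program" where
  "count_com = Inc Len ;; seqs (replicate 6 (Inc Bnd)) ;; Move Go_Right ;;
    While (\<lambda>x z. x \<noteq> Right_End)
      (If (\<lambda>x z. x = Input None) (Inc Seps) Skip ;; Inc Len ;; seqs (replicate 8 (Inc Bnd)) ;;
       Move Go_Right)"

lemma runs_count_com:
  assumes "8 * length w + 8 \<le> B"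
    and "\<And>p. Q p ((\<lambda>_. 0)(Len := Suc (length w), Bnd := 8 * length w + 6, Seps := num_seps w))"
  shows "runs w B count_com 0 (\<lambda>_. 0) Q"
proof -
  define at_pos :: "nat \<Rightarrow> 'a reg \<Rightarrow> nat" where "at_pos = (\<lambda>q. (\<lambda>_. 0)(Len := Suc q, Bnd := 8 * q + 6, Seps := num_seps (take q w)))"
  define post where "post = (\<lambda>p p' st'.
    (\<exists>q \<le> length w. p' = Suc q \<and> st' = at_pos q) \<and> Suc (length w) - p' < Suc (length w) - p)"
  have "runs w B (While (\<lambda>x z. x \<noteq> Right_End)
      (If (\<lambda>x z. x = Input None) (Inc Seps) Skip ;; Inc Len ;; seqs (replicate 8 (Inc Bnd)) ;;
       Move Go_Right)) (Suc 0) (at_pos 0) Q"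
  proof (rule runs_While[where J = "\<lambda>p st. \<exists>q \<le> length w. p = Suc q \<and> st = at_pos q"
        and \<mu> = "\<lambda>p st. Suc (length w) - p"])
    fix p st assume "\<exists>q \<le> length w. p = Suc q \<and> st = at_pos q" and "input_at w p \<noteq> Right_End"
    then obtain q where q: "q < length w" "p = Suc q" "st = at_pos q"
      using input_at_end[of w] by (metis le_neq_implies_less)
    have le: "num_seps (take q w) \<le> length w"
      using length_filter_le[of "\<lambda>x. x = None" "take q w"] by (simp add: num_seps_def)
    let ?st = "at_pos q" and ?v = "num_seps (take (Suc q) w)"
    have step: "runs w B (Inc Len ;; seqs (replicate 8 (Inc Bnd)) ;; Move Go_Right) p (?st(Seps := ?v))
        (post p)"
    proof (intro runs_Seq runs_Inc runs_incs runs_Move)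
      let ?st1 = "?st(Seps := ?v)"
      let ?st2 = "?st1(Len := Suc (?st1 Len))"
      have "?st2(Bnd := ?st2 Bnd + 8) = at_pos (Suc q)"
        by (auto simp: at_pos_def)
      then show "post p (move_input (length w) Go_Right p) (?st2(Bnd := ?st2 Bnd + 8))"
        using q unfolding post_def by (intro conjI exI[of _ "Suc q"]) auto
    qed (use assms(1) q in \<open>auto simp: at_pos_def\<close>)
    have "runs w B (If (\<lambda>x z. x = Input None) (Inc Seps) Skip ;; Inc Len ;;
        seqs (replicate 8 (Inc Bnd)) ;; Move Go_Right) p st
        (post p)"
    proof (rule runs_Seq, rule runs_If)
      assume "input_at w p = Input None"
      then have "?v = Suc (?st Seps)"
        using q by (simp add: input_at_Suc num_seps_def take_Suc_conv_app_nth at_pos_def)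
      then show "runs w B (Inc Seps) p st (\<lambda>p' st'. runs w B (Inc Len ;; seqs (replicate 8 (Inc Bnd)) ;;
          Move Go_Right) p' st' (post p))"
        using step q le assms(1) by (intro runs_Inc) (simp_all add: at_pos_def)
    next
      assume "input_at w p \<noteq> Input None"
      then have "?v = ?st Seps"
        using q by (simp add: input_at_Suc num_seps_def take_Suc_conv_app_nth at_pos_def)
      then have "?st(Seps := ?v) = st"
        using q by simp
      then show "runs w B Skip p st (\<lambda>p' st'. runs w B (Inc Len ;; seqs (replicate 8 (Inc Bnd)) ;;
          Move Go_Right) p' st' (post p))"
        using step by (intro runs_Skip) simp
    qed
    then show "runs w B (If (\<lambda>x z. x = Input None) (Inc Seps) Skip ;; Inc Len ;;
        seqs (replicate 8 (Inc Bnd)) ;; Move Go_Right) p st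
        (\<lambda>p' st'. (\<exists>q \<le> length w. p' = Suc q \<and> st' = at_pos q) \<and> Suc (length w) - p' < Suc (length w) - p)"
      unfolding post_def .
  next
    fix p st assume "\<exists>q \<le> length w. p = Suc q \<and> st = at_pos q" and "\<not> input_at w p \<noteq> Right_End"
    then have "st = at_pos (length w)"
      using input_at_Suc[of _ w] by (metis input_symbol.distinct(5) le_neq_implies_less)
    then show "Q p st"
      using assms(2) by (simp add: at_pos_def)
  qed auto
  moreover have "(\<lambda>_. 0)(Len := Suc 0, Bnd := 6) = at_pos 0"
    by (auto simp: at_pos_def num_seps_def)
  ultimately show ?thesis
    unfolding count_com_def using assms(1) by (intro runs_Seq runs_Inc runs_incs runs_Move) simp_all
qed

context label_program
begin

definition main_com :: "'a program" where
  "main_com = copy_reg Tmp Len Pos1 ;;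
    While (nonzero Pos1) (search_com ;; If (\<lambda>x z. z Found) (raise_reg Fail) Skip ;; Dec Pos1)"

lemma runs_main_com:
  assumes w: "w \<in> lists (pair_alphabet (Gam \<Sigma>))" and B: "Suc (length w) \<le> B"
    and "st Tmp = 0" "st Bnd = N" "N \<le> B" "st Len = Suc (length w)" "st Fail = 0"
    and post: "\<And>p' st'. (st' Fail = 0 \<longleftrightarrow>
        (\<forall>i \<in> {1..Suc (length w)}. \<exists>j \<in> {1..Suc (length w)}. all_match w N i j)) \<Longrightarrow>
      st' Seps = st Seps \<Longrightarrow> Q p' st'"
  shows "runs w B main_com p st Q"
  unfolding main_com_def
proof (rule runs_Seq, rule runs_copy_reg)
  let ?X = "{Fail, Found, Pos1, Pos2} \<union> work_regs" and ?L = "Suc (length w)"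
  let ?st1 = "st(Pos1 := st Len)"
  define ok where "ok = (\<lambda>i. \<exists>j \<in> {1..?L}. all_match w N i j)"
  define J where "J = (\<lambda>(p' :: nat) st'. st' Pos1 \<le> ?L \<and>
    (st' Fail = 0 \<longleftrightarrow> (\<forall>i \<in> {st' Pos1<..?L}. ok i)) \<and> differ_on ?X st st')"
  show "runs w B (While (nonzero Pos1) (search_com ;; If (\<lambda>x z. z Found) (raise_reg Fail) Skip ;; Dec Pos1)) p ?st1 Q"
  proof (rule runs_While[where \<mu> = "\<lambda>p' st'. st' Pos1" and J = J])
    have "differ_on ?X st ?st1"
      by (intro differ_on_upd) auto
    then show "J p ?st1"
      using assms(6,7) by (simp add: J_def)
  next
    fix p2 st2
    assume J: "J p2 st2" and i: "\<not> st2 Pos1 = 0"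
    have eq: "st2 Tmp = 0" "st2 Bnd = N" "st2 Len = ?L"
      using assms(3,4,6) J by (simp_all add: J_def differ_onD[of ?X st st2])
    have "{st2 Pos1 - 1<..?L} = insert (st2 Pos1) {st2 Pos1<..?L}"
      using J i by (auto simp: J_def)
    then have all: "(\<forall>i \<in> {st2 Pos1 - 1<..?L}. ok i) \<longleftrightarrow> ok (st2 Pos1) \<and> (\<forall>i \<in> {st2 Pos1<..?L}. ok i)"
      by auto
    show "runs w B (search_com ;; If (\<lambda>x z. z Found) (raise_reg Fail) Skip ;; Dec Pos1) p2 st2
        (\<lambda>p' st'. J p' st' \<and> st' Pos1 < st2 Pos1)"
    proof (rule runs_Seq, rule runs_search_com[OF w B eq(1,2) assms(5) HOL.refl eq(3)])
      fix p3 st3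
      assume "st3 Found = 0 \<longleftrightarrow> \<not> (\<exists>j \<in> {1..?L}. all_match w N (st2 Pos1) j)"
        and d: "differ_on ({Found, Pos2} \<union> work_regs) st2 st3"
      then have m3: "st3 Found = 0 \<longleftrightarrow> \<not> ok (st2 Pos1)"
        by (simp add: ok_def)
      have eq3: "st3 Pos1 = st2 Pos1" "st3 Fail = st2 Fail"
        by (simp_all add: differ_onD[OF d])
      have d3: "differ_on ?X st st3"
        using J differ_on_mono[OF d, of ?X] by (auto simp: J_def intro: differ_on_trans)
      show "runs w B (If (\<lambda>x z. z Found) (raise_reg Fail) Skip ;; Dec Pos1) p3 st3
          (\<lambda>p' st'. J p' st' \<and> st' Pos1 < st2 Pos1)"
      proof (rule runs_Seq, rule runs_If)
        assume "st3 Found = 0"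
        then have "\<not> (\<forall>i \<in> {st2 Pos1 - 1<..?L}. ok i)"
          using m3 all by simp
        moreover have "differ_on ?X st (st3(Fail := 1, Pos1 := st2 Pos1 - 1))"
          using d3 by (intro differ_on_upd) auto
        ultimately have "J p3 (st3(Fail := 1, Pos1 := st2 Pos1 - 1))"
          using J by (auto simp: J_def)
        then show "runs w B (raise_reg Fail) p3 st3 (\<lambda>p' st'. runs w B (Dec Pos1) p' st'
            (\<lambda>p' st'. J p' st' \<and> st' Pos1 < st2 Pos1))"
          using B i eq3 by (intro runs_raise_reg runs_Dec) auto
      next
        assume "\<not> st3 Found = 0"
        moreover have "differ_on ?X st (st3(Pos1 := st2 Pos1 - 1))"
          using d3 by (intro differ_on_upd) auto
        ultimately have "J p3 (st3(Pos1 := st2 Pos1 - 1))"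
          using J m3 all eq3 unfolding J_def by auto
        then show "runs w B Skip p3 st3 (\<lambda>p' st'. runs w B (Dec Pos1) p' st'
            (\<lambda>p' st'. J p' st' \<and> st' Pos1 < st2 Pos1))"
          using i eq3 by (intro runs_Skip runs_Dec) auto
      qed
    qed (use J i in \<open>auto simp: J_def\<close>)
  next
    fix p2 st2
    assume J: "J p2 st2" and i: "\<not> \<not> st2 Pos1 = 0"
    have "{st2 Pos1<..?L} = {1..?L}"
      using i by auto
    moreover have "st2 Seps = st Seps"
      using J by (simp add: J_def differ_onD[of ?X st st2])
    ultimately show "Q p2 st2"
      using J unfolding J_def ok_def by (intro post) simp_all
  qed
qed (use assms in auto)

text \<open>Inputs with no or several separators encode no instance and must be rejected. The search
  is run on them as well, since its correctness holds for every input, and the count is consulted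
  afterwards.\<close>

definition word_problem_com :: "'a program" where
  "word_problem_com = count_com ;; main_com ;;
    If (\<lambda>x z. z Seps) (raise_reg Fail) (Dec Seps ;; If (\<lambda>x z. z Seps) Skip (raise_reg Fail))"

lemma runs_word_problem_com:
  assumes w: "w \<in> lists (pair_alphabet (Gam \<Sigma>))"
  shows "runs w (8 * length w + 8) word_problem_com 0 (\<lambda>_. 0) (\<lambda>p st. st Fail = 0 \<longleftrightarrow>
    num_seps w = 1 \<and>
    (\<forall>i \<in> {1..Suc (length w)}. \<exists>j \<in> {1..Suc (length w)}. all_match w (8 * length w + 6) i j))"
  unfolding word_problem_com_def
proof (rule runs_Seq, rule runs_count_com, simp, rule runs_Seq, rule runs_main_com[OF w])
  let ?B = "8 * length w + 8"
    and ?ok = "\<forall>i \<in> {1..Suc (length w)}. \<exists>j \<in> {1..Suc (length w)}. all_match w (8 * length w + 6) i j"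
  fix p :: nat and st :: "'a reg \<Rightarrow> nat"
  assume "st Fail = 0 \<longleftrightarrow> ?ok"
    and "st Seps = ((\<lambda>_. 0)(Len := Suc (length w), Bnd := 8 * length w + 6, Seps := num_seps w)) Seps"
  then show "runs w ?B (If (\<lambda>x z. z Seps) (raise_reg Fail) (Dec Seps ;; If (\<lambda>x z. z Seps) Skip (raise_reg Fail)))
      p st (\<lambda>p st. st Fail = 0 \<longleftrightarrow> num_seps w = 1 \<and> ?ok)"
    by (intro runs_If runs_Seq runs_Dec runs_raise_reg runs_Skip) auto
qed simp_all

section \<open>Size and support of labels\<close>

lemma abs_fire_le: "(\<And>s. \<bar>f s\<bar> \<le> C) \<Longrightarrow> \<bar>fire t f s\<bar> \<le> 3 * C"
  using abs_triangle_ineq[of "f s" "2 * f t"] abs_ge_zero[of "f s"]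
  unfolding fire_def by (smt (verit) abs_minus_cancel)

lemma abs_act_le: "(\<And>s. \<bar>f s\<bar> \<le> C) \<Longrightarrow> \<bar>act c f s\<bar> \<le> 9 * C"
  using abs_fire_le[of "fire (site c) f" "3 * C"] abs_fire_le[of f C] by (simp add: act_def)

text \<open>A letter stands for two firings, each of which at most triples the entries: a factor of
  9 per position.\<close>

lemma abs_lscan_le: "(\<And>s. \<bar>f s\<bar> \<le> C) \<Longrightarrow> \<bar>lscan w p f s\<bar> \<le> 9 ^ p * C"
proof (induction p arbitrary: f C)
  case (Suc p)
  have C: "0 \<le> C"
    using Suc.prems[of s] abs_ge_zero[of "f s"] by linarith
  have "1 \<le> (9 :: int) ^ Suc p"
    by (rule one_le_power) simp
  then have le: "C \<le> 9 ^ Suc p * C"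
    using mult_right_mono[of 1 "9 ^ Suc p" C] C by (simp only: mult_1)
  have "\<bar>lscan w p (act (bar_letter c) f) s\<bar> \<le> 9 ^ p * (9 * C)" for c
    by (rule Suc.IH) (rule abs_act_le[OF Suc.prems])
  then show ?case
    using Suc.prems[of s] le
    by (auto simp: mult.assoc mult.left_commute split: input_symbol.split option.split)
qed simp

lemma abs_label_at_le:
  assumes "1 \<le> i" "i \<le> Suc (length w)"
  shows "\<bar>label_at w i s\<bar> \<le> 2 * 9 ^ length w"
proof -
  have lscan: "\<bar>lscan w p f s\<bar> \<le> 2 * 9 ^ length w" if "p \<le> length w" "\<And>s. \<bar>f s\<bar> \<le> 2" for p f
  proof -
    have "\<bar>lscan w p f s\<bar> \<le> 9 ^ p * 2"
      using that(2) by (rule abs_lscan_le)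
    also have "\<dots> \<le> 9 ^ length w * 2"
      using that(1) by (intro mult_right_mono power_increasing) auto
    finally show ?thesis
      by simp
  qed
  have "\<bar>base a s\<bar> \<le> 2" "\<bar>one s\<bar> \<le> 2" for a s
    by (auto simp: base_def one_def)
  moreover have "i \<le> length w" if "input_at w i = Input x" for x
    using that by (auto simp: input_at_def split: if_splits)
  moreover have "i - 1 \<le> length w"
    using assms(2) by simp
  ultimately show ?thesis
    unfolding label_at_def using assms(1)
    by (auto intro!: lscan split: input_symbol.split option.split sum.split)
qed

lemma act_outside: "gen c \<in> \<Sigma> \<Longrightarrow> fst s \<notin> \<Sigma> \<Longrightarrow> act c f s = f s"
  by (auto simp: act_def fire_def nbr_def)

lemma lscan_outside:
  assumes "w \<in> lists (pair_alphabet (Gam \<Sigma>))" "fst s \<notin> \<Sigma>"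
  shows "lscan w p f s = f s"
proof (induction p arbitrary: f)
  case (Suc p)
  then show ?case
    using input_at_Some(1)[OF assms(1), of "Suc p"] assms(2)
    by (auto simp: act_outside mem_Gam_iff split: input_symbol.split option.split)
qed simp

text \<open>The program sees only the sites over the alphabet, while labels are functions on all
  sites. Elsewhere they are constantly 1, so agreement on \<open>sites\<close> is equality.\<close>

lemma label_at_outside:
  assumes "w \<in> lists (pair_alphabet (Gam \<Sigma>))" "fst s \<notin> \<Sigma>" "I \<subseteq> \<Sigma> \<times> \<Sigma>"
  shows "label_at w i s = 1"
proof -
  have "base (gen c) s = 1" if "input_at w i = Input (Some c)" for c
    using input_at_Some(1)[OF assms(1) that] assms(2,3) by (auto simp: base_def mem_Gam_iff)
  then show ?thesis
    using lscan_outside[OF assms(1,2)]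
    by (auto simp: label_at_def one_def split: input_symbol.split option.split)
qed

end

text \<open>The numbers \<open>1 / (k * (n choose k))\<close> form Leibniz's harmonic triangle. Its
  first column consists of the \<open>1 / n\<close>, and every further entry is a difference of two
  entries of the preceding column; so multiplication by \<open>D\<close> makes all of them
  integral.\<close>

lemma leibniz_triangle:
  assumes "\<And>m. 1 \<le> m \<Longrightarrow> m \<le> n \<Longrightarrow> int m dvd D" "1 \<le> k" "k \<le> n"
  shows "int (k * (n choose k)) dvd D"
proof -
  have "real_of_int D / real (k * (n choose k)) \<in> \<int>"
    using assms(2,1,3)
  proof (induction k arbitrary: n rule: dec_induct)
    case base
    then obtain c where "D = int n * c"
      by (metis dvdE order.refl)
    then show ?case
      using base by simp
  next
    case (step k)
    have pos: "0 < real k" "0 < real (n choose k)" "k < n" "0 < real (n - 1 choose k)"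
      using step by auto
    \<comment> \<open>With \<open>a = k\<close>, \<open>b = n\<close> and
      \<open>c = n choose k\<close> this is the recurrence \<open>1 / ((k + 1) * (n choose (k + 1)))
      = 1 / (k * (n - 1 choose k)) - 1 / (k * (n choose k))\<close>.\<close>
    have field: "x / ((b - a) * c) = x / (a * ((b - a) * c) / b) - x / (a * c)"
      if "0 < a" "0 < c" "a < b" for x a b c :: real
      using that by (simp add: field_simps)
    have nk: "real (n - k) = real n - real k"
      using pos by (simp add: of_nat_diff)
    have "real (Suc k * (n choose Suc k)) = (real n - real k) * real (n choose k)"
      using binomial_absorb_comp[of n k] binomial_absorption[of k n] nk by (metis of_nat_mult)
    moreover have bM: "real n * real (n - 1 choose k) = (real n - real k) * real (n choose k)"
      using binomial_absorb_comp[of n k] nk by (metis of_nat_mult)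
    have "real (k * (n - 1 choose k)) = real k * ((real n - real k) * real (n choose k)) / real n"
      using pos by (subst bM[symmetric]) simp
    ultimately have "real_of_int D / real (Suc k * (n choose Suc k)) =
        real_of_int D / real (k * (n - 1 choose k)) - real_of_int D / real (k * (n choose k))"
      using field[of "real k" "real (n choose k)" "real n" "real_of_int D"] pos
      by (simp only: of_nat_mult)
    moreover have "real_of_int D / real (k * (n - 1 choose k)) \<in> \<int>"
      using step by (intro step.IH) auto
    moreover have "real_of_int D / real (k * (n choose k)) \<in> \<int>"
      using step by (intro step.IH) auto
    ultimately show ?case
      by simp
  qed
  then obtain c where "real_of_int D / real (k * (n choose k)) = real_of_int c"
    by (auto elim: Ints_cases)
  moreover have "0 < k * (n choose k)"
    using assms(2,3) by simp
  ultimately have "real_of_int D = real_of_int (c * int (k * (n choose k)))"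
    by (simp add: field_simps)
  then have "D = c * int (k * (n choose k))"
    by (simp only: of_int_eq_iff)
  then show ?thesis
    by simp
qed

text \<open>The difference is a common multiple of \<open>1, ..., 2 * k\<close>. A nonzero one is at
  least \<open>k * (2 * k choose k)\<close>, hence at least \<open>2 ^ k\<close>.\<close>

lemma cong_all_imp_eq:
  fixes a b :: int
  assumes "\<And>m. m \<in> {1..2 * k} \<Longrightarrow> [a = b] (mod int m)" "\<bar>a - b\<bar> < 2 ^ k" "1 \<le> k"
  shows "a = b"
proof (rule ccontr)
  assume "a \<noteq> b"
  have "int (k * (2 * k choose k)) dvd a - b"
    using assms(1,3) by (intro leibniz_triangle) (auto simp: cong_iff_dvd_diff)
  then have "int (k * (2 * k choose k)) \<le> \<bar>a - b\<bar>"
    using \<open>a \<noteq> b\<close> by (intro zdvd_imp_le) auto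
  moreover have "(2 :: real) ^ k \<le> real (2 * k choose k)"
    using binomial_ge_n_over_k_pow_k[of k "2 * k", where 'a = real] assms(3) by simp
  then have "2 ^ k \<le> 2 * k choose k"
    by (metis of_nat_le_iff of_nat_numeral of_nat_power)
  then have "2 ^ k \<le> k * (2 * k choose k)"
    using assms(3) by (metis le_trans mult_le_mono1 mult_1)
  then have "2 ^ k \<le> int (k * (2 * k choose k))"
    by (metis of_nat_le_iff of_nat_numeral of_nat_power)
  ultimately show False
    using assms(2) by linarith
qed

context label_program
begin

text \<open>The bound is \<open>2 * k\<close> for \<open>k = 4 * length w + 3\<close>, and this
  \<open>k\<close> is chosen such that \<open>2 ^ k\<close> exceeds every difference of two label
  entries.\<close>

lemma all_match_iff:
  assumes "w \<in> lists (pair_alphabet (Gam \<Sigma>))" "I \<subseteq> \<Sigma> \<times> \<Sigma>"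
    and "1 \<le> i" "i \<le> Suc (length w)" "1 \<le> j" "j \<le> Suc (length w)"
  shows "all_match w (8 * length w + 6) i j \<longleftrightarrow>
    lside w (i - 1) \<noteq> lside w (j - 1) \<and> label_at w i = label_at w j"
proof -
  let ?n = "length w"
  have "label_at w i = label_at w j"
    if cong: "\<And>m s. m \<in> {1..8 * ?n + 6} \<Longrightarrow> s \<in> set sites \<Longrightarrow>
      [label_at w i s = label_at w j s] (mod int m)"
  proof
    fix s
    show "label_at w i s = label_at w j s"
    proof (cases "fst s \<in> \<Sigma>")
      case True
      then have s: "s \<in> set sites"
        using set_sites by (simp add: mem_Times_iff)
      \<comment> \<open>Rounding 9 up to 16 gives a power of 2. The 4 in \<open>4 * 9 ^ ?n\<close>
        is twice the factor in the bound on a single label, and the surplus 3 in the exponent makes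
        the inequality strict.\<close>
      have "(9 :: int) ^ ?n \<le> 16 ^ ?n"
        by (intro power_mono) auto
      also have "\<dots> = 2 ^ (4 * ?n)"
        by (simp add: power_mult)
      finally have "4 * 9 ^ ?n < (2 :: int) ^ (4 * ?n + 3)"
        by (simp add: power_add) (use zero_less_power[of "2 :: int" "4 * ?n"] in linarith)
      moreover have "\<bar>label_at w i s - label_at w j s\<bar> \<le> 4 * 9 ^ ?n"
        using abs_label_at_le[OF assms(3,4), of s] abs_label_at_le[OF assms(5,6), of s] by linarith
      ultimately show ?thesis
        using cong[OF _ s] by (intro cong_all_imp_eq[of "4 * ?n + 3"]) auto
    next
      case False
      then show ?thesis
        using label_at_outside[OF assms(1) _ assms(2)] by simp
    qed
  qed
  then show ?thesis
    unfolding all_match_def match_mod_def by fastforce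
qed

text \<open>The prefix \<open>pre\<close> is empty for the first word and ends in the separator for
  the second, so one lemma serves both. The scan meets the letters of \<open>p\<close> from right to
  left, which is the order of \<open>bar p\<close>.\<close>

lemma lscan_block:
  assumes "w = pre @ map Some p @ rest" "pre = [] \<or> last pre = None"
  shows "lscan w (length pre + length p) f = acts (bar p) f \<and>
    (lside w (length pre + length p) \<longleftrightarrow> pre \<noteq> [])"
  using assms(1)
proof (induction p arbitrary: f rest rule: rev_induct)
  case Nil
  show ?case
  proof (cases "pre = []")
    case False
    then have "input_at w (length pre) = Input None"
      using assms(2) Nil by (simp add: input_at_def nth_append last_conv_nth)
    then show ?thesis
      using False lscan_stop[of w "length pre" f] lside_stop[of w "length pre"] by simp
  qed simp
next
  case (snoc c p)
  have "input_at w (length pre + length (p @ [c])) = Input (Some c)"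
    using snoc.prems by (simp add: input_at_def nth_append)
  moreover have "w = pre @ map Some p @ (Some c # rest)"
    using snoc.prems by simp
  ultimately show ?case
    using snoc.IH lscan_letter[of w "length pre + length (p @ [c])" c]
      lside_letter[of w "length pre + length (p @ [c])" c] by simp
qed

lemma label_at_letter:
  assumes "w = pre @ map Some p @ Some c # rest" "pre = [] \<or> last pre = None"
  shows "label_at w (Suc (length pre + length p)) = acts (bar p) (edge c)"
proof -
  have c: "input_at w (Suc (length pre + length p)) = Input (Some c)"
    using assms(1) by (simp add: input_at_def nth_append)
  then show ?thesis
    using lscan_block[OF assms(1,2)] lscan_letter[OF c] by (cases c) (simp_all add: label_at_def)
qed

lemma label_at_end:
  assumes "w = pre @ map Some u @ rest" "pre = [] \<or> last pre = None" "rest = [] \<or> hd rest = None"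
  shows "label_at w (Suc (length pre + length u)) = acts (bar u) one"
proof -
  have "input_at w (Suc (length pre + length u)) \<in> {Input None, Right_End}"
    using assms by (cases rest) (auto simp: input_at_def nth_append)
  then show ?thesis
    using lscan_block[OF assms(1,2)] by (auto simp: label_at_def)
qed

lemma label_at_image:
  assumes "w = pre @ map Some u @ rest" "pre = [] \<or> last pre = None" "rest = [] \<or> hd rest = None"
  shows "label_at w ` {Suc (length pre)..Suc (length pre + length u)} = all_labels u"
proof (rule subset_antisym; rule subsetI)
  fix f assume "f \<in> label_at w ` {Suc (length pre)..Suc (length pre + length u)}"
  then obtain i where i: "i \<in> {Suc (length pre)..Suc (length pre + length u)}" "f = label_at w i"
    by blast
  then obtain k where "i = Suc (length pre) + k"
    using le_Suc_ex[of "Suc (length pre)" i] by auto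
  then have k: "k \<le> length u" "f = label_at w (Suc (length pre + k))"
    using i by auto
  show "f \<in> all_labels u"
  proof (cases "k = length u")
    case True
    then show ?thesis
      using k label_at_end[OF assms] by (simp add: all_labels_def)
  next
    case False
    then have u: "u = take k u @ u ! k # drop (Suc k) u"
      using k by (intro id_take_nth_drop) simp
    then have "w = pre @ map Some (take k u) @ Some (u ! k) # (map Some (drop (Suc k) u) @ rest)"
      using assms(1) by (metis append.assoc append_Cons list.simps(9) map_append)
    then have "f = acts (bar (take k u)) (edge (u ! k))"
      using label_at_letter[OF _ assms(2), of w "take k u" "u ! k"] k by simp
    then show ?thesis
      using u unfolding all_labels_def mem_labels_iff insert_iff by blast
  qed
next
  fix f assume "f \<in> all_labels u"
  then consider "f = acts (bar u) one" | p c q where "u = p @ c # q" "f = acts (bar p) (edge c)"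
    unfolding all_labels_def insert_iff mem_labels_iff by blast
  then show "f \<in> label_at w ` {Suc (length pre)..Suc (length pre + length u)}"
  proof cases
    case 1
    then show ?thesis
      using label_at_end[OF assms] by (intro image_eqI[of _ _ "Suc (length pre + length u)"]) auto
  next
    case 2
    then have "f = label_at w (Suc (length pre + length p))"
      using label_at_letter[OF _ assms(2), of w p c "map Some q @ rest"] assms(1) by simp
    then show ?thesis
      using 2(1) by auto
  qed
qed

lemma lside_block:
  assumes "w = pre @ map Some u @ rest" "pre = [] \<or> last pre = None"
    and "i \<in> {Suc (length pre)..Suc (length pre + length u)}"
  shows "lside w (i - 1) \<longleftrightarrow> pre \<noteq> []"
proof -
  obtain k where k: "k \<le> length u" "i - 1 = length pre + k"
    using assms(3) by (auto simp: le_iff_add)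
  have "w = pre @ map Some (take k u) @ (map Some (drop k u) @ rest)"
    using assms(1) by (metis append.assoc append_take_drop_id map_append)
  then show ?thesis
    using lscan_block[OF _ assms(2), of w "take k u"] k by simp
qed

text \<open>As partners must lie on opposite sides, the single condition over all positions splits
  into the two inclusions between the label sets.\<close>

lemma pair_word_matches_iff:
  assumes w: "w = pair_word u v"
  shows "(\<forall>i \<in> {1..Suc (length w)}. \<exists>j \<in> {1..Suc (length w)}.
      lside w (i - 1) \<noteq> lside w (j - 1) \<and> label_at w i = label_at w j) \<longleftrightarrow>
    all_labels u = all_labels v"
proof -
  let ?pre = "map Some u @ [None]"
  let ?U = "{Suc 0..Suc (length u)}" and ?V = "{Suc (length ?pre)..Suc (length ?pre + length v)}"
  have w1: "w = [] @ map Some u @ (None # map Some v)" and w2: "w = ?pre @ map Some v @ []"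
    using w by (simp_all add: pair_word_def)
  have lab: "label_at w ` ?U = all_labels u" "label_at w ` ?V = all_labels v"
    using label_at_image[OF w1] label_at_image[OF w2] by simp_all
  have side: "i \<in> ?U \<Longrightarrow> \<not> lside w (i - 1)" "i \<in> ?V \<Longrightarrow> lside w (i - 1)" for i
    using lside_block[OF w1, of i] lside_block[OF w2, of i] by simp_all
  \<comment> \<open>The separator at \<open>length u + 1\<close> closes the first block, and the
    right end marker at \<open>length w + 1\<close> closes the second.\<close>
  have "{1..Suc (length w)} = ?U \<union> ?V"
    using w by (auto simp: pair_word_def)
  then have "(\<forall>i \<in> {1..Suc (length w)}. \<exists>j \<in> {1..Suc (length w)}.
      lside w (i - 1) \<noteq> lside w (j - 1) \<and> label_at w i = label_at w j) \<longleftrightarrow>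
    (\<forall>i \<in> ?U. \<exists>j \<in> ?V. label_at w i = label_at w j) \<and> (\<forall>i \<in> ?V. \<exists>j \<in> ?U. label_at w i = label_at w j)"
    using side by (simp only: ball_Un bex_Un) meson
  also have "\<dots> \<longleftrightarrow> label_at w ` ?U = label_at w ` ?V"
    by (simp only: set_eq_subset image_subset_iff image_iff)
  finally show ?thesis
    using lab by simp
qed

end

lemma num_seps_pair_word: "num_seps (pair_word u v) = 1"
  by (simp add: num_seps_def pair_word_def)

lemma pair_word_if_num_seps:
  assumes "num_seps w = 1"
  obtains u v where "w = pair_word u v"
proof -
  have "None \<in> set w"
    using assms by (auto simp: num_seps_def length_Suc_conv filter_eq_Cons_iff)
  then obtain p q where w: "w = p @ None # q"
    by (meson split_list)
  have some: "\<exists>u. r = map Some u" if "None \<notin> set r" for r :: "'a option list"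
    unfolding ex_map_conv using that by (metis not_None_eq)
  have "None \<notin> set p" "None \<notin> set q"
    using assms w by (auto simp: num_seps_def filter_empty_conv)
  then obtain u v where "p = map Some u" "q = map Some v"
    using some by blast
  then show ?thesis
    using w that[of u v] by (simp add: pair_word_def)
qed

lemma pair_word_in_lists: "pair_word u v \<in> lists (pair_alphabet A) \<longleftrightarrow> u \<in> lists A \<and> v \<in> lists A"
  by (simp add: pair_word_def pair_alphabet_def) (auto simp: subset_iff)

theorem theorem8:
  fixes \<Sigma> :: "'a set" and I :: "('a \<times> 'a) set"
  assumes "independence_alphabet \<Sigma> I"
  shows "in_DLOGSPACE (pair_alphabet (Gam \<Sigma>)) (FPCIM_word_problem \<Sigma> I)"
proof -
  have fin: "finite \<Sigma>" and sub: "I \<subseteq> \<Sigma> \<times> \<Sigma>" and "irrefl I" "Relation.sym I"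
    using assms by (simp_all add: independence_alphabet_def)
  have finG: "finite (Gam \<Sigma>)"
    using fin by (simp add: Gam_def)
  obtain sites where "set sites = \<Sigma> \<times> (UNIV :: bool set)" "distinct sites"
    using finite_distinct_list[of "\<Sigma> \<times> (UNIV :: bool set)"] fin by auto
  moreover obtain letters where "set letters = Gam \<Sigma>"
    using finite_list[OF finG] by auto
  ultimately interpret label_program \<Sigma> I sites letters
    using \<open>irrefl I\<close> \<open>Relation.sym I\<close> by unfold_locales
  show ?thesis
  proof (rule in_DLOGSPACE_if_exec)
    show "finite (pair_alphabet (Gam \<Sigma>))"
      using finG by (simp add: pair_alphabet_def)
    show "FPCIM_word_problem \<Sigma> I \<subseteq> lists (pair_alphabet (Gam \<Sigma>))"
      unfolding FPCIM_word_problem_def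
    proof (rule subsetI, elim CollectE exE conjE)
      fix w and u v :: "('a + 'a) list"
      assume "w = pair_word u v" "u \<in> lists (Gam \<Sigma>)" "v \<in> lists (Gam \<Sigma>)"
      then show "w \<in> lists (pair_alphabet (Gam \<Sigma>))"
        by (simp only: pair_word_in_lists)
    qed
    fix w :: "('a + 'a) option list" assume w: "w \<in> lists (pair_alphabet (Gam \<Sigma>))"
    let ?L = "{1..Suc (length w)}"
    have "num_seps w = 1 \<and> (\<forall>i \<in> ?L. \<exists>j \<in> ?L. all_match w (8 * length w + 6) i j) \<longleftrightarrow>
        num_seps w = 1 \<and> (\<forall>i \<in> ?L. \<exists>j \<in> ?L. lside w (i - 1) \<noteq> lside w (j - 1) \<and> label_at w i = label_at w j)"
      by (intro conj_cong ball_cong bex_cong HOL.refl all_match_iff[OF w sub]) auto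
    also have "\<dots> \<longleftrightarrow> w \<in> FPCIM_word_problem \<Sigma> I"
    proof
      assume l: "num_seps w = 1 \<and>
        (\<forall>i \<in> ?L. \<exists>j \<in> ?L. lside w (i - 1) \<noteq> lside w (j - 1) \<and> label_at w i = label_at w j)"
      then obtain u v where uv: "w = pair_word u v"
        using pair_word_if_num_seps[of w] by blast
      have in_lists: "u \<in> lists (Gam \<Sigma>)" "v \<in> lists (Gam \<Sigma>)"
        using w pair_word_in_lists[of u v "Gam \<Sigma>"] unfolding uv by blast+
      have "fpcim_val \<Sigma> I u = fpcim_val \<Sigma> I v"
        using l pair_word_matches_iff[OF uv] fpcim_val_eq_iff_labels[OF in_lists sub] by blast
      then show "w \<in> FPCIM_word_problem \<Sigma> I"
        using uv in_lists unfolding FPCIM_word_problem_def by blast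
    next
      assume "w \<in> FPCIM_word_problem \<Sigma> I"
      then obtain u v where uv: "w = pair_word u v" "u \<in> lists (Gam \<Sigma>)" "v \<in> lists (Gam \<Sigma>)"
        "fpcim_val \<Sigma> I u = fpcim_val \<Sigma> I v"
        unfolding FPCIM_word_problem_def by blast
      then show "num_seps w = 1 \<and>
        (\<forall>i \<in> ?L. \<exists>j \<in> ?L. lside w (i - 1) \<noteq> lside w (j - 1) \<and> label_at w i = label_at w j)"
        using pair_word_matches_iff[OF uv(1)] fpcim_val_eq_iff_labels[OF uv(2,3) sub]
          num_seps_pair_word by blast
    qed
    finally have correct: "num_seps w = 1 \<and> (\<forall>i \<in> ?L. \<exists>j \<in> ?L. all_match w (8 * length w + 6) i j) \<longleftrightarrow>
        w \<in> FPCIM_word_problem \<Sigma> I" .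
    \<comment> \<open>The largest register content is the bound \<open>8 * length w + 6\<close>;
      \<open>8 * length w + 8\<close> is a bound of the required form
      \<open>k * length w + k\<close>.\<close>
    show "\<exists>p st. exec w (8 * length w + 8) word_problem_com (0, \<lambda>_. 0) (p, st) \<and>
        (st Fail = 0 \<longleftrightarrow> w \<in> FPCIM_word_problem \<Sigma> I)"
      using runs_word_problem_com[OF w] unfolding runs_def correct .
  qed
qed

end
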